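(* Let $W:\mathbb{R}^m\to\mathbb{R}$ be $C^{1,1}_{loc}$ and nonnegative, with $W(a)=0$ for some $a\in\mathbb{R}^m$. Assume there is $r_0>0$ such that for every $\nu\in\mathbb{S}^{m-1}$ the function $r\mapsto W(a+r\nu)$ is nondecreasing on $(0,r_0]$, and that $W(u)>0$ whenever $|u-a|<2r_0$ and $u\neq a$. Let $\Omega\subset\mathbb{R}^n$ be an open, connected, bounded set with Lipschitz continuous boundary, and let $u\in W^{1,2}(\Omega;\mathbb{R}^m)\cap L^\infty(\Omega;\mathbb{R}^m)$ be minimal in the sense that $E(u;\Omega)\leq E(u+\varphi;\Omega)$ for every $\varphi\in W^{1,2}_0(\Omega;\mathbb{R}^m)\cap L^\infty(\Omega;\mathbb{R}^m)$. If $|u(x)-a|\leq r$ for $x\in\partial\Omega$, for some $r\in(0,\frac{r_0}{2})$, then $|u(x)-a|\leq r$ for all $x\in\Omega$.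
   Context: The energy is $E(v;\Omega)=\int_\Omega\{\frac12|\nabla v|^2+W(v)\}dx$, where $|\nabla v|^2=\sum_{i=1}^n|v_{x_i}|^2$. *)

theory Defs
  imports "HOL-Analysis.Analysis"
begin

definition partial_deriv :: "'n::finite \<Rightarrow> (real^'n \<Rightarrow> 'b::real_normed_vector) \<Rightarrow> real^'n \<Rightarrow> 'b" where
  "partial_deriv i f x = frechet_derivative f (at x) (axis i 1)"

fun iter_partial :: "'n::finite list \<Rightarrow> (real^'n \<Rightarrow> 'b::real_normed_vector) \<Rightarrow> real^'n \<Rightarrow> 'b" where
  "iter_partial [] f = f"
| "iter_partial (i # is) f = partial_deriv i (iter_partial is f)"

definition smooth_fun :: "(real^'n::finite \<Rightarrow> 'b::real_normed_vector) \<Rightarrow> bool" where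
  "smooth_fun f \<longleftrightarrow> (\<forall>is x. iter_partial is f differentiable (at x))"

definition test_fun :: "(real^'n::finite) set \<Rightarrow> (real^'n \<Rightarrow> 'b::real_normed_vector) \<Rightarrow> bool" where
  "test_fun \<Omega> \<phi> \<longleftrightarrow> smooth_fun \<phi> \<and>
     compact (closure {x. \<phi> x \<noteq> 0}) \<and> closure {x. \<phi> x \<noteq> 0} \<subseteq> \<Omega>"

definition weak_gradient :: "(real^'n::finite) set \<Rightarrow> (real^'n \<Rightarrow> 'b::euclidean_space) \<Rightarrow> (real^'n \<Rightarrow> 'b^'n) \<Rightarrow> bool" where
  "weak_gradient \<Omega> u G \<longleftrightarrow>
     (\<forall>K. compact K \<and> K \<subseteq> \<Omega> \<longrightarrow>
          integrable (lebesgue_on K) u \<and> (\<forall>i. integrable (lebesgue_on K) (\<lambda>x. G x $ i))) \<and>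
     (\<forall>i. \<forall>\<phi>::real^'n \<Rightarrow> real. test_fun \<Omega> \<phi> \<longrightarrow>
          integral\<^sup>L (lebesgue_on \<Omega>) (\<lambda>x. partial_deriv i \<phi> x *\<^sub>R u x)
          = - integral\<^sup>L (lebesgue_on \<Omega>) (\<lambda>x. \<phi> x *\<^sub>R G x $ i))"

definition sobolev_W12 :: "(real^'n::finite) set \<Rightarrow> (real^'n \<Rightarrow> 'b::euclidean_space) \<Rightarrow> bool" where
  "sobolev_W12 \<Omega> u \<longleftrightarrow>
     u \<in> borel_measurable (lebesgue_on \<Omega>) \<and>
     integrable (lebesgue_on \<Omega>) (\<lambda>x. (norm (u x))\<^sup>2) \<and>
     (\<exists>G. weak_gradient \<Omega> u G \<and> G \<in> borel_measurable (lebesgue_on \<Omega>) \<and>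
          integrable (lebesgue_on \<Omega>) (\<lambda>x. (norm (G x))\<^sup>2))"

definition sobolev_W12_0 :: "(real^'n::finite) set \<Rightarrow> (real^'n \<Rightarrow> 'b::euclidean_space) \<Rightarrow> bool" where
  "sobolev_W12_0 \<Omega> u \<longleftrightarrow>
     sobolev_W12 \<Omega> u \<and>
     (\<exists>G \<phi>. weak_gradient \<Omega> u G \<and> (\<forall>k. test_fun \<Omega> (\<phi> k)) \<and>
        ((\<lambda>k. \<integral>\<^sup>+ x. ennreal ((norm (\<phi> k x - u x))\<^sup>2
                 + (\<Sum>i\<in>UNIV. (norm (partial_deriv i (\<phi> k) x - G x $ i))\<^sup>2)) \<partial>lebesgue_on \<Omega>)
          \<longlonglongrightarrow> 0))"

definition L_infty :: "(real^'n::finite) set \<Rightarrow> (real^'n \<Rightarrow> 'b::euclidean_space) \<Rightarrow> bool" where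
  "L_infty \<Omega> u \<longleftrightarrow> u \<in> borel_measurable (lebesgue_on \<Omega>) \<and>
     (\<exists>C. AE x in lebesgue_on \<Omega>. norm (u x) \<le> C)"

text \<open>The (a.e. unique) weak gradient; |grad v|^2 = sum over i,j of |d v_j / d x_i|^2 = norm squared.\<close>
definition sobolev_grad :: "(real^'n::finite) set \<Rightarrow> (real^'n \<Rightarrow> 'b::euclidean_space) \<Rightarrow> real^'n \<Rightarrow> 'b^'n" where
  "sobolev_grad \<Omega> u = (SOME G. weak_gradient \<Omega> u G)"

definition energy :: "('b::euclidean_space \<Rightarrow> real) \<Rightarrow> (real^'n::finite) set \<Rightarrow> (real^'n \<Rightarrow> 'b) \<Rightarrow> ennreal" where
  "energy W \<Omega> v = (\<integral>\<^sup>+ x. ennreal (1/2 * (norm (sobolev_grad \<Omega> v x))\<^sup>2 + W (v x)) \<partial>lebesgue_on \<Omega>)"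

definition C11_loc :: "('b::euclidean_space \<Rightarrow> real) \<Rightarrow> bool" where
  "C11_loc W \<longleftrightarrow> (\<exists>g. (\<forall>x. (W has_derivative (\<lambda>h. g x \<bullet> h)) (at x)) \<and>
                      (\<forall>x. \<exists>\<epsilon>>0. \<exists>L. L-lipschitz_on (ball x \<epsilon>) g))"

text \<open>Lipschitz boundary: near every boundary point, after a rotation, Omega is the
  region below the graph of a Lipschitz function over the orthogonal hyperplane.\<close>
definition lipschitz_boundary :: "(real^'n::finite) set \<Rightarrow> bool" where
  "lipschitz_boundary \<Omega> \<longleftrightarrow>
     (\<forall>p\<in>frontier \<Omega>. \<exists>\<rho>>0. \<exists>e \<gamma> L. norm e = 1 \<and>
        L-lipschitz_on {y. y \<bullet> e = 0} (\<gamma> :: real^'n \<Rightarrow> real) \<and>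
        \<Omega> \<inter> ball p \<rho> = {x \<in> ball p \<rho>. x \<bullet> e < \<gamma> (x - (x \<bullet> e) *\<^sub>R e)})"

end

theory Submission
  imports Defs
begin

text \<open>
  The comparison function is \<open>P \<circ> u\<close>, where \<open>P (a + s \<nu>) = a + \<alpha> s \<nu>\<close> and \<open>\<alpha>\<close> is the identity on
  \<open>[0, r]\<close>, has \<open>\<bar>\<alpha>'\<bar> < 1\<close> beyond \<open>r\<close>, and vanishes beyond \<open>r0\<close>; such an \<open>\<alpha>\<close> exists because \<open>2 r < r0\<close>.
  The monotonicity of \<open>W\<close> on rays and \<open>W a = 0 \<le> W\<close> give \<open>W \<circ> P \<le> W\<close>, while splitting a gradient into
  its radial and tangential parts gives
  \<open>\<bar>\<nabla>(P \<circ> u)\<bar>\<^sup>2 \<le> \<bar>\<nabla>u\<bar>\<^sup>2 - (1 - \<alpha>'\<^sup>2) \<bar>\<nabla>\<bar>u - a\<bar>\<bar>\<^sup>2\<close>. As \<open>P \<circ> u - u\<close> is an admissible variation,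
  minimality forces \<open>\<nabla>\<bar>u - a\<bar> = 0\<close> where \<open>\<bar>u - a\<bar> > r\<close>. Hence \<open>(\<bar>u - a\<bar> - r)\<^sup>+\<close> has zero gradient and
  vanishes on the boundary, so it is zero.

  To stay within \<open>C\<^sup>1\<close> chain rules, \<open>\<alpha>\<close> is chosen \<open>C\<^sup>1\<close>, and the conclusion is drawn for \<open>T (\<bar>u - a\<bar> - r)\<close>
  with \<open>T t = r + t - \<alpha> (r + t)\<close>, which vanishes to second order at \<open>0\<close>.
\<close>

subsection \<open>Continuity of translations in the mean\<close>

text \<open>The profile has to reach \<open>0\<close> by \<open>r0\<close> because the monotonicity
  of \<open>W\<close> on rays ends there; farther out the only comparison available is
  \<open>W a = 0\<close>. Descending from \<open>r\<close> to \<open>0\<close> over the length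
  \<open>r0 - r\<close> with slope strictly above \<open>-1\<close> is possible exactly when
  \<open>r < r0 - r\<close>. Strictness matters: it turns equality of the energies into a vanishing
  radial gradient.

  The boundary condition is the hypothesis that \<open>v = max 0 (norm (u - a) - r)\<close> lies in
  \<open>sobolev_W12_0\<close>, so the admissibility of the variation must come from this alone. The
  variation is therefore factored as \<open>- T v\<close> times \<open>N u\<close>, where
  \<open>N\<close> extends the radial unit field, and approximations of \<open>v\<close> by test
  functions are carried over to the product.

  Everything before the radial map serves this: \<open>energy\<close> uses an arbitrarily chosen
  weak gradient, so weak gradients must be shown unique, and both the chain rule and the passage
  from compactly supported Sobolev functions to test functions go through mollification.\<close>

lemma nn_integral_lborel_shift:
  fixes f :: "'a::euclidean_space \<Rightarrow> ennreal"
  assumes [measurable]: "f \<in> borel_measurable borel"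
  shows "(\<integral>\<^sup>+x. f (z + x) \<partial>lborel) = (\<integral>\<^sup>+x. f x \<partial>lborel)"
proof -
  have "(\<integral>\<^sup>+x. f x \<partial>lborel) = (\<integral>\<^sup>+x. f x \<partial>distr lborel borel ((+) z))"
    by (simp add: lborel_distr_plus)
  also have "\<dots> = (\<integral>\<^sup>+x. f (z + x) \<partial>lborel)"
    by (subst nn_integral_distr) auto
  finally show ?thesis by simp
qed

text \<open>The gauge \<open>N\<close> is left open so that one mollification argument serves both
  \<open>L1\<close> (\<open>abs\<close>) and \<open>L2\<close> (the square, without a root).\<close>

definition shift_continuous :: "('a::euclidean_space \<Rightarrow> real) \<Rightarrow> (real \<Rightarrow> real) \<Rightarrow> bool" where
  "shift_continuous f N \<longleftrightarrow>
     (\<forall>e>0. \<exists>d>0. \<forall>z. norm z < d \<longrightarrow> (\<integral>\<^sup>+x. ennreal (N (f (z + x) - f x)) \<partial>lborel) \<le> ennreal e)"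

lemma shift_continuousE:
  assumes "shift_continuous f N" "e > 0"
  obtains d where "d > 0" "\<And>z. norm z < d \<Longrightarrow> (\<integral>\<^sup>+x. ennreal (N (f (z + x) - f x)) \<partial>lborel) \<le> ennreal e"
  using assms unfolding shift_continuous_def by blast

text \<open>Outer regularity gives an open \<open>U\<close> around \<open>A\<close> with little
  excess. A point that a short shift moves out of \<open>A\<close> either lands in
  \<open>U - A\<close> or was already close to the complement of \<open>U\<close>, and both sets are
  small.\<close>

lemma shift_continuous_indicator:
  fixes A :: "'a::euclidean_space set"
  assumes [measurable]: "A \<in> sets borel" and fin: "emeasure lborel A < \<infinity>"
  shows "shift_continuous (\<lambda>x. indicator A x * c) abs"
  unfolding shift_continuous_def
proof (intro allI impI)
  fix e :: real assume "e > 0"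
  \<comment> \<open>The \<open>4\<close> counts two directions (points leaving and points entering
    \<open>A\<close>) with two small sets each; the \<open>+ 1\<close> guards against
    \<open>c = 0\<close>.\<close>
  define e' where "e' = e / (4 * (\<bar>c\<bar> + 1))"
  have e': "e' > 0" using \<open>e > 0\<close> by (simp add: e'_def add_pos_nonneg)
  obtain U where U: "open U" "A \<subseteq> U" and small: "emeasure lborel (U - A) < e'"
    using outer_regular_lborel[OF assms(1) e'] by auto
  have [measurable]: "U \<in> sets borel" using U by auto
  \<comment> \<open>The points of \<open>A\<close> near the complement of \<open>U\<close>. These
    sets decrease to the empty set because \<open>U\<close> is open, and finiteness of the measure
    of \<open>A\<close> makes their measures tend to \<open>0\<close>.\<close>
  define B where "B n = A \<inter> (\<Union>y\<in>-U. ball y (1 / real (Suc n)))" for n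
  have Bo: "open (\<Union>y\<in>-U. ball y (1 / real (Suc n)))" for n by auto
  have Bm [measurable]: "B n \<in> sets borel" for n unfolding B_def using Bo by auto
  have "(\<lambda>n. emeasure lborel (B n)) \<longlonglongrightarrow> emeasure lborel (\<Inter>n. B n)"
  proof (rule Lim_emeasure_decseq)
    show "range B \<subseteq> sets lborel" by auto
    show "decseq B"
    proof (rule decseq_SucI, rule subsetI)
      fix n x assume "x \<in> B (Suc n)"
      moreover have "1 / real (Suc (Suc n)) \<le> 1 / real (Suc n)" by (simp add: field_simps)
      ultimately show "x \<in> B n" unfolding B_def by fastforce
    qed
    fix n show "emeasure lborel (B n) \<noteq> \<infinity>"
      using fin emeasure_mono[of "B n" A lborel] unfolding B_def by (auto simp: top_unique)
  qed
  moreover have "(\<Inter>n. B n) = {}"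
  proof (rule ccontr)
    assume "(\<Inter>n. B n) \<noteq> {}"
    then obtain x where x: "\<And>n. x \<in> B n" by auto
    then have "x \<in> U" using U by (auto simp: B_def)
    then obtain d where d: "d > 0" "ball x d \<subseteq> U" using U openE by blast
    obtain n where n: "1 / real (Suc n) < d" using d by (metis inverse_eq_divide reals_Archimedean)
    from x[of n] obtain y where "y \<notin> U" "dist y x < 1 / real (Suc n)" by (auto simp: B_def)
    with n d show False by (auto simp: subset_iff dist_commute)
  qed
  ultimately have "(\<lambda>n. emeasure lborel (B n)) \<longlonglongrightarrow> 0" by simp
  then have "eventually (\<lambda>n. emeasure lborel (B n) < e') sequentially"
    using e' order_tendstoD(2) by (metis ennreal_0 ennreal_lessI)
  then obtain n where n: "emeasure lborel (B n) < e'" by (auto simp: eventually_sequentially)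
  have half: "emeasure lborel {x\<in>A. z + x \<notin> A} \<le> ennreal (2 * e')" if z: "norm z < 1 / real (Suc n)" for z
  proof -
    have sub: "{x\<in>A. z + x \<notin> A} \<subseteq> B n \<union> {x. z + x \<in> U - A}"
    proof
      fix x assume x: "x \<in> {x\<in>A. z + x \<notin> A}"
      show "x \<in> B n \<union> {x. z + x \<in> U - A}"
      proof (cases "z + x \<in> U")
        case False
        moreover have "dist (z + x) x < 1 / real (Suc n)" using z by (simp add: dist_norm)
        ultimately show ?thesis using x unfolding B_def by auto
      qed (use x in auto)
    qed
    have "emeasure lborel {x. z + x \<in> U - A} = (\<integral>\<^sup>+x. indicator {x. z + x \<in> U - A} x \<partial>lborel)"
      by (rule nn_integral_indicator[symmetric]) measurable
    also have "\<dots> = (\<integral>\<^sup>+x. indicator (U - A) (z + x) \<partial>lborel)"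
      by (rule nn_integral_cong) (simp add: indicator_def)
    also have "\<dots> = emeasure lborel (U - A)" by (subst nn_integral_lborel_shift) auto
    finally have eq: "emeasure lborel {x. z + x \<in> U - A} = emeasure lborel (U - A)" .
    have "emeasure lborel {x\<in>A. z + x \<notin> A} \<le> emeasure lborel (B n \<union> {x. z + x \<in> U - A})"
      by (rule emeasure_mono[OF sub]) measurable
    also have "\<dots> \<le> emeasure lborel (B n) + emeasure lborel {x. z + x \<in> U - A}"
      by (rule emeasure_subadditive) measurable
    also have "\<dots> \<le> ennreal e' + ennreal e'" unfolding eq using n small by (intro add_mono) auto
    also have "\<dots> = ennreal (2 * e')" using e' by (simp flip: ennreal_plus)
    finally show ?thesis .
  qed
  show "\<exists>d>0. \<forall>z. norm z < d \<longrightarrow> (\<integral>\<^sup>+x. ennreal \<bar>indicator A (z + x) * c - indicator A x * c\<bar> \<partial>lborel) \<le> ennreal e"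
  proof (intro exI[of _ "1 / real (Suc n)"] conjI allI impI)
    fix z :: 'a assume z: "norm z < 1 / real (Suc n)"
    \<comment> \<open>A point \<open>x\<close> enters \<open>A\<close> under the shift by
      \<open>z\<close> exactly when \<open>z + x\<close> leaves \<open>A\<close> under the shift by
      \<open>-z\<close>, so the bound \<open>half\<close> covers both kinds.\<close>
    have "(\<integral>\<^sup>+x. ennreal \<bar>indicator A (z + x) * c - indicator A x * c\<bar> \<partial>lborel)
      = (\<integral>\<^sup>+x. ennreal \<bar>c\<bar> * indicator {x\<in>A. z + x \<notin> A} x + ennreal \<bar>c\<bar> * indicator {y\<in>A. - z + y \<notin> A} (z + x) \<partial>lborel)"
      by (rule nn_integral_cong) (auto simp: indicator_def)
    also have "\<dots> = ennreal \<bar>c\<bar> * emeasure lborel {x\<in>A. z + x \<notin> A}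
        + (\<integral>\<^sup>+x. ennreal \<bar>c\<bar> * indicator {y\<in>A. - z + y \<notin> A} (z + x) \<partial>lborel)"
      by (subst nn_integral_add) (auto simp: nn_integral_cmult)
    also have "(\<integral>\<^sup>+x. ennreal \<bar>c\<bar> * indicator {y\<in>A. - z + y \<notin> A} (z + x) \<partial>lborel)
        = ennreal \<bar>c\<bar> * emeasure lborel {y\<in>A. - z + y \<notin> A}"
      by (subst nn_integral_lborel_shift) (auto simp: nn_integral_cmult)
    also have "ennreal \<bar>c\<bar> * emeasure lborel {x\<in>A. z + x \<notin> A} + ennreal \<bar>c\<bar> * emeasure lborel {y\<in>A. - z + y \<notin> A}
      \<le> ennreal \<bar>c\<bar> * ennreal (2 * e') + ennreal \<bar>c\<bar> * ennreal (2 * e')"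
      using half[of z] half[of "-z"] z by (intro add_mono mult_left_mono) auto
    also have "\<dots> = ennreal (\<bar>c\<bar> * (4 * e'))"
      using e' by (simp flip: ennreal_plus ennreal_mult')
    also have "\<dots> \<le> ennreal e"
      using \<open>e > 0\<close> by (intro ennreal_leI) (simp add: e'_def field_simps)
    finally show "(\<integral>\<^sup>+x. ennreal \<bar>indicator A (z + x) * c - indicator A x * c\<bar> \<partial>lborel) \<le> ennreal e" .
  qed auto
qed

text \<open>The property holds for scaled indicators and survives sums and \<open>L1\<close> limits.
  The limit case is a three-epsilon argument in which translation invariance makes the two outer
  errors equal.\<close>

lemma shift_continuous_L1:
  fixes f :: "'a::euclidean_space \<Rightarrow> real"
  assumes "integrable lborel f"
  shows "shift_continuous f abs"
  using assms
proof (induction rule: integrable_induct)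
  case (base A c)
  then show ?case using shift_continuous_indicator[of A c] by simp
next
  case (add f g)
  note [measurable] = \<open>integrable lborel f\<close>[THEN borel_measurable_integrable] \<open>integrable lborel g\<close>[THEN borel_measurable_integrable]
  note IH = \<open>shift_continuous f abs\<close> \<open>shift_continuous g abs\<close>
  show ?case unfolding shift_continuous_def
  proof (intro allI impI)
    fix e :: real assume e: "e > 0"
    then have "e / 2 > 0" by simp
    obtain d1 where d1: "d1 > 0"
      "\<And>z. norm z < d1 \<Longrightarrow> (\<integral>\<^sup>+x. ennreal \<bar>f (z + x) - f x\<bar> \<partial>lborel) \<le> ennreal (e / 2)"
      using shift_continuousE[OF IH(1) \<open>e / 2 > 0\<close>] by metis
    obtain d2 where d2: "d2 > 0"
      "\<And>z. norm z < d2 \<Longrightarrow> (\<integral>\<^sup>+x. ennreal \<bar>g (z + x) - g x\<bar> \<partial>lborel) \<le> ennreal (e / 2)"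
      using shift_continuousE[OF IH(2) \<open>e / 2 > 0\<close>] by metis
    note d = d1 d2
    show "\<exists>d>0. \<forall>z. norm z < d \<longrightarrow> (\<integral>\<^sup>+x. ennreal \<bar>f (z + x) + g (z + x) - (f x + g x)\<bar> \<partial>lborel) \<le> ennreal e"
    proof (intro exI[of _ "min d1 d2"] conjI allI impI)
      fix z :: 'a assume z: "norm z < min d1 d2"
      have "(\<integral>\<^sup>+x. ennreal \<bar>f (z + x) + g (z + x) - (f x + g x)\<bar> \<partial>lborel)
        \<le> (\<integral>\<^sup>+x. ennreal \<bar>f (z + x) - f x\<bar> + ennreal \<bar>g (z + x) - g x\<bar> \<partial>lborel)"
        by (rule nn_integral_mono) (auto simp flip: ennreal_plus intro!: ennreal_leI)
      also have "\<dots> \<le> ennreal (e / 2) + ennreal (e / 2)"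
        using d z by (subst nn_integral_add) (auto intro!: add_mono)
      also have "\<dots> = ennreal e" using e by (simp flip: ennreal_plus)
      finally show "(\<integral>\<^sup>+x. ennreal \<bar>f (z + x) + g (z + x) - (f x + g x)\<bar> \<partial>lborel) \<le> ennreal e" .
    qed (use d in auto)
  qed
next
  case (lim f s)
  have int: "integrable lborel f" "\<And>i. integrable lborel (s i)" by fact+
  note [measurable] = int[THEN borel_measurable_integrable]
  have conv: "(\<lambda>i. \<integral>\<^sup>+x. ennreal (norm (f x - s i x)) \<partial>lborel) \<longlonglongrightarrow> 0"
  proof (rule nn_integral_dominated_convergence_norm)
    show "AE x in lborel. norm (s j x) \<le> 2 * norm (f x)" for j
      using \<open>\<And>i x. x \<in> space lborel \<Longrightarrow> norm (s i x) \<le> 2 * norm (f x)\<close> by auto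
    show "(\<integral>\<^sup>+x. ennreal (2 * norm (f x)) \<partial>lborel) < \<infinity>"
      using int by (simp add: integrable_iff_bounded ennreal_mult nn_integral_cmult ennreal_mult_less_top)
    show "AE x in lborel. (\<lambda>i. s i x) \<longlonglongrightarrow> f x" using \<open>\<And>x. x \<in> space lborel \<Longrightarrow> (\<lambda>i. s i x) \<longlonglongrightarrow> f x\<close> by auto
  qed auto
  show ?case unfolding shift_continuous_def
  proof (intro allI impI)
    fix e :: real assume e: "e > 0"
    then have e3: "e / 3 > 0" by simp
    have "eventually (\<lambda>i. (\<integral>\<^sup>+x. ennreal (norm (f x - s i x)) \<partial>lborel) < ennreal (e / 3)) sequentially"
      by (rule order_tendstoD(2)[OF conv]) (use e3 in simp)
    from eventually_happens[OF this]
    obtain i where i: "(\<integral>\<^sup>+x. ennreal \<bar>f x - s i x\<bar> \<partial>lborel) < ennreal (e / 3)"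
      by auto
    have IH: "shift_continuous (s i) abs" by fact
    obtain d where d: "d > 0" "\<And>z. norm z < d \<Longrightarrow> (\<integral>\<^sup>+x. ennreal \<bar>s i (z + x) - s i x\<bar> \<partial>lborel) \<le> ennreal (e / 3)"
      using shift_continuousE[OF IH e3] by metis
    show "\<exists>d>0. \<forall>z. norm z < d \<longrightarrow> (\<integral>\<^sup>+x. ennreal \<bar>f (z + x) - f x\<bar> \<partial>lborel) \<le> ennreal e"
    proof (intro exI[of _ d] conjI allI impI)
      fix z :: 'a assume z: "norm z < d"
      have "(\<integral>\<^sup>+x. ennreal \<bar>f (z + x) - f x\<bar> \<partial>lborel)
        \<le> (\<integral>\<^sup>+x. (ennreal \<bar>f (z + x) - s i (z + x)\<bar> + ennreal \<bar>s i (z + x) - s i x\<bar>) + ennreal \<bar>f x - s i x\<bar> \<partial>lborel)"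
        by (rule nn_integral_mono) (auto simp flip: ennreal_plus intro!: ennreal_leI)
      also have "\<dots> = (\<integral>\<^sup>+x. ennreal \<bar>f (z + x) - s i (z + x)\<bar> \<partial>lborel)
          + (\<integral>\<^sup>+x. ennreal \<bar>s i (z + x) - s i x\<bar> \<partial>lborel) + (\<integral>\<^sup>+x. ennreal \<bar>f x - s i x\<bar> \<partial>lborel)"
        by (simp add: nn_integral_add)
      also have "(\<integral>\<^sup>+x. ennreal \<bar>f (z + x) - s i (z + x)\<bar> \<partial>lborel) = (\<integral>\<^sup>+x. ennreal \<bar>f x - s i x\<bar> \<partial>lborel)"
        by (rule nn_integral_lborel_shift) measurable
      also have "\<dots> + (\<integral>\<^sup>+x. ennreal \<bar>s i (z + x) - s i x\<bar> \<partial>lborel) + (\<integral>\<^sup>+x. ennreal \<bar>f x - s i x\<bar> \<partial>lborel)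
        \<le> ennreal (e / 3) + ennreal (e / 3) + ennreal (e / 3)"
        using i d(2)[OF z] by (intro add_mono) auto
      also have "\<dots> = ennreal e" using e by (simp flip: ennreal_plus)
      finally show "(\<integral>\<^sup>+x. ennreal \<bar>f (z + x) - f x\<bar> \<partial>lborel) \<le> ennreal e" .
    qed (use d in auto)
  qed
qed

text \<open>For nonnegative numbers \<open>(a - b)\<^sup>2 \<le> \<bar>a\<^sup>2 - b\<^sup>2\<bar>\<close>, so continuity of translations in
  \<open>L\<^sup>2\<close> follows from continuity in \<open>L\<^sup>1\<close> for the squares of the positive and negative parts.\<close>

lemma shift_continuous_L2:
  fixes f :: "'a::euclidean_space \<Rightarrow> real"
  assumes [measurable]: "f \<in> borel_measurable borel" and sq: "integrable lborel (\<lambda>x. (f x)\<^sup>2)"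
  shows "shift_continuous f (\<lambda>t. t\<^sup>2)"
proof -
  define p q where "p = (\<lambda>x. (max 0 (f x))\<^sup>2)" and "q = (\<lambda>x. (max 0 (- f x))\<^sup>2)"
  have int: "integrable lborel p" "integrable lborel q"
    by (auto intro!: Bochner_Integration.integrable_bound[OF sq] simp: p_def q_def max_def)
  note [measurable] = borel_measurable_integrable[OF int(1)] borel_measurable_integrable[OF int(2)]
  have nonneg_diff: "(a - b)\<^sup>2 \<le> \<bar>a\<^sup>2 - b\<^sup>2\<bar>" if "a \<ge> 0" "b \<ge> 0" for a b :: real
  proof -
    have "(a - b)\<^sup>2 = \<bar>a - b\<bar> * \<bar>a - b\<bar>" by (simp add: power2_eq_square)
    also have "\<dots> \<le> \<bar>a - b\<bar> * \<bar>a + b\<bar>" using that by (intro mult_left_mono) auto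
    also have "\<dots> = \<bar>a\<^sup>2 - b\<^sup>2\<bar>" by (simp add: abs_mult[symmetric] power2_eq_square algebra_simps)
    finally show ?thesis .
  qed
  have pw: "(s - t)\<^sup>2 \<le> 2 * \<bar>(max 0 s)\<^sup>2 - (max 0 t)\<^sup>2\<bar> + 2 * \<bar>(max 0 (-s))\<^sup>2 - (max 0 (-t))\<^sup>2\<bar>" for s t :: real
  proof -
    have "(s - t)\<^sup>2 = ((max 0 s - max 0 t) - (max 0 (-s) - max 0 (-t)))\<^sup>2" by (auto simp: max_def)
    also have "\<dots> \<le> 2 * (max 0 s - max 0 t)\<^sup>2 + 2 * (max 0 (-s) - max 0 (-t))\<^sup>2"
      using zero_le_power2[of "(max 0 s - max 0 t) + (max 0 (-s) - max 0 (-t))"]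
      by (simp add: power2_eq_square algebra_simps)
    also have "\<dots> \<le> 2 * \<bar>(max 0 s)\<^sup>2 - (max 0 t)\<^sup>2\<bar> + 2 * \<bar>(max 0 (-s))\<^sup>2 - (max 0 (-t))\<^sup>2\<bar>"
      by (intro add_mono mult_left_mono nonneg_diff) auto
    finally show ?thesis .
  qed
  show ?thesis unfolding shift_continuous_def
  proof (intro allI impI)
    fix e :: real assume e: "e > 0"
    then have "e / 4 > 0" by simp
    obtain d1 where d1: "d1 > 0"
      "\<And>z. norm z < d1 \<Longrightarrow> (\<integral>\<^sup>+x. ennreal \<bar>p (z + x) - p x\<bar> \<partial>lborel) \<le> ennreal (e / 4)"
      using shift_continuousE[OF shift_continuous_L1[OF int(1)] \<open>e / 4 > 0\<close>] by metis
    obtain d2 where d2: "d2 > 0"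
      "\<And>z. norm z < d2 \<Longrightarrow> (\<integral>\<^sup>+x. ennreal \<bar>q (z + x) - q x\<bar> \<partial>lborel) \<le> ennreal (e / 4)"
      using shift_continuousE[OF shift_continuous_L1[OF int(2)] \<open>e / 4 > 0\<close>] by metis
    note d = d1 d2
    show "\<exists>d>0. \<forall>z. norm z < d \<longrightarrow> (\<integral>\<^sup>+x. ennreal ((f (z + x) - f x)\<^sup>2) \<partial>lborel) \<le> ennreal e"
    proof (intro exI[of _ "min d1 d2"] conjI allI impI)
      fix z :: 'a assume z: "norm z < min d1 d2"
      have "(\<integral>\<^sup>+x. ennreal ((f (z + x) - f x)\<^sup>2) \<partial>lborel)
        \<le> (\<integral>\<^sup>+x. ennreal 2 * ennreal \<bar>p (z + x) - p x\<bar> + ennreal 2 * ennreal \<bar>q (z + x) - q x\<bar> \<partial>lborel)"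
      proof (rule nn_integral_mono)
        fix x
        have "ennreal ((f (z + x) - f x)\<^sup>2) \<le> ennreal (2 * \<bar>p (z + x) - p x\<bar> + 2 * \<bar>q (z + x) - q x\<bar>)"
          using pw[of "f (z + x)" "f x"] unfolding p_def q_def by (rule ennreal_leI)
        then show "ennreal ((f (z + x) - f x)\<^sup>2) \<le> ennreal 2 * ennreal \<bar>p (z + x) - p x\<bar> + ennreal 2 * ennreal \<bar>q (z + x) - q x\<bar>"
          by (simp only: ennreal_plus ennreal_mult abs_ge_zero mult_nonneg_nonneg zero_le_numeral)
      qed
      also have "\<dots> \<le> ennreal 2 * ennreal (e / 4) + ennreal 2 * ennreal (e / 4)"
        using d z by (subst nn_integral_add) (auto intro!: add_mono mult_left_mono simp: nn_integral_cmult)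
      also have "\<dots> = ennreal (2 * (e / 4) + 2 * (e / 4))" using e by (subst ennreal_plus) (auto simp only: ennreal_mult)
      also have "\<dots> = ennreal e" by simp
      finally show "(\<integral>\<^sup>+x. ennreal ((f (z + x) - f x)\<^sup>2) \<partial>lborel) \<le> ennreal e" .
    qed (use d in auto)
  qed
qed

subsection \<open>Mollification\<close>

definition kernel :: "('a::euclidean_space \<Rightarrow> real) \<Rightarrow> real \<Rightarrow> bool" where
  "kernel \<eta> d \<longleftrightarrow> continuous_on UNIV \<eta> \<and> (\<forall>x. 0 \<le> \<eta> x) \<and> (\<forall>x. d \<le> norm x \<longrightarrow> \<eta> x = 0)
     \<and> integrable lborel \<eta> \<and> integral\<^sup>L lborel \<eta> = 1"

text \<open>Convolution, taken over \<open>lebesgue\<close> because Sobolev functions are only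
  Lebesgue measurable.\<close>

definition mollify :: "('a::euclidean_space \<Rightarrow> real) \<Rightarrow> ('a \<Rightarrow> 'b::euclidean_space) \<Rightarrow> 'a \<Rightarrow> 'b" where
  "mollify \<eta> f x = integral\<^sup>L lebesgue (\<lambda>y. \<eta> (x - y) *\<^sub>R f y)"

lemma compact_support_bounded:
  fixes \<eta> :: "'a::euclidean_space \<Rightarrow> 'b::real_normed_vector"
  assumes "continuous_on UNIV \<eta>" "\<And>x. d \<le> norm x \<Longrightarrow> \<eta> x = 0"
  obtains B where "B > 0" "\<And>x. norm (\<eta> x) \<le> B"
proof -
  have "compact (\<eta> ` cball 0 d)"
    by (intro compact_continuous_image continuous_on_subset[OF assms(1)]) auto
  then obtain B where B: "B > 0" "\<And>x. x \<in> cball 0 d \<Longrightarrow> norm (\<eta> x) \<le> B"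
    by (force dest!: compact_imp_bounded simp: bounded_pos)
  have "norm (\<eta> x) \<le> B" for x
    using B assms(2)[of x] by (cases "norm x \<le> d") auto
  with B show ?thesis using that by blast
qed

lemma continuous_compact_support_integrable:
  fixes h :: "'a::euclidean_space \<Rightarrow> 'b::euclidean_space"
  assumes "continuous_on UNIV h" "\<And>x. d \<le> norm x \<Longrightarrow> h x = 0"
  shows "integrable lborel h"
proof -
  obtain B where B: "B > 0" "\<And>x. norm (h x) \<le> B" using compact_support_bounded[OF assms] by metis
  have "integrable lborel (\<lambda>x::'a. indicator (cball 0 d) x *\<^sub>R B)"
    using emeasure_compact_finite[of "cball (0::'a) d"]
    by (intro integrable_scaleR_left integrable_real_indicator) (auto simp: emeasure_lborel_cball_finite)
  then show ?thesis
  proof (rule Bochner_Integration.integrable_bound)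
    show "h \<in> borel_measurable lborel"
      using borel_measurable_continuous_onI[OF assms(1)] by simp
    show "AE x in lborel. norm (h x) \<le> norm (indicator (cball 0 d) x *\<^sub>R B)"
      using B assms(2) by (auto simp: indicator_def)
  qed
qed

lemma tendsto_0_if_le:
  fixes F :: "nat \<Rightarrow> ennreal"
  assumes "\<And>e::real. e > 0 \<Longrightarrow> \<forall>\<^sub>F k in sequentially. F k \<le> ennreal e"
  shows "F \<longlonglongrightarrow> 0"
proof (rule order_tendstoI)
  fix a :: ennreal assume "0 < a"
  then obtain e where e: "0 < e" "e < a" using dense by blast
  then have "e \<noteq> top" by auto
  then obtain e' where "e = ennreal e'" "0 \<le> e'" by (cases e) auto
  with e show "\<forall>\<^sub>F k in sequentially. F k < a"
    using assms[of e'] by (auto elim!: eventually_mono intro: le_less_trans)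
qed auto

lemma integral_lborel_reflect:
  fixes f :: "'a::euclidean_space \<Rightarrow> 'b::{banach, second_countable_topology}"
  assumes [measurable]: "f \<in> borel_measurable borel"
  shows "integral\<^sup>L lborel (\<lambda>x. f (z - x)) = integral\<^sup>L lborel f"
    and "integrable lborel (\<lambda>x. f (z - x)) \<longleftrightarrow> integrable lborel f"
proof -
  have eq: "lborel = distr lborel borel (\<lambda>x. z - x)"
    using lborel_affine[of "-1" z] by (simp add: density_1)
  show "integral\<^sup>L lborel (\<lambda>x. f (z - x)) = integral\<^sup>L lborel f"
    by (subst (2) eq, subst integral_distr) auto
  show "integrable lborel (\<lambda>x. f (z - x)) \<longleftrightarrow> integrable lborel f"
    by (subst (2) eq, subst integrable_distr_eq) auto
qed

lemma jensen_abs: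
  fixes w :: "'a::euclidean_space \<Rightarrow> real"
  assumes "integrable lborel (\<lambda>x. \<eta> x * w x)" and "\<And>x. 0 \<le> \<eta> x"
  shows "ennreal \<bar>integral\<^sup>L lborel (\<lambda>x. \<eta> x * w x)\<bar> \<le> (\<integral>\<^sup>+x. ennreal (\<eta> x * \<bar>w x\<bar>) \<partial>lborel)"
  using integral_norm_bound_ennreal[OF assms(1)] assms(2) by (simp add: abs_mult)

text \<open>Nonnegativity of the variance: expand the \<open>\<eta>\<close>-weighted integral of
  \<open>(w - m)\<^sup>2\<close> around the mean \<open>m\<close>. If the second moment is infinite
  there is nothing to show.\<close>

lemma jensen_square:
  fixes w :: "'a::euclidean_space \<Rightarrow> real"
  assumes int: "integrable lborel (\<lambda>x. \<eta> x * w x)" and \<eta>: "\<And>x. 0 \<le> \<eta> x" "integrable lborel \<eta>" "integral\<^sup>L lborel \<eta> = 1"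
    and w [measurable]: "w \<in> borel_measurable borel"
  shows "ennreal ((integral\<^sup>L lborel (\<lambda>x. \<eta> x * w x))\<^sup>2) \<le> (\<integral>\<^sup>+x. ennreal (\<eta> x * (w x)\<^sup>2) \<partial>lborel)"
proof (cases "integrable lborel (\<lambda>x. \<eta> x * (w x)\<^sup>2)")
  case True
  define m where "m = integral\<^sup>L lborel (\<lambda>x. \<eta> x * w x)"
  have eq: "\<eta> x * (w x - m)\<^sup>2 = \<eta> x * (w x)\<^sup>2 - 2 * m * (\<eta> x * w x) + m\<^sup>2 * \<eta> x" for x
    by (simp add: power2_eq_square algebra_simps)
  have "0 \<le> integral\<^sup>L lborel (\<lambda>x. \<eta> x * (w x - m)\<^sup>2)" using \<eta>(1) by simp
  also have "\<dots> = integral\<^sup>L lborel (\<lambda>x. \<eta> x * (w x)\<^sup>2) - 2 * m * m + m\<^sup>2 * 1"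
    unfolding eq using True int \<eta> by (simp add: m_def)
  finally have "m\<^sup>2 \<le> integral\<^sup>L lborel (\<lambda>x. \<eta> x * (w x)\<^sup>2)" by (simp add: power2_eq_square)
  then have "ennreal (m\<^sup>2) \<le> ennreal (integral\<^sup>L lborel (\<lambda>x. \<eta> x * (w x)\<^sup>2))" by (rule ennreal_leI)
  also have "\<dots> = (\<integral>\<^sup>+x. ennreal (\<eta> x * (w x)\<^sup>2) \<partial>lborel)"
    using True \<eta>(1) by (subst nn_integral_eq_integral) auto
  finally show ?thesis by (simp add: m_def)
next
  case False
  note [measurable] = borel_measurable_integrable[OF \<eta>(2)]
  have "(\<integral>\<^sup>+x. ennreal (\<eta> x * (w x)\<^sup>2) \<partial>lborel) = \<infinity>"
    using False \<eta>(1) by (simp add: integrable_iff_bounded not_less top_unique abs_mult)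
  then show ?thesis by simp
qed

lemma kernel_integrable:
  fixes f :: "'a::euclidean_space \<Rightarrow> 'b::euclidean_space"
  assumes \<eta>: "continuous_on UNIV \<eta>" "\<And>x. d \<le> norm x \<Longrightarrow> \<eta> x = 0" and f: "integrable lebesgue f"
  shows "integrable lebesgue (\<lambda>y. \<eta> (x - y) *\<^sub>R f y)"
proof -
  obtain B where B: "B > 0" "\<And>x. norm (\<eta> x) \<le> B" using compact_support_bounded[OF \<eta>] by metis
  have [measurable]: "\<eta> \<in> borel_measurable borel" using \<eta>(1) by (rule borel_measurable_continuous_onI)
  have [measurable]: "(\<lambda>y. \<eta> (x - y)) \<in> borel_measurable lebesgue"
    by (rule measurable_completion) simp
  note [measurable] = borel_measurable_integrable[OF f]
  show ?thesis
  proof (rule Bochner_Integration.integrable_bound)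
    show "integrable lebesgue (\<lambda>y. B *\<^sub>R f y)" using f by simp
    show "AE y in lebesgue. norm (\<eta> (x - y) *\<^sub>R f y) \<le> norm (B *\<^sub>R f y)"
      using B by (auto intro!: mult_right_mono)
  qed measurable
qed

lemma mollify_lborel:
  fixes f :: "'a::euclidean_space \<Rightarrow> 'b::euclidean_space"
  assumes \<eta>: "continuous_on UNIV \<eta>" and f: "f \<in> borel_measurable borel"
  shows "mollify \<eta> f x = integral\<^sup>L lborel (\<lambda>y. \<eta> (x - y) *\<^sub>R f y)"
proof -
  have [measurable]: "\<eta> \<in> borel_measurable borel" using \<eta>(1) by (rule borel_measurable_continuous_onI)
  note [measurable] = f
  show ?thesis unfolding mollify_def by (rule integral_completion) simp
qed

text \<open>The error is an \<open>\<eta>\<close>-average of \<open>f (x - z) - f x\<close>. Jensen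
  moves \<open>N\<close> under the average and Fubini exchanges the integrals; then every shift with
  \<open>norm z < d\<close> costs at most \<open>e\<close>, and the weights have total mass
  \<open>1\<close>. The radius \<open>d\<close> is the same for all kernels.\<close>

lemma mollify_approx:
  fixes f :: "'a::euclidean_space \<Rightarrow> real"
  assumes f: "integrable lborel f" and sc: "shift_continuous f N" and e: "e > 0"
    and N [measurable]: "N \<in> borel_measurable borel" and N0: "\<And>t. 0 \<le> N t"
    and jens: "\<And>(\<eta>::'a \<Rightarrow> real) w. integrable lborel \<eta> \<Longrightarrow> (\<And>x. 0 \<le> \<eta> x) \<Longrightarrow> integral\<^sup>L lborel \<eta> = 1 \<Longrightarrow>
        w \<in> borel_measurable borel \<Longrightarrow> integrable lborel (\<lambda>x. \<eta> x * w x) \<Longrightarrow>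
        ennreal (N (integral\<^sup>L lborel (\<lambda>x. \<eta> x * w x))) \<le> (\<integral>\<^sup>+x. ennreal (\<eta> x * N (w x)) \<partial>lborel)"
  obtains d where "d > 0"
    "\<And>\<eta>. kernel \<eta> d \<Longrightarrow> (\<integral>\<^sup>+x. ennreal (N (mollify \<eta> f x - f x)) \<partial>lborel) \<le> ennreal e"
proof -
  obtain d where d: "d > 0" "\<And>z. norm z < d \<Longrightarrow> (\<integral>\<^sup>+x. ennreal (N (f (z + x) - f x)) \<partial>lborel) \<le> ennreal e"
    using shift_continuousE[OF sc e] by metis
  note [measurable] = borel_measurable_integrable[OF f]
  show ?thesis
  proof (rule that[OF d(1)])
    fix \<eta> :: "'a \<Rightarrow> real" assume k: "kernel \<eta> d"
    then have \<eta>: "continuous_on UNIV \<eta>" "\<And>x. 0 \<le> \<eta> x" "\<And>x. d \<le> norm x \<Longrightarrow> \<eta> x = 0"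
      "integrable lborel \<eta>" "integral\<^sup>L lborel \<eta> = 1" by (auto simp: kernel_def)
    note [measurable] = borel_measurable_continuous_onI[OF \<eta>(1)]
    have pw: "ennreal (N (mollify \<eta> f x - f x)) \<le> (\<integral>\<^sup>+z. ennreal (\<eta> z * N (f (x - z) - f x)) \<partial>lborel)" for x
    proof -
      have i1: "integrable lborel (\<lambda>y. \<eta> (x - y) *\<^sub>R f y)"
        using kernel_integrable[OF \<eta>(1,3), where f=f and x=x] f by (simp add: integrable_completion)
      have gm: "(\<lambda>z. \<eta> z * f (x - z)) \<in> borel_measurable borel" by measurable
      have i2: "integrable lborel (\<lambda>z. \<eta> z * f (x - z))"
        using integral_lborel_reflect(2)[OF gm, of x] i1 by simp
      have "mollify \<eta> f x = integral\<^sup>L lborel (\<lambda>z. \<eta> z * f (x - z))"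
        using integral_lborel_reflect(1)[OF gm, of x] by (simp add: mollify_lborel[OF \<eta>(1)])
      then have eq: "mollify \<eta> f x - f x = integral\<^sup>L lborel (\<lambda>z. \<eta> z * (f (x - z) - f x))"
        using i2 \<eta>(4,5) by (simp add: right_diff_distrib)
      have i3: "integrable lborel (\<lambda>z. \<eta> z * (f (x - z) - f x))"
        using i2 \<eta>(4) by (simp add: right_diff_distrib)
      show ?thesis unfolding eq by (rule jens[OF \<eta>(4,2,5) _ i3]) measurable
    qed
    have "(\<integral>\<^sup>+x. ennreal (N (mollify \<eta> f x - f x)) \<partial>lborel)
        \<le> (\<integral>\<^sup>+x. (\<integral>\<^sup>+z. ennreal (\<eta> z * N (f (x - z) - f x)) \<partial>lborel) \<partial>lborel)"
      by (intro nn_integral_mono pw)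
    also have "\<dots> = (\<integral>\<^sup>+z. (\<integral>\<^sup>+x. ennreal (\<eta> z * N (f (x - z) - f x)) \<partial>lborel) \<partial>lborel)"
      by (rule lborel_pair.Fubini') measurable
    also have "\<dots> \<le> (\<integral>\<^sup>+z. ennreal (\<eta> z) * ennreal e \<partial>lborel)"
    proof (rule nn_integral_mono)
      fix z
      have "(\<integral>\<^sup>+x. ennreal (\<eta> z * N (f (x - z) - f x)) \<partial>lborel)
        = ennreal (\<eta> z) * (\<integral>\<^sup>+x. ennreal (N (f (- z + x) - f x)) \<partial>lborel)"
        using \<eta>(2) N0 by (subst nn_integral_cmult[symmetric]) (auto simp: ennreal_mult)
      also have "\<dots> \<le> ennreal (\<eta> z) * ennreal e"
        using d(2)[of "-z"] \<eta>(3)[of z] by (cases "norm z < d") (auto intro!: mult_left_mono)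
      finally show "(\<integral>\<^sup>+x. ennreal (\<eta> z * N (f (x - z) - f x)) \<partial>lborel) \<le> ennreal (\<eta> z) * ennreal e" .
    qed
    also have "\<dots> = ennreal e"
      using \<eta> by (subst nn_integral_multc) (auto simp: nn_integral_eq_integral)
    finally show "(\<integral>\<^sup>+x. ennreal (N (mollify \<eta> f x - f x)) \<partial>lborel) \<le> ennreal e" .
  qed
qed

lemma mollify_inner:
  fixes f :: "'a::euclidean_space \<Rightarrow> 'b::euclidean_space"
  assumes "continuous_on UNIV \<eta>" "\<And>x. d \<le> norm x \<Longrightarrow> \<eta> x = 0" "integrable lebesgue f"
  shows "mollify \<eta> f x \<bullet> b = mollify \<eta> (\<lambda>y. f y \<bullet> b) x"
  unfolding mollify_def
  using kernel_integrable[OF assms, where x=x] by (simp add: integral_inner_left[symmetric] del: integral_inner_left)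

lemma mollify_cong_AE:
  fixes f g :: "'a::euclidean_space \<Rightarrow> 'b::euclidean_space"
  assumes "continuous_on UNIV \<eta>" "AE x in lebesgue. f x = g x" "f \<in> borel_measurable lebesgue" "g \<in> borel_measurable lebesgue"
  shows "mollify \<eta> f x = mollify \<eta> g x"
proof -
  note [measurable] = borel_measurable_continuous_onI[OF assms(1)]
  have [measurable]: "(\<lambda>y. \<eta> (x - y)) \<in> borel_measurable lebesgue"
    by (rule measurable_completion) simp
  note [measurable] = assms(3,4)
  show ?thesis unfolding mollify_def using assms(2) by (intro integral_cong_AE) auto
qed

lemma borel_representative:
  fixes f :: "'a::euclidean_space \<Rightarrow> real"
  assumes "f \<in> borel_measurable lebesgue"
  obtains g where "g \<in> borel_measurable borel" "AE x in lebesgue. f x = g x"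
  using completion_ex_borel_measurable_real[OF assms] by (auto intro: AE_completion)

lemma mollify_tendsto_real:
  fixes f :: "'a::euclidean_space \<Rightarrow> real"
  assumes K: "\<And>k. kernel (K k) (1 / real (Suc k))" and f: "integrable lebesgue f"
  shows "(\<lambda>k. \<integral>\<^sup>+x. ennreal \<bar>mollify (K k) f x - f x\<bar> \<partial>lebesgue) \<longlonglongrightarrow> 0" (is ?A)
    and "integrable lebesgue (\<lambda>x. (f x)\<^sup>2) \<Longrightarrow> (\<lambda>k. \<integral>\<^sup>+x. ennreal ((mollify (K k) f x - f x)\<^sup>2) \<partial>lebesgue) \<longlonglongrightarrow> 0" (is "_ \<Longrightarrow> ?B")
proof -
  \<comment> \<open>Fubini on \<open>lborel\<close> needs joint Borel measurability, so
    \<open>f\<close> is replaced by an almost everywhere equal Borel function, which has the same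
    mollifications.\<close>
  obtain g where g [measurable]: "g \<in> borel_measurable borel" and ae: "AE x in lebesgue. f x = g x"
    using borel_representative borel_measurable_integrable[OF f] by blast
  have gl [measurable]: "g \<in> borel_measurable lebesgue" by (rule measurable_completion) simp
  note fl [measurable] = borel_measurable_integrable[OF f]
  have "integrable lebesgue g" using f ae by (subst integrable_cong_AE[of _ _ f]) (auto elim: eventually_mono)
  then have ig: "integrable lborel g" by (simp add: integrable_completion)
  have cK: "continuous_on UNIV (K k)" for k using K[of k] by (simp add: kernel_def)
  have mono: "kernel \<eta> a \<Longrightarrow> a \<le> b \<Longrightarrow> kernel \<eta> b" for \<eta> :: "'a \<Rightarrow> real" and a b
    unfolding kernel_def by (meson order_trans)
  have key: "(\<lambda>k. \<integral>\<^sup>+x. ennreal (N (mollify (K k) f x - f x)) \<partial>lebesgue) \<longlonglongrightarrow> 0"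
    if N: "shift_continuous g N" "N \<in> borel_measurable borel" "\<And>t. 0 \<le> N t"
     "\<And>(\<eta>::'a \<Rightarrow> real) w. integrable lborel \<eta> \<Longrightarrow> (\<And>x. 0 \<le> \<eta> x) \<Longrightarrow> integral\<^sup>L lborel \<eta> = 1 \<Longrightarrow>
        w \<in> borel_measurable borel \<Longrightarrow> integrable lborel (\<lambda>x. \<eta> x * w x) \<Longrightarrow>
        ennreal (N (integral\<^sup>L lborel (\<lambda>x. \<eta> x * w x))) \<le> (\<integral>\<^sup>+x. ennreal (\<eta> x * N (w x)) \<partial>lborel)"
    for N :: "real \<Rightarrow> real"
  proof (rule tendsto_0_if_le)
    fix e :: real assume "e > 0"
    obtain d where d: "d > 0" "\<And>\<eta>. kernel \<eta> d \<Longrightarrow> (\<integral>\<^sup>+x. ennreal (N (mollify \<eta> g x - g x)) \<partial>lborel) \<le> ennreal e"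
      by (rule mollify_approx[OF ig N(1) \<open>e > 0\<close> N(2,3,4)]) blast+
    obtain n where n: "1 / real (Suc n) < d" using d by (metis inverse_eq_divide reals_Archimedean)
    have "(\<integral>\<^sup>+x. ennreal (N (mollify (K k) f x - f x)) \<partial>lebesgue) \<le> ennreal e" if "k \<ge> n" for k
    proof -
      have "1 / real (Suc k) \<le> 1 / real (Suc n)" using that by (simp add: field_simps)
      then have "kernel (K k) d" using mono[OF K[of k]] n by simp
      have "(\<integral>\<^sup>+x. ennreal (N (mollify (K k) f x - f x)) \<partial>lebesgue)
          = (\<integral>\<^sup>+x. ennreal (N (mollify (K k) g x - g x)) \<partial>lebesgue)"
        using ae mollify_cong_AE[OF cK ae fl gl, of k] by (intro nn_integral_cong_AE) auto
      also have "\<dots> \<le> ennreal e" using d(2)[OF \<open>kernel (K k) d\<close>] by (simp add: nn_integral_completion)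
      finally show ?thesis .
    qed
    then show "\<forall>\<^sub>F k in sequentially. (\<integral>\<^sup>+x. ennreal (N (mollify (K k) f x - f x)) \<partial>lebesgue) \<le> ennreal e"
      by (auto simp: eventually_sequentially)
  qed
  show ?A by (rule key) (use shift_continuous_L1[OF ig] jensen_abs in auto)
  assume sq: "integrable lebesgue (\<lambda>x. (f x)\<^sup>2)"
  have "integrable lebesgue (\<lambda>x. (g x)\<^sup>2)" using sq ae by (subst integrable_cong_AE[of _ _ "\<lambda>x. (f x)\<^sup>2"]) (auto elim: eventually_mono)
  then have "integrable lborel (\<lambda>x. (g x)\<^sup>2)" by (simp add: integrable_completion)
  then show ?B by (intro key) (use shift_continuous_L2[OF g] jensen_square in auto)
qed

lemma norm_squared_Basis: "(norm (x::'b::euclidean_space))\<^sup>2 = (\<Sum>b\<in>Basis. (x \<bullet> b)\<^sup>2)"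
  by (subst euclidean_inner[of x x, folded power2_norm_eq_inner]) (simp add: power2_eq_square)

text \<open>Coordinatewise reduction to real functions: the norm is at most the sum of the absolute
  coordinates, its square equals the sum of their squares.\<close>

lemma mollify_tendsto:
  fixes f :: "'a::euclidean_space \<Rightarrow> 'b::euclidean_space"
  assumes K: "\<And>k. kernel (K k) (1 / real (Suc k))" and f: "integrable lebesgue f"
    and meas: "\<And>k. mollify (K k) f \<in> borel_measurable borel"
  shows "(\<lambda>k. \<integral>\<^sup>+x. ennreal (norm (mollify (K k) f x - f x)) \<partial>lebesgue) \<longlonglongrightarrow> 0" (is ?A)
    and "integrable lebesgue (\<lambda>x. (norm (f x))\<^sup>2) \<Longrightarrow>
      (\<lambda>k. \<integral>\<^sup>+x. ennreal ((norm (mollify (K k) f x - f x))\<^sup>2) \<partial>lebesgue) \<longlonglongrightarrow> 0" (is "_ \<Longrightarrow> ?B")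
proof -
  note [measurable] = borel_measurable_integrable[OF f]
  have [measurable]: "mollify (K k) f \<in> borel_measurable lebesgue" for k
    using meas[of k] by (intro measurable_completion) simp
  have c: "continuous_on UNIV (K k)" "\<And>x. 1 / real (Suc k) \<le> norm x \<Longrightarrow> K k x = 0" for k
    using K[of k] by (auto simp: kernel_def)
  have inner: "(mollify (K k) f x - f x) \<bullet> b = mollify (K k) (\<lambda>y. f y \<bullet> b) x - f x \<bullet> b" for k x b
    by (simp add: inner_diff_left mollify_inner[OF c f])
  have fb: "integrable lebesgue (\<lambda>x. f x \<bullet> b)" for b using f by simp
  show ?A
  proof (rule tendsto_sandwich[OF _ _ tendsto_const])
    show "(\<lambda>k. \<Sum>b\<in>Basis. \<integral>\<^sup>+x. ennreal \<bar>(mollify (K k) f x - f x) \<bullet> b\<bar> \<partial>lebesgue) \<longlonglongrightarrow> 0"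
      unfolding inner using mollify_tendsto_real(1)[OF K fb] by (intro tendsto_null_sum) auto
    show "\<forall>\<^sub>F k in sequentially. (\<integral>\<^sup>+x. ennreal (norm (mollify (K k) f x - f x)) \<partial>lebesgue)
       \<le> (\<Sum>b\<in>Basis. \<integral>\<^sup>+x. ennreal \<bar>(mollify (K k) f x - f x) \<bullet> b\<bar> \<partial>lebesgue)"
    proof (intro always_eventually allI)
      fix k
      have "(\<integral>\<^sup>+x. ennreal (norm (mollify (K k) f x - f x)) \<partial>lebesgue)
        \<le> (\<integral>\<^sup>+x. (\<Sum>b\<in>Basis. ennreal \<bar>(mollify (K k) f x - f x) \<bullet> b\<bar>) \<partial>lebesgue)"
        by (intro nn_integral_mono) (simp add: sum_ennreal ennreal_leI norm_le_l1)
      also have "\<dots> = (\<Sum>b\<in>Basis. \<integral>\<^sup>+x. ennreal \<bar>(mollify (K k) f x - f x) \<bullet> b\<bar> \<partial>lebesgue)"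
        by (intro nn_integral_sum) measurable
      finally show "(\<integral>\<^sup>+x. ennreal (norm (mollify (K k) f x - f x)) \<partial>lebesgue) \<le> \<dots>" .
    qed
  qed auto
  assume sq: "integrable lebesgue (\<lambda>x. (norm (f x))\<^sup>2)"
  have fb2: "integrable lebesgue (\<lambda>x. (f x \<bullet> b)\<^sup>2)" if "b \<in> Basis" for b
  proof (rule Bochner_Integration.integrable_bound[OF sq])
    show "AE x in lebesgue. norm ((f x \<bullet> b)\<^sup>2) \<le> norm ((norm (f x))\<^sup>2)"
      using Basis_le_norm[OF that] by (auto simp: abs_le_square_iff[symmetric])
  qed measurable
  have "(\<integral>\<^sup>+x. ennreal ((norm (mollify (K k) f x - f x))\<^sup>2) \<partial>lebesgue)
    = (\<Sum>b\<in>Basis. \<integral>\<^sup>+x. ennreal (((mollify (K k) f x - f x) \<bullet> b)\<^sup>2) \<partial>lebesgue)" for k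
    unfolding norm_squared_Basis by (subst nn_integral_sum[symmetric]) (auto simp: sum_ennreal)
  then show ?B
    unfolding inner using mollify_tendsto_real(2)[OF K fb fb2] by (auto intro!: tendsto_null_sum)
qed

subsection \<open>Smooth functions\<close>

lemma partial_deriv_eq:
  assumes "(f has_derivative D) (at x)"
  shows "partial_deriv i f x = D (axis i 1)"
  using frechet_derivative_at[OF assms] by (simp add: partial_deriv_def)

lemma linear_axis_expansion:
  fixes D :: "real^'n::finite \<Rightarrow> 'b::real_vector"
  assumes "linear D"
  shows "D h = (\<Sum>i\<in>UNIV. (h $ i) *\<^sub>R D (axis i 1))"
proof -
  have "D h = D (\<Sum>i\<in>UNIV. (h $ i) *\<^sub>R axis i 1)"
    using basis_expansion[of h] by (simp add: scalar_mult_eq_scaleR)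
  also have "\<dots> = (\<Sum>i\<in>UNIV. (h $ i) *\<^sub>R D (axis i 1))"
    by (simp add: linear_sum[OF assms] linear_cmul[OF assms])
  finally show ?thesis .
qed

lemma sum_axis: "(\<Sum>j\<in>UNIV. axis i 1 $ j *\<^sub>R X j) = (X (i::'n::finite) :: 'z::real_vector)"
proof -
  have "(\<Sum>j\<in>UNIV. axis i 1 $ j *\<^sub>R X j) = (\<Sum>j\<in>UNIV. if j = i then X j else 0)"
    by (rule sum.cong) (auto simp: axis_def)
  then show ?thesis by simp
qed

lemma has_derivative_partials:
  fixes f :: "real^'n::finite \<Rightarrow> 'b::real_normed_vector"
  assumes "f differentiable (at x)"
  shows "(f has_derivative (\<lambda>h. \<Sum>i\<in>UNIV. (h $ i) *\<^sub>R partial_deriv i f x)) (at x)"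
proof -
  from assms obtain D where D: "(f has_derivative D) (at x)" by (auto simp: differentiable_def)
  have "D = (\<lambda>h. \<Sum>i\<in>UNIV. (h $ i) *\<^sub>R partial_deriv i f x)"
    unfolding partial_deriv_eq[OF D] by (rule ext) (rule linear_axis_expansion[OF has_derivative_linear[OF D]])
  with D show ?thesis by simp
qed

lemma iter_partial_append: "iter_partial (xs @ ys) f = iter_partial xs (iter_partial ys f)"
  by (induction xs) auto

lemma smooth_fun_differentiable: "smooth_fun f \<Longrightarrow> f differentiable (at x)"
  unfolding smooth_fun_def by (metis iter_partial.simps(1))

lemma smooth_fun_partial: "smooth_fun f \<Longrightarrow> smooth_fun (partial_deriv i f)"
  unfolding smooth_fun_def
proof (intro allI)
  fix xs x assume "\<forall>is x. iter_partial is f differentiable (at x)"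
  then have "iter_partial (xs @ [i]) f differentiable (at x)" by blast
  then show "iter_partial xs (partial_deriv i f) differentiable (at x)" by (simp add: iter_partial_append)
qed

lemma smooth_fun_continuous: "smooth_fun f \<Longrightarrow> continuous_on UNIV f"
  by (meson continuous_at_imp_continuous_on differentiable_imp_continuous_within smooth_fun_differentiable)

text \<open>Exhibiting a set of differentiable functions that is closed under partial derivatives
  replaces an induction over all lists of directions.\<close>

lemma smooth_fun_coinduct:
  assumes "f \<in> S" "\<And>f x. f \<in> S \<Longrightarrow> f differentiable (at x)" "\<And>f i. f \<in> S \<Longrightarrow> partial_deriv i f \<in> S"
  shows "smooth_fun f"
proof -
  have "iter_partial xs f \<in> S" for xs by (induction xs) (use assms in auto)
  then show ?thesis unfolding smooth_fun_def using assms(2) by blast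
qed

lemma partial_deriv_reflect:
  fixes g :: "real^'n::finite \<Rightarrow> 'b::real_normed_vector"
  assumes "g differentiable (at (x - y))"
  shows "(\<lambda>y. g (x - y)) differentiable (at y)" "partial_deriv i (\<lambda>y. g (x - y)) y = - partial_deriv i g (x - y)"
proof -
  from assms obtain D where D: "(g has_derivative D) (at (x - y))" by (auto simp: differentiable_def)
  have "((\<lambda>y. g (x - y)) has_derivative (\<lambda>h. D (- h))) (at y)"
    by (rule has_derivative_compose[of "\<lambda>y. x - y" "\<lambda>h. - h" y UNIV g D, simplified])
       (use D in \<open>auto intro!: derivative_eq_intros\<close>)
  note D' = this
  show "(\<lambda>y. g (x - y)) differentiable (at y)" using D' by (auto simp: differentiable_def)
  show "partial_deriv i (\<lambda>y. g (x - y)) y = - partial_deriv i g (x - y)"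
    using has_derivative_linear[OF D] by (simp add: partial_deriv_eq[OF D] partial_deriv_eq[OF D'] linear_neg)
qed

lemma smooth_fun_reflect:
  fixes g :: "real^'n::finite \<Rightarrow> 'b::real_normed_vector"
  assumes "smooth_fun g"
  shows "smooth_fun (\<lambda>y. g (x - y))"
\<comment> \<open>The scalar \<open>s\<close> in the invariant set absorbs the sign that every
  differentiation of a reflected function produces.\<close>
proof (rule smooth_fun_coinduct[where S = "{(\<lambda>y. s *\<^sub>R g (x - y)) | s g. smooth_fun g}"])
  show "(\<lambda>y. g (x - y)) \<in> {(\<lambda>y. s *\<^sub>R g (x - y)) | s g. smooth_fun g}"
    using assms by (intro CollectI exI[of _ 1] exI[of _ g]) auto
next
  fix f y assume "f \<in> {(\<lambda>y. s *\<^sub>R (g :: real^'n \<Rightarrow> 'b) (x - y)) | s g. smooth_fun g}"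
  then obtain s and g :: "real^'n \<Rightarrow> 'b" where f: "f = (\<lambda>y. s *\<^sub>R g (x - y))" and g: "smooth_fun g" by auto
  show "f differentiable (at y)"
    unfolding f by (intro differentiable_scaleR differentiable_const partial_deriv_reflect(1) smooth_fun_differentiable g)
next
  fix f i assume "f \<in> {(\<lambda>y. s *\<^sub>R (g :: real^'n \<Rightarrow> 'b) (x - y)) | s g. smooth_fun g}"
  then obtain s and g :: "real^'n \<Rightarrow> 'b" where f: "f = (\<lambda>y. s *\<^sub>R g (x - y))" and g: "smooth_fun g" by auto
  have "partial_deriv i f y = (- s) *\<^sub>R partial_deriv i g (x - y)" for y
  proof -
    have d: "((\<lambda>y. g (x - y)) has_derivative frechet_derivative (\<lambda>y. g (x - y)) (at y)) (at y)"
      using partial_deriv_reflect(1)[OF smooth_fun_differentiable[OF g]] by (simp add: frechet_derivative_works)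
    have "partial_deriv i f y = s *\<^sub>R partial_deriv i (\<lambda>y. g (x - y)) y"
      unfolding f using partial_deriv_eq[OF has_derivative_scaleR_right[OF d, of s], of i]
      by (simp only: partial_deriv_def)
    then show ?thesis
      using partial_deriv_reflect(2)[OF smooth_fun_differentiable[OF g], of i x y] by simp
  qed
  then have "partial_deriv i f = (\<lambda>y. (- s) *\<^sub>R partial_deriv i g (x - y))" by auto
  then show "partial_deriv i f \<in> {(\<lambda>y. s *\<^sub>R g (x - y)) | s g. smooth_fun g}"
    using smooth_fun_partial[OF g] by blast
qed

section \<open>Supports and test functions\<close>

lemma partial_deriv_zero_outside:
  fixes f :: "real^'n::finite \<Rightarrow> 'b::real_normed_vector"
  assumes "open S" "x \<in> S" "\<And>y. y \<in> S \<Longrightarrow> f y = 0"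
  shows "partial_deriv i f x = 0"
proof -
  have "(f has_derivative (\<lambda>h. 0)) (at x)"
    by (rule has_derivative_transform_within_open[of "\<lambda>_. 0" _ x UNIV S]) (use assms in auto)
  then show ?thesis by (simp add: partial_deriv_eq)
qed

lemma open_outside_cball: "open {x::'a::real_normed_vector. d < norm x}"
  by (intro open_Collect_less continuous_intros)

lemma test_funE:
  fixes \<phi> :: "real^'n::finite \<Rightarrow> 'b::real_normed_vector"
  assumes "test_fun \<Omega> \<phi>"
  obtains K where "compact K" "K \<subseteq> \<Omega>" "\<And>x. x \<notin> K \<Longrightarrow> \<phi> x = 0" "\<And>x i. x \<notin> K \<Longrightarrow> partial_deriv i \<phi> x = 0"
proof
  let ?K = "closure {x. \<phi> x \<noteq> 0}"
  show "compact ?K" "?K \<subseteq> \<Omega>" using assms by (auto simp: test_fun_def)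
  show z: "\<phi> x = 0" if "x \<notin> ?K" for x using that closure_subset[of "{x. \<phi> x \<noteq> 0}"] by auto
  show "partial_deriv i \<phi> x = 0" if "x \<notin> ?K" for x i
  proof (rule partial_deriv_zero_outside[of "- ?K"])
    show "open (- ?K)" by (intro open_Compl closed_closure)
    show "x \<in> - ?K" using that by simp
    show "\<phi> y = 0" if "y \<in> - ?K" for y using that by (intro z) simp
  qed
qed

lemma test_funI:
  fixes \<phi> :: "real^'n::finite \<Rightarrow> 'b::real_normed_vector"
  assumes "smooth_fun \<phi>" "compact K" "K \<subseteq> \<Omega>" "\<And>x. x \<notin> K \<Longrightarrow> \<phi> x = 0"
  shows "test_fun \<Omega> \<phi>"
proof -
  have "closure {x. \<phi> x \<noteq> 0} \<subseteq> K"
    using assms by (intro closure_minimal) (auto intro: compact_imp_closed)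
  moreover from this have "compact (closure {x. \<phi> x \<noteq> 0})"
    using assms(2) by (metis closed_closure compact_Int_closed inf.absorb2)
  ultimately show ?thesis using assms by (auto simp: test_fun_def)
qed

section \<open>Uniform estimates for smooth functions of compact support, and derivatives of
  mollifications\<close>

lemma smooth_compact_lipschitz:
  fixes g :: "real^'n::finite \<Rightarrow> real"
  assumes g: "smooth_fun g" "\<And>x. d < norm x \<Longrightarrow> g x = 0"
  obtains L where "L \<ge> 0" "\<And>x y. \<bar>g x - g y\<bar> \<le> L * norm (x - y)"
proof -
  have "\<exists>B>0. \<forall>x. norm (partial_deriv i g x) \<le> B" for i
  proof -
    have "partial_deriv i g x = 0" if "d + 1 \<le> norm x" for x
      by (rule partial_deriv_zero_outside[OF open_outside_cball[of d]]) (use that g in auto)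
    then show ?thesis
      using compact_support_bounded[OF smooth_fun_continuous[OF smooth_fun_partial[OF g(1)]]] by metis
  qed
  then obtain B where B: "\<And>i. B i > 0" "\<And>i x. norm (partial_deriv i g x) \<le> B i" by metis
  have "\<bar>g x - g y\<bar> \<le> (\<Sum>i\<in>UNIV. B i) * norm (x - y)" for x y
  proof -
    have "norm (g x - g y) \<le> (\<Sum>i\<in>UNIV. B i) * norm (x - y)"
    proof (rule differentiable_bound[of UNIV])
      show "(g has_derivative (\<lambda>h. \<Sum>i\<in>UNIV. (h $ i) *\<^sub>R partial_deriv i g x)) (at x within UNIV)" for x
        using has_derivative_partials[OF smooth_fun_differentiable[OF g(1)]] by simp
      show "onorm (\<lambda>h. \<Sum>i\<in>UNIV. (h $ i) *\<^sub>R partial_deriv i g x) \<le> (\<Sum>i\<in>UNIV. B i)" for x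
      proof (rule onorm_le)
        fix h :: "real^'n"
        have "norm (\<Sum>i\<in>UNIV. (h $ i) *\<^sub>R partial_deriv i g x) \<le> (\<Sum>i\<in>UNIV. norm ((h $ i) *\<^sub>R partial_deriv i g x))"
          by (rule norm_sum)
        also have "\<dots> \<le> (\<Sum>i\<in>UNIV. norm h * B i)"
          using B component_le_norm_cart[of h] by (intro sum_mono) (auto simp: abs_mult intro!: mult_mono)
        finally show "norm (\<Sum>i\<in>UNIV. (h $ i) *\<^sub>R partial_deriv i g x) \<le> (\<Sum>i\<in>UNIV. B i) * norm h"
          by (simp add: sum_distrib_left mult.commute)
      qed
    qed auto
    then show ?thesis by simp
  qed
  moreover have "(\<Sum>i\<in>UNIV. B i) \<ge> 0" using B(1) by (intro sum_nonneg) (auto intro: less_imp_le)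
  ultimately show ?thesis using that by blast
qed

text \<open>Each partial derivative is again smooth with compact support, hence Lipschitz, so the
  linearization error is quadratic. The constant does not depend on \<open>x\<close>, which is what
  allows differentiation under the integral in \<open>mollify_has_derivative\<close>.\<close>

lemma smooth_compact_taylor:
  fixes g :: "real^'n::finite \<Rightarrow> real"
  assumes g: "smooth_fun g" "\<And>x. d < norm x \<Longrightarrow> g x = 0"
  obtains C where "C \<ge> 0" "\<And>x h. \<bar>g (x + h) - g x - (\<Sum>i\<in>UNIV. (h $ i) * partial_deriv i g x)\<bar> \<le> C * (norm h)\<^sup>2"
proof -
  have "\<exists>L\<ge>0. \<forall>x y. \<bar>partial_deriv i g x - partial_deriv i g y\<bar> \<le> L * norm (x - y)" for i
  proof -
    have "partial_deriv i g x = 0" if "d < norm x" for x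
      by (rule partial_deriv_zero_outside[OF open_outside_cball[of d]]) (use that g in auto)
    then show ?thesis using smooth_compact_lipschitz[OF smooth_fun_partial[OF g(1)]] by metis
  qed
  then obtain L where L: "\<And>i. L i \<ge> 0" "\<And>i x y. \<bar>partial_deriv i g x - partial_deriv i g y\<bar> \<le> L i * norm (x - y)" by metis
  let ?D = "\<lambda>x h. \<Sum>i\<in>UNIV. (h $ i) *\<^sub>R partial_deriv i g x"
  have "\<bar>g (x + h) - g x - (\<Sum>i\<in>UNIV. (h $ i) * partial_deriv i g x)\<bar> \<le> (\<Sum>i\<in>UNIV. L i) * (norm h)\<^sup>2" for x h
  proof -
    have "norm (g (x + h) - g x - ?D x (x + h - x)) \<le> norm (x + h - x) * ((\<Sum>i\<in>UNIV. L i) * norm h)"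
    proof (rule differentiable_bound_linearization[where S = "cball x (norm h)"])
      show "x + t *\<^sub>R (x + h - x) \<in> cball x (norm h)" if "t \<in> {0..1}" for t
        using that by (auto simp: dist_norm mult_left_le_one_le)
      show "(g has_derivative ?D y) (at y within cball x (norm h))" for y
        using has_derivative_partials[OF smooth_fun_differentiable[OF g(1)]] by (rule has_derivative_at_withinI)
      show "onorm (?D y - ?D x) \<le> (\<Sum>i\<in>UNIV. L i) * norm h" if y: "y \<in> cball x (norm h)" for y
      proof (rule onorm_le)
        fix k :: "real^'n"
        have "norm ((?D y - ?D x) k) = norm (\<Sum>i\<in>UNIV. (k $ i) * (partial_deriv i g y - partial_deriv i g x))"
          by (simp add: sum_subtractf right_diff_distrib)
        also have "\<dots> \<le> (\<Sum>i\<in>UNIV. norm ((k $ i) * (partial_deriv i g y - partial_deriv i g x)))"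
          by (rule norm_sum)
        also have "\<dots> \<le> (\<Sum>i\<in>UNIV. norm k * (L i * norm h))"
        proof (rule sum_mono)
          fix i
          have "\<bar>partial_deriv i g y - partial_deriv i g x\<bar> \<le> L i * norm (y - x)" by (rule L(2))
          also have "\<dots> \<le> L i * norm h" using y L(1)[of i] by (intro mult_left_mono) (auto simp: dist_norm norm_minus_commute)
          finally show "norm ((k $ i) * (partial_deriv i g y - partial_deriv i g x)) \<le> norm k * (L i * norm h)"
            using component_le_norm_cart[of k i] by (auto simp: abs_mult intro!: mult_mono)
        qed
        finally show "norm ((?D y - ?D x) k) \<le> (\<Sum>i\<in>UNIV. L i) * norm h * norm k"
          by (simp add: sum_distrib_left sum_distrib_right mult_ac)
      qed
    qed auto
    then show ?thesis by (simp add: power2_eq_square mult_ac)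
  qed
  moreover have "(\<Sum>i\<in>UNIV. L i) \<ge> 0" using L(1) by (intro sum_nonneg) auto
  ultimately show ?thesis using that by blast
qed

text \<open>All derivatives fall on the kernel. The uniform Taylor remainder of \<open>g\<close>
  integrates against \<open>f\<close> to at most \<open>C * (norm h)\<^sup>2\<close> times the
  \<open>L1\<close> norm of \<open>f\<close>, so integrability of \<open>f\<close> is
  enough.\<close>

lemma mollify_has_derivative:
  fixes f :: "real^'n::finite \<Rightarrow> 'b::euclidean_space"
  assumes g: "smooth_fun g" "\<And>x. d < norm x \<Longrightarrow> g x = 0" and f: "integrable lebesgue f"
  shows "(mollify g f has_derivative (\<lambda>h. \<Sum>i\<in>UNIV. (h $ i) *\<^sub>R mollify (partial_deriv i g) f x)) (at x)"
proof -
  obtain C where C: "C \<ge> 0" "\<And>x h. \<bar>g (x + h) - g x - (\<Sum>i\<in>UNIV. (h $ i) * partial_deriv i g x)\<bar> \<le> C * (norm h)\<^sup>2"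
    using smooth_compact_taylor[where d = d, OF g] by metis
  have ig: "integrable lebesgue (\<lambda>y. g (x - y) *\<^sub>R f y)" for x
    by (rule kernel_integrable[OF smooth_fun_continuous[OF g(1)] _ f, of "d + 1"]) (use g in auto)
  have ip: "integrable lebesgue (\<lambda>y. partial_deriv i g (x - y) *\<^sub>R f y)" for x i
  proof (rule kernel_integrable[OF smooth_fun_continuous[OF smooth_fun_partial[OF g(1)]] _ f, of "d + 1"])
    show "partial_deriv i g x = 0" if "d + 1 \<le> norm x" for x
      by (rule partial_deriv_zero_outside[OF open_outside_cball[of d]]) (use that g in auto)
  qed
  define A where "A = integral\<^sup>L lebesgue (\<lambda>y. norm (f y))"
  let ?D = "\<lambda>h. \<Sum>i\<in>UNIV. (h $ i) *\<^sub>R mollify (partial_deriv i g) f x"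
  have bound: "norm (mollify g f (x + h) - mollify g f x - ?D h) \<le> C * (norm h)\<^sup>2 * A" for h
  proof -
    let ?r = "\<lambda>y. g (x + h - y) - g (x - y) - (\<Sum>i\<in>UNIV. (h $ i) * partial_deriv i g (x - y))"
    have "mollify g f (x + h) - mollify g f x - ?D h = integral\<^sup>L lebesgue (\<lambda>y. ?r y *\<^sub>R f y)"
      unfolding mollify_def using ig[of x] ig[of "x + h"] ip[of _ x]
      by (simp add: scaleR_diff_left scaleR_sum_left flip: scaleR_scaleR)
    also have "norm \<dots> \<le> integral\<^sup>L lebesgue (\<lambda>y. C * (norm h)\<^sup>2 * norm (f y))"
    proof (rule Bochner_Integration.integral_norm_bound_integral)
      show "integrable lebesgue (\<lambda>y. ?r y *\<^sub>R f y)"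
        using ig[of x] ig[of "x + h"] ip[of _ x] by (simp add: scaleR_diff_left scaleR_sum_left flip: scaleR_scaleR)
      show "integrable lebesgue (\<lambda>y. C * (norm h)\<^sup>2 * norm (f y))" using f by simp
      show "norm (?r y *\<^sub>R f y) \<le> C * (norm h)\<^sup>2 * norm (f y)" for y
      proof -
        have "x - y + h = x + h - y" by simp
        with C(2)[of "x - y" h] have "\<bar>?r y\<bar> \<le> C * (norm h)\<^sup>2" by simp
        then show ?thesis unfolding norm_scaleR real_norm_def by (rule mult_right_mono) simp
      qed
    qed
    finally show ?thesis by (simp add: A_def)
  qed
  show ?thesis unfolding has_derivative_at
  proof
    show "bounded_linear ?D"
      by (intro bounded_linear_sum bounded_linear_scaleR_const bounded_linear_vec_nth)
    show "(\<lambda>h. norm (mollify g f (x + h) - mollify g f x - ?D h) / norm h) \<midarrow>0\<rightarrow> 0"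
    proof (rule tendsto_sandwich[OF _ _ tendsto_const])
      show "((\<lambda>h. C * A * norm h) \<longlongrightarrow> 0) (at 0)" by (intro tendsto_eq_intros) auto
      show "\<forall>\<^sub>F h in at 0. norm (mollify g f (x + h) - mollify g f x - ?D h) / norm h \<le> C * A * norm h"
        using bound by (auto simp: eventually_at_filter divide_simps power2_eq_square mult_ac)
    qed auto
  qed
qed

lemma mollify_partial_deriv:
  fixes f :: "real^'n::finite \<Rightarrow> 'b::euclidean_space"
  assumes "smooth_fun g" "\<And>x. d < norm x \<Longrightarrow> g x = 0" "integrable lebesgue f"
  shows "partial_deriv i (mollify g f) x = mollify (partial_deriv i g) f x"
  using partial_deriv_eq[OF mollify_has_derivative[where d = d, OF assms], of i] by (simp only: sum_axis)

lemma mollify_smooth: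
  fixes f :: "real^'n::finite \<Rightarrow> 'b::euclidean_space"
  assumes g: "smooth_fun g" "\<And>x. d < norm x \<Longrightarrow> g x = 0" and f: "integrable lebesgue f"
  shows "smooth_fun (mollify g f)"
proof (rule smooth_fun_coinduct[where S = "{mollify g f | g. smooth_fun g \<and> (\<forall>x. d < norm x \<longrightarrow> g x = 0)}"])
  fix F x assume "F \<in> {mollify g f | g. smooth_fun g \<and> (\<forall>x. d < norm x \<longrightarrow> g x = 0)}"
  then obtain g where F: "F = mollify g f" and g: "smooth_fun g" "\<And>x. d < norm x \<Longrightarrow> g x = 0" by auto
  show "F differentiable (at x)" unfolding F using mollify_has_derivative[where d = d, OF g f] by (auto simp: differentiable_def)
next
  fix F i assume "F \<in> {mollify g f | g. smooth_fun g \<and> (\<forall>x. d < norm x \<longrightarrow> g x = 0)}"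
  then obtain g where F: "F = mollify g f" and g: "smooth_fun g" "\<And>x. d < norm x \<Longrightarrow> g x = 0" by auto
  have "partial_deriv i F = mollify (partial_deriv i g) f"
    unfolding F using mollify_partial_deriv[where d = d, OF g f] by auto
  moreover have "partial_deriv i g x = 0" if "d < norm x" for x
    by (rule partial_deriv_zero_outside[OF open_outside_cball[of d]]) (use that g in auto)
  ultimately show "partial_deriv i F \<in> {mollify g f | g. smooth_fun g \<and> (\<forall>x. d < norm x \<longrightarrow> g x = 0)}"
    using smooth_fun_partial[OF g(1)] by blast
qed (use g in blast)

subsection \<open>Integration by parts\<close>

text \<open>By translation invariance every difference quotient of \<open>h\<close> along
  \<open>v\<close> has integral \<open>0\<close>. The quotients converge to \<open>D x v\<close>,
  are bounded by \<open>B\<close>, and live in one common ball, so dominated convergence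
  applies.\<close>

lemma integral_partial_zero:
  fixes h :: "real^'n::finite \<Rightarrow> 'b::euclidean_space"
  assumes D: "\<And>x. (h has_derivative D x) (at x)" and cont: "continuous_on UNIV (\<lambda>x. D x v)"
    and h0: "\<And>x. d < norm x \<Longrightarrow> h x = 0"
  shows "integral\<^sup>L lborel (\<lambda>x. D x v) = 0"
proof -
  have D0: "D x v = 0" if "d < norm x" for x
  proof -
    have "(h has_derivative (\<lambda>_. 0)) (at x)"
      by (rule has_derivative_transform_within_open[of "\<lambda>_. 0" _ x UNIV "{x. d < norm x}"])
         (use that h0 open_outside_cball[of d] in auto)
    then have "D x = (\<lambda>_. 0)" using D has_derivative_unique by blast
    then show ?thesis by simp
  qed
  have "\<exists>B>0. \<forall>x. norm (D x v) \<le> B"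
    by (rule compact_support_bounded[OF cont, of "d + 1"]) (use D0 in auto)
  then obtain B where B: "B > 0" "\<And>x. norm (D x v) \<le> B" by blast
  have hc: "continuous_on UNIV h"
    using D by (auto intro!: continuous_at_imp_continuous_on has_derivative_continuous)
  have hm [measurable]: "h \<in> borel_measurable borel" by (rule borel_measurable_continuous_onI[OF hc])
  have hi: "integrable lborel h"
    by (rule continuous_compact_support_integrable[OF hc, of "d + 1"]) (use h0 in auto)
  have lip: "norm (h (x + t *\<^sub>R v) - h x) \<le> B * t" if "t \<ge> 0" for x t
  proof -
    let ?g = "\<lambda>s. h (x + s *\<^sub>R v)"
    have "norm (?g t - ?g 0) \<le> B * norm (t - 0)"
    proof (rule differentiable_bound[of UNIV])
      fix s :: real
      have "(?g has_derivative (\<lambda>r. D (x + s *\<^sub>R v) (r *\<^sub>R v))) (at s)"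
        by (rule has_derivative_compose[of "\<lambda>s. x + s *\<^sub>R v" "\<lambda>r. r *\<^sub>R v" s UNIV h]) (auto intro!: derivative_eq_intros D)
      then show "(?g has_derivative (\<lambda>r. D (x + s *\<^sub>R v) (r *\<^sub>R v))) (at s within UNIV)" by simp
      show "onorm (\<lambda>r. D (x + s *\<^sub>R v) (r *\<^sub>R v)) \<le> B"
      proof (rule onorm_le)
        fix r
        show "norm (D (x + s *\<^sub>R v) (r *\<^sub>R v)) \<le> B * norm r"
          using mult_left_mono[OF B(2)[of "x + s *\<^sub>R v"], of "\<bar>r\<bar>"]
          by (simp add: linear_cmul[OF has_derivative_linear[OF D]] mult.commute)
      qed
    qed auto
    then show ?thesis using that by simp
  qed
  define t where "t n = 1 / real (Suc n)" for n
  define q where "q n x = (1 / t n) *\<^sub>R (h (t n *\<^sub>R v + x) - h x)" for n x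
  have t: "t n > 0" "t n \<le> 1" for n by (auto simp: t_def)
  have t0: "t \<longlonglongrightarrow> 0" unfolding t_def by (rule LIMSEQ_Suc[OF lim_1_over_n])
  have qbound: "norm (q n x) \<le> B" for n x
    using lip[of "t n" x] t(1)[of n] by (simp add: q_def add.commute divide_simps mult.commute)
  \<comment> \<open>Since \<open>t n \<le> 1\<close>, a shift by \<open>t n *\<^sub>R v\<close>
    moves a point by at most \<open>norm v\<close>; outside radius \<open>?R\<close> both ends of
    the quotient lie where \<open>h\<close> vanishes.\<close>
  let ?R = "\<bar>d\<bar> + norm v + 1"
  have q0: "q n x = 0" if "?R \<le> norm x" for n x
  proof -
    have "norm (t n *\<^sub>R v) \<le> norm v" using t[of n] by (simp add: mult_left_le_one_le)
    then have "norm (t n *\<^sub>R v + x) > d" using that norm_diff_ineq[of x "t n *\<^sub>R v"] by (simp add: add.commute)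
    moreover have "norm x > d" using that norm_ge_zero[of v] by linarith
    ultimately show ?thesis using h0 by (simp add: q_def)
  qed
  have eqdistr: "integral\<^sup>L lborel (\<lambda>x. h (z + x)) = integral\<^sup>L lborel h" "integrable lborel (\<lambda>x. h (z + x))" for z
  proof -
    have "integral\<^sup>L (distr lborel borel ((+) z)) h = integral\<^sup>L lborel (\<lambda>x. h (z + x))"
      by (subst integral_distr) auto
    then show "integral\<^sup>L lborel (\<lambda>x. h (z + x)) = integral\<^sup>L lborel h" by (simp add: lborel_distr_plus)
    have "integrable (distr lborel borel ((+) z)) h \<longleftrightarrow> integrable lborel (\<lambda>x. h (z + x))"
      by (subst integrable_distr_eq) auto
    then show "integrable lborel (\<lambda>x. h (z + x))" using hi by (simp add: lborel_distr_plus)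
  qed
  have qi: "integral\<^sup>L lborel (q n) = 0" for n
    unfolding q_def using eqdistr hi by simp
  have "(\<lambda>n. integral\<^sup>L lborel (q n)) \<longlonglongrightarrow> integral\<^sup>L lborel (\<lambda>x. D x v)"
  proof (rule integral_dominated_convergence)
    show "(\<lambda>x. D x v) \<in> borel_measurable lborel" using borel_measurable_continuous_onI[OF cont] by simp
    show "q n \<in> borel_measurable lborel" for n unfolding q_def by measurable
    show "integrable lborel (\<lambda>x::real^'n. indicator (cball 0 ?R) x *\<^sub>R B)"
      by (intro integrable_scaleR_left integrable_real_indicator) (auto intro: emeasure_lborel_cball_finite[unfolded infinity_ennreal_def])
    show "AE x in lborel. norm (q n x) \<le> indicator (cball 0 ?R) x *\<^sub>R B" for n
      using qbound[of n] q0[of _ n] B by (auto simp: indicator_def)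
    show "AE x in lborel. (\<lambda>n. q n x) \<longlonglongrightarrow> D x v"
    proof (intro AE_I2)
      fix x
      have "((\<lambda>s. h (x + s *\<^sub>R v)) has_derivative (\<lambda>r. D (x + 0 *\<^sub>R v) (r *\<^sub>R v))) (at 0)"
        by (rule has_derivative_compose[of "\<lambda>s. x + s *\<^sub>R v" "\<lambda>r. r *\<^sub>R v" 0 UNIV h]) (auto intro!: derivative_eq_intros D)
      then have "(\<lambda>r. norm (h (x + (0 + r) *\<^sub>R v) - h (x + 0 *\<^sub>R v) - D (x + 0 *\<^sub>R v) (r *\<^sub>R v)) / norm r) \<midarrow>0\<rightarrow> 0"
        unfolding has_derivative_at by blast
      moreover have "filterlim t (at 0) sequentially"
        using t0 t(1) by (intro filterlim_atI) (auto simp: eventually_sequentially less_imp_neq[symmetric])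
      ultimately have "(\<lambda>n. norm (h (x + (0 + t n) *\<^sub>R v) - h (x + 0 *\<^sub>R v) - D (x + 0 *\<^sub>R v) (t n *\<^sub>R v)) / norm (t n)) \<longlonglongrightarrow> 0"
        by (rule filterlim_compose)
      moreover have "norm (h (x + (0 + t n) *\<^sub>R v) - h (x + 0 *\<^sub>R v) - D (x + 0 *\<^sub>R v) (t n *\<^sub>R v)) / norm (t n)
         = norm (q n x - D x v)" for n
      proof -
        have "q n x - D x v = (1 / t n) *\<^sub>R (h (x + t n *\<^sub>R v) - h x - t n *\<^sub>R D x v)"
          using t(1)[of n] by (simp add: q_def add.commute scaleR_diff_right)
        then show ?thesis
          using t(1)[of n] by (simp add: linear_cmul[OF has_derivative_linear[OF D]] divide_inverse mult.commute)
      qed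
      ultimately have "(\<lambda>n. norm (q n x - D x v)) \<longlonglongrightarrow> 0" by simp
      then show "(\<lambda>n. q n x) \<longlonglongrightarrow> D x v" using LIM_zero_cancel tendsto_norm_zero_iff by blast
    qed
  qed
  then show ?thesis using qi by (simp add: LIMSEQ_const_iff)
qed

text \<open>The product rule reduces this to \<open>integral_partial_zero\<close>. The hypothesis
  \<open>supp\<close> lets the vanishing come from either factor, so that the other one may be a
  coordinate function or a composition without compact support.\<close>

lemma integration_by_parts:
  fixes f :: "real^'n::finite \<Rightarrow> real" and g :: "real^'n \<Rightarrow> 'b::euclidean_space"
  assumes f: "\<And>x. (f has_derivative Df x) (at x)" "continuous_on UNIV (\<lambda>x. Df x v)"
    and g: "\<And>x. (g has_derivative Dg x) (at x)" "continuous_on UNIV (\<lambda>x. Dg x v)"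
    and supp: "\<And>x. d < norm x \<Longrightarrow> f x = 0 \<and> Df x v = 0 \<or> g x = 0 \<and> Dg x v = 0"
  shows "integral\<^sup>L lebesgue (\<lambda>x. Df x v *\<^sub>R g x) = - integral\<^sup>L lebesgue (\<lambda>x. f x *\<^sub>R Dg x v)"
proof -
  have c: "continuous_on UNIV f" "continuous_on UNIV g"
    using f(1) g(1) by (auto intro!: continuous_at_imp_continuous_on has_derivative_continuous)
  have cc: "continuous_on UNIV (\<lambda>x. Df x v *\<^sub>R g x)" "continuous_on UNIV (\<lambda>x. f x *\<^sub>R Dg x v)"
    by (intro continuous_intros c f(2) g(2))+
  have z: "Df x v *\<^sub>R g x = 0" "f x *\<^sub>R Dg x v = 0" "f x *\<^sub>R g x = 0" if "d < norm x" for x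
    using supp[OF that] by auto
  have i1: "integrable lborel (\<lambda>x. Df x v *\<^sub>R g x)"
    by (rule continuous_compact_support_integrable[OF cc(1), of "d + 1"]) (rule z(1), simp)
  have i2: "integrable lborel (\<lambda>x. f x *\<^sub>R Dg x v)"
    by (rule continuous_compact_support_integrable[OF cc(2), of "d + 1"]) (rule z(2), simp)
  have "integral\<^sup>L lborel (\<lambda>x. f x *\<^sub>R Dg x v + Df x v *\<^sub>R g x) = 0"
    by (rule integral_partial_zero[OF has_derivative_scaleR[OF f(1) g(1)], of v d])
       (intro continuous_on_add cc, rule z(3))
  then have "integral\<^sup>L lborel (\<lambda>x. Df x v *\<^sub>R g x) = - integral\<^sup>L lborel (\<lambda>x. f x *\<^sub>R Dg x v)"
    using i1 i2 by (simp add: add_eq_0_iff)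
  then show ?thesis using cc[THEN borel_measurable_continuous_onI] by (simp add: integral_completion)
qed

subsection \<open>A smooth kernel\<close>

text \<open>For \<open>k = 0\<close> this is the standard function that is flat at \<open>0\<close>.
  The powers make the family stable under differentiation, up to linear combinations.\<close>

definition flat_exp :: "nat \<Rightarrow> real \<Rightarrow> real" where
  "flat_exp k t = (if t \<le> 0 then 0 else (1 / t) ^ k * exp (- (1 / t)))"

lemma flat_exp_tendsto_0: "(flat_exp k \<longlongrightarrow> 0) (at 0)"
proof (rule filterlim_split_at)
  show "(flat_exp k \<longlongrightarrow> 0) (at_left 0)"
    by (rule tendsto_eventually) (auto simp: flat_exp_def eventually_at_filter)
  have "((\<lambda>x. flat_exp k (inverse x)) \<longlongrightarrow> 0) at_top"
  proof (rule Lim_transform_eventually[OF tendsto_power_div_exp_0])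
    show "\<forall>\<^sub>F x in at_top. x ^ k / exp x = flat_exp k (inverse x)"
      using eventually_gt_at_top[of 0] by eventually_elim (simp add: flat_exp_def exp_minus divide_inverse)
  qed
  then show "(flat_exp k \<longlongrightarrow> 0) (at_right 0)" by (simp add: filterlim_at_right_to_top)
qed

lemma flat_exp_deriv:
  "(flat_exp k has_real_derivative (- real k * flat_exp (k + 1) t + flat_exp (k + 2) t)) (at t)"
proof (cases t "0::real" rule: linorder_cases)
  case less
  have "((\<lambda>_. 0) has_real_derivative 0) (at t)" by simp
  then have "(flat_exp k has_real_derivative 0) (at t)"
    by (rule DERIV_cong_ev[THEN iffD1, rotated -1])
       (use less eventually_nhds_in_open[of "{..<0}" t] in \<open>auto elim!: eventually_mono simp: flat_exp_def\<close>)
  then show ?thesis using less by (simp add: flat_exp_def)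
next
  case equal
  have "((\<lambda>h. (flat_exp k (0 + h) - flat_exp k 0) / h) \<longlongrightarrow> 0) (at 0)"
    by (rule Lim_transform_eventually[OF flat_exp_tendsto_0[of "Suc k"]])
       (auto simp: eventually_at_filter flat_exp_def)
  then show ?thesis using equal by (simp add: DERIV_def flat_exp_def)
next
  case greater
  have "((\<lambda>t. (1 / t) ^ k * exp (- (1 / t))) has_real_derivative
      (- real k * ((1 / t) ^ (k + 1) * exp (- (1 / t))) + (1 / t) ^ (k + 2) * exp (- (1 / t)))) (at t)"
  proof -
    have d: "((\<lambda>t. (1 / t) ^ k * exp (- (1 / t))) has_real_derivative
      (real k * (1 / t) ^ (k - 1) * (- 1 / t\<^sup>2) * exp (- (1 / t)) + (1 / t) ^ k * (exp (- (1 / t)) * (1 / t\<^sup>2)))) (at t)"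
      using greater by (auto intro!: derivative_eq_intros simp: power2_eq_square)
    show ?thesis by (rule DERIV_cong[OF d]) (use greater in \<open>cases k; simp add: field_simps power2_eq_square\<close>)
  qed
  then have "(flat_exp k has_real_derivative
      (- real k * ((1 / t) ^ (k + 1) * exp (- (1 / t))) + (1 / t) ^ (k + 2) * exp (- (1 / t)))) (at t)"
    by (rule DERIV_cong_ev[THEN iffD1, rotated -1])
       (use greater eventually_nhds_in_open[of "{0<..}" t] in \<open>auto elim!: eventually_mono simp: flat_exp_def\<close>)
  then show ?thesis using greater by (simp add: flat_exp_def)
qed

text \<open>An algebra stable under directional derivatives, hence consisting of smooth functions by
  \<open>smooth_fun_coinduct\<close>. The constants are needed for the factors that differentiation
  brings out, the products for a bump on a cube.\<close>

inductive_set flat_algebra :: "(real^'n::finite \<Rightarrow> real) set" where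
  base: "(\<lambda>x. flat_exp k (c * x $ i + e)) \<in> flat_algebra"
| const: "(\<lambda>x. c) \<in> flat_algebra"
| add: "f \<in> flat_algebra \<Longrightarrow> g \<in> flat_algebra \<Longrightarrow> (\<lambda>x. f x + g x) \<in> flat_algebra"
| mult: "f \<in> flat_algebra \<Longrightarrow> g \<in> flat_algebra \<Longrightarrow> (\<lambda>x. f x * g x) \<in> flat_algebra"

lemma flat_algebra_derivative:
  "f \<in> flat_algebra \<Longrightarrow> \<exists>D. (\<forall>x. (f has_derivative (\<lambda>h. D h x)) (at x)) \<and> (\<forall>h. D h \<in> flat_algebra)"
proof (induction rule: flat_algebra.induct)
  case (base k c i e)
  let ?D = "\<lambda>h x. (- real k * flat_exp (k + 1) (c * x $ i + e) + flat_exp (k + 2) (c * x $ i + e)) * (c * h $ i)"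
  show ?case
  proof (intro exI[of _ ?D] conjI allI)
    fix x :: "real^'a"
    have 1: "((\<lambda>x. c * x $ i + e) has_derivative (\<lambda>h. c * h $ i)) (at x)"
      by (auto intro!: derivative_eq_intros bounded_linear.has_derivative[OF bounded_linear_vec_nth])
    show "((\<lambda>x. flat_exp k (c * x $ i + e)) has_derivative (\<lambda>h. ?D h x)) (at x)"
      using has_derivative_compose[OF 1 flat_exp_deriv[of k, unfolded has_field_derivative_def]] by simp
    show "?D h \<in> flat_algebra" for h
      by (intro flat_algebra.intros)
  qed
next
  case (const c)
  show ?case by (rule exI[of _ "\<lambda>h x. 0"]) (auto intro: flat_algebra.const)
next
  case (add f g)
  then obtain D E where "\<And>x. (f has_derivative (\<lambda>h. D h x)) (at x)" "\<And>h. D h \<in> flat_algebra"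
    "\<And>x. (g has_derivative (\<lambda>h. E h x)) (at x)" "\<And>h. E h \<in> flat_algebra" by blast
  then show ?case
    by (intro exI[of _ "\<lambda>h x. D h x + E h x"] conjI allI) (auto intro!: has_derivative_add flat_algebra.add)
next
  case (mult f g)
  then obtain D E where *: "\<And>x. (f has_derivative (\<lambda>h. D h x)) (at x)" "\<And>h. D h \<in> flat_algebra"
    "\<And>x. (g has_derivative (\<lambda>h. E h x)) (at x)" "\<And>h. E h \<in> flat_algebra" by blast
  show ?case
    by (intro exI[of _ "\<lambda>h x. f x * E h x + D h x * g x"] conjI allI has_derivative_mult flat_algebra.add flat_algebra.mult mult.hyps *)
qed

lemma flat_algebra_smooth:
  assumes "f \<in> flat_algebra"
  shows "smooth_fun f"
proof (rule smooth_fun_coinduct[OF assms])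
  fix f :: "real^'n \<Rightarrow> real" and i x assume "f \<in> flat_algebra"
  then obtain D where D: "\<And>x. (f has_derivative (\<lambda>h. D h x)) (at x)" "\<And>h. D h \<in> flat_algebra"
    using flat_algebra_derivative by blast
  show "f differentiable (at x)" using D(1) by (auto simp: differentiable_def)
  have "partial_deriv i f = D (axis i 1)" using partial_deriv_eq[OF D(1)] by auto
  then show "partial_deriv i f \<in> flat_algebra" using D(2) by simp
qed

lemma flat_algebra_prod:
  "finite I \<Longrightarrow> (\<And>i. i \<in> I \<Longrightarrow> F i \<in> flat_algebra) \<Longrightarrow> (\<lambda>x. \<Prod>i\<in>I. F i x) \<in> flat_algebra"
  by (induction rule: finite_induct) (auto intro: flat_algebra.intros)

lemma exists_smooth_kernel:
  assumes "d > 0"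
  obtains \<eta> :: "real^'n::finite \<Rightarrow> real" where "smooth_fun \<eta>" "kernel \<eta> d"
proof -
  \<comment> \<open>The bump lives on the cube \<open>\<bar>x $ i\<bar> < 1 / s\<close>; with this
    \<open>s\<close> the \<open>l1\<close> norm, and so the Euclidean norm, stays below
    \<open>d\<close> there.\<close>
  define s where "s = real CARD('n) / d"
  have s: "s > 0" using assms by (simp add: s_def)
  define \<psi> :: "real^'n \<Rightarrow> real" where "\<psi> x = (\<Prod>i\<in>UNIV. flat_exp 0 (s * x $ i + 1) * flat_exp 0 ((- s) * x $ i + 1))" for x
  have sm: "\<psi> \<in> flat_algebra" unfolding \<psi>_def[abs_def]
    by (intro flat_algebra_prod flat_algebra.mult flat_algebra.base) simp
  have cont: "continuous_on UNIV \<psi>" by (rule smooth_fun_continuous[OF flat_algebra_smooth[OF sm]])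
  have nonneg: "\<psi> x \<ge> 0" for x unfolding \<psi>_def by (intro prod_nonneg) (auto simp: flat_exp_def)
  have zero: "\<psi> x = 0" if "d \<le> norm x" for x
  proof (rule ccontr)
    assume "\<psi> x \<noteq> 0"
    then have "\<forall>i. flat_exp 0 (s * x $ i + 1) * flat_exp 0 ((- s) * x $ i + 1) \<noteq> 0"
      by (simp add: \<psi>_def)
    then have pos: "s * x $ i + 1 > 0 \<and> (- s) * x $ i + 1 > 0" for i
      by (auto simp: flat_exp_def split: if_splits dest: spec[of _ i])
    have *: "\<bar>x $ i\<bar> < 1 / s" for i
      using s pos[of i] by (auto simp: abs_less_iff field_simps)
    have "norm x \<le> (\<Sum>i\<in>UNIV. \<bar>x $ i\<bar>)" by (rule norm_le_l1_cart)
    also have "\<dots> < (\<Sum>i\<in>(UNIV::'n set). 1 / s)" using * by (intro sum_strict_mono) auto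
    also have "\<dots> = d" using assms by (simp add: s_def)
    finally show False using that by simp
  qed
  have int: "integrable lborel \<psi>" by (rule continuous_compact_support_integrable[OF cont zero])
  \<comment> \<open>Otherwise the set where \<open>\<psi>\<close> is nonzero would be negligible,
    although it is open and contains \<open>0\<close>.\<close>
  have "integral\<^sup>L lborel \<psi> \<noteq> 0"
  proof
    assume "integral\<^sup>L lborel \<psi> = 0"
    then have ae: "AE x in lborel. \<psi> x = 0"
      using integral_nonneg_eq_0_iff_AE[OF int] nonneg by simp
    have op: "open {x. \<psi> x \<noteq> 0}" using cont by (intro open_Collect_neq continuous_intros)
    have "0 \<in> {x. \<psi> x \<noteq> 0}" by (simp add: \<psi>_def flat_exp_def)
    moreover have "{x. \<psi> x \<noteq> 0} \<in> null_sets lborel"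
      using ae op by (subst AE_iff_null_sets) auto
    then have "negligible {x. \<psi> x \<noteq> 0}" by (simp add: negligible_iff_null_sets null_sets_completionI)
    ultimately show False using open_not_negligible[OF op] by blast
  qed
  then have pos: "integral\<^sup>L lborel \<psi> > 0" using nonneg by (simp add: order_less_le)
  define \<eta> where "\<eta> x = 1 / integral\<^sup>L lborel \<psi> * \<psi> x" for x
  have "smooth_fun \<eta>" unfolding \<eta>_def[abs_def]
    by (intro flat_algebra_smooth flat_algebra.mult flat_algebra.const sm)
  moreover have "kernel \<eta> d" unfolding kernel_def \<eta>_def[abs_def]
    using cont nonneg zero int pos by (auto intro!: continuous_intros)
  ultimately show ?thesis using that by blast
qed

subsection \<open>Weak gradients\<close>

text \<open>Bridges \<open>lebesgue_on S\<close> and mollification, which integrates over the whole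
  space.\<close>

definition zero_ext :: "'a set \<Rightarrow> ('a \<Rightarrow> 'b::real_vector) \<Rightarrow> 'a \<Rightarrow> 'b" where
  "zero_ext S f x = indicator S x *\<^sub>R f x"

definition mollifier :: "nat \<Rightarrow> real^'n::finite \<Rightarrow> real" where
  "mollifier k = (SOME \<eta>. smooth_fun \<eta> \<and> kernel \<eta> (1 / real (Suc k)))"

lemma mollifier: "smooth_fun (mollifier k)" "kernel (mollifier k) (1 / real (Suc k))"
proof -
  have "\<exists>\<eta> :: real^'n \<Rightarrow> real. smooth_fun \<eta> \<and> kernel \<eta> (1 / real (Suc k))"
    by (rule exists_smooth_kernel[of "1 / real (Suc k)"]) auto
  from someI_ex[OF this] show "smooth_fun (mollifier k :: real^'n \<Rightarrow> real)" "kernel (mollifier k :: real^'n \<Rightarrow> real) (1 / real (Suc k))"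
    by (auto simp: mollifier_def)
qed

lemma lebesgue_on_zero_ext:
  fixes f :: "'a::euclidean_space \<Rightarrow> 'b::euclidean_space"
  assumes "S \<in> sets lebesgue"
  shows "integrable (lebesgue_on S) f \<longleftrightarrow> integrable lebesgue (zero_ext S f)"
    and "integral\<^sup>L (lebesgue_on S) f = integral\<^sup>L lebesgue (zero_ext S f)"
    and "f \<in> borel_measurable (lebesgue_on S) \<longleftrightarrow> zero_ext S f \<in> borel_measurable lebesgue"
proof -
  have "zero_ext S f = (\<lambda>x. indicator S x *\<^sub>R f x)" by (auto simp: zero_ext_def)
  then show "integrable (lebesgue_on S) f \<longleftrightarrow> integrable lebesgue (zero_ext S f)"
    and "integral\<^sup>L (lebesgue_on S) f = integral\<^sup>L lebesgue (zero_ext S f)"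
    and "f \<in> borel_measurable (lebesgue_on S) \<longleftrightarrow> zero_ext S f \<in> borel_measurable lebesgue"
    using assms by (simp_all add: integrable_restrict_space Bochner_Integration.integral_restrict_space borel_measurable_restrict_space_iff)
qed

lemma integrable_lebesgue_on_subset:
  fixes f :: "'a::euclidean_space \<Rightarrow> 'b::euclidean_space"
  assumes "integrable (lebesgue_on S) f" "S \<in> sets lebesgue" "T \<in> sets lebesgue" "T \<subseteq> S"
  shows "integrable (lebesgue_on T) f"
proof -
  have "zero_ext T f = (\<lambda>x. indicator T x *\<^sub>R zero_ext S f x)"
    using assms(4) by (auto simp: fun_eq_iff zero_ext_def indicator_def)
  then show ?thesis
    using assms integrable_mult_indicator[of T lebesgue "zero_ext S f"] by (simp add: lebesgue_on_zero_ext)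
qed

lemma compact_support_scaleR_integrable:
  fixes g :: "'a::euclidean_space \<Rightarrow> real" and f :: "'a \<Rightarrow> 'b::euclidean_space"
  assumes g: "continuous_on UNIV g" "\<And>x. x \<notin> K \<Longrightarrow> g x = 0" and K: "compact K"
    and f: "integrable (lebesgue_on K) f"
  shows "integrable lebesgue (\<lambda>x. g x *\<^sub>R f x)"
    and "K \<subseteq> S \<Longrightarrow> S \<in> sets lebesgue \<Longrightarrow> integrable (lebesgue_on S) (\<lambda>x. g x *\<^sub>R f x)"
    and "K \<subseteq> S \<Longrightarrow> S \<in> sets lebesgue \<Longrightarrow>
      integral\<^sup>L (lebesgue_on S) (\<lambda>x. g x *\<^sub>R f x) = integral\<^sup>L lebesgue (\<lambda>x. g x *\<^sub>R f x)"
proof -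
  obtain d where d: "\<And>x. x \<in> K \<Longrightarrow> norm x \<le> d" using compact_imp_bounded[OF K] by (auto simp: bounded_iff)
  have g0: "g x = 0" if "d + 1 \<le> norm x" for x using g(2)[of x] d[of x] that by fastforce
  obtain B where B: "B > 0" "\<And>x. norm (g x) \<le> B"
    using compact_support_bounded[where d = "d + 1", OF g(1) g0] by metis
  have KL: "K \<in> sets lebesgue" using K by (simp add: compact_imp_closed)
  have fi: "integrable lebesgue (zero_ext K f)" using f KL by (simp add: lebesgue_on_zero_ext)
  have gm [measurable]: "g \<in> borel_measurable lebesgue"
    using borel_measurable_continuous_onI[OF g(1)] by (intro measurable_completion) simp
  note [measurable] = borel_measurable_integrable[OF fi]
  have eq: "(\<lambda>x. g x *\<^sub>R f x) = (\<lambda>x. g x *\<^sub>R zero_ext K f x)"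
    by (rule ext) (use g(2) in \<open>auto simp: zero_ext_def indicator_def\<close>)
  show int: "integrable lebesgue (\<lambda>x. g x *\<^sub>R f x)" unfolding eq
  proof (rule Bochner_Integration.integrable_bound)
    show "integrable lebesgue (\<lambda>x. B *\<^sub>R zero_ext K f x)" using fi by simp
    show "AE x in lebesgue. norm (g x *\<^sub>R zero_ext K f x) \<le> norm (B *\<^sub>R zero_ext K f x)"
      using B by (auto intro!: mult_right_mono)
  qed measurable
  assume S: "K \<subseteq> S" "S \<in> sets lebesgue"
  have "zero_ext S (\<lambda>x. g x *\<^sub>R f x) = (\<lambda>x. g x *\<^sub>R f x)"
  proof
    fix x show "zero_ext S (\<lambda>x. g x *\<^sub>R f x) x = g x *\<^sub>R f x"
      using S(1) g(2)[of x] by (cases "x \<in> K") (auto simp: zero_ext_def indicator_def)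
  qed
  then show "integrable (lebesgue_on S) (\<lambda>x. g x *\<^sub>R f x)"
    and "integral\<^sup>L (lebesgue_on S) (\<lambda>x. g x *\<^sub>R f x) = integral\<^sup>L lebesgue (\<lambda>x. g x *\<^sub>R f x)"
    using S int by (simp_all add: lebesgue_on_zero_ext)
qed

lemma weak_gradient_integrable_compact:
  assumes "weak_gradient \<Omega> u G" "compact K" "K \<subseteq> \<Omega>"
  shows "integrable (lebesgue_on K) u" "integrable (lebesgue_on K) (\<lambda>x. G x $ i)"
  using assms unfolding weak_gradient_def by auto

lemma weak_gradient_test:
  assumes "weak_gradient \<Omega> u G" "test_fun \<Omega> \<phi>"
  shows "integral\<^sup>L (lebesgue_on \<Omega>) (\<lambda>x. partial_deriv i \<phi> x *\<^sub>R u x)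
          = - integral\<^sup>L (lebesgue_on \<Omega>) (\<lambda>x. \<phi> x *\<^sub>R G x $ i)"
  using assms unfolding weak_gradient_def by auto

text \<open>Test functions and their partial derivatives vanish off a compact subset of
  \<open>\<Omega>\<close>, so the defining identity may be checked with integrals over the whole
  space.\<close>

lemma weak_gradientI:
  fixes u :: "real^'n::finite \<Rightarrow> 'b::euclidean_space"
  assumes \<Omega>: "open \<Omega>" and u: "integrable (lebesgue_on \<Omega>) u" and G: "\<And>i. integrable (lebesgue_on \<Omega>) (\<lambda>x. G x $ i)"
    and eq: "\<And>i (\<phi>::real^'n \<Rightarrow> real). test_fun \<Omega> \<phi> \<Longrightarrow>
       integral\<^sup>L lebesgue (\<lambda>x. partial_deriv i \<phi> x *\<^sub>R u x) = - integral\<^sup>L lebesgue (\<lambda>x. \<phi> x *\<^sub>R G x $ i)"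
  shows "weak_gradient \<Omega> u G"
proof -
  have \<Omega>L: "\<Omega> \<in> sets lebesgue" using \<Omega> by simp
  show ?thesis unfolding weak_gradient_def
  proof (intro conjI allI impI)
    fix K :: "(real^'n) set" assume "compact K \<and> K \<subseteq> \<Omega>"
    then have K: "K \<in> sets lebesgue" "K \<subseteq> \<Omega>" by (auto simp: compact_imp_closed)
    show "integrable (lebesgue_on K) u" "\<And>i. integrable (lebesgue_on K) (\<lambda>x. G x $ i)"
      using integrable_lebesgue_on_subset[OF _ \<Omega>L K] u G by auto
  next
    fix i and \<phi> :: "real^'n \<Rightarrow> real" assume \<phi>: "test_fun \<Omega> \<phi>"
    then obtain K where K: "compact K" "K \<subseteq> \<Omega>" "\<And>x. x \<notin> K \<Longrightarrow> \<phi> x = 0" "\<And>x i. x \<notin> K \<Longrightarrow> partial_deriv i \<phi> x = 0"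
      by (rule test_funE) (rule that)
    have KL: "K \<in> sets lebesgue" using K by (auto simp: compact_imp_closed)
    have sm: "smooth_fun \<phi>" using \<phi> by (simp add: test_fun_def)
    note i1 = compact_support_scaleR_integrable(3)[OF smooth_fun_continuous[OF smooth_fun_partial[OF sm, of i]] K(4) K(1)
          integrable_lebesgue_on_subset[OF u \<Omega>L KL K(2)] K(2) \<Omega>L]
    note i2 = compact_support_scaleR_integrable(3)[OF smooth_fun_continuous[OF sm] K(3) K(1)
          integrable_lebesgue_on_subset[OF G[of i] \<Omega>L KL K(2)] K(2) \<Omega>L]
    show "integral\<^sup>L (lebesgue_on \<Omega>) (\<lambda>x. partial_deriv i \<phi> x *\<^sub>R u x)
          = - integral\<^sup>L (lebesgue_on \<Omega>) (\<lambda>x. \<phi> x *\<^sub>R G x $ i)"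
      using eq[OF \<phi>, of i] i1 i2 by simp
  qed
qed

lemma weak_gradient_test':
  fixes u :: "real^'n::finite \<Rightarrow> 'b::euclidean_space"
  assumes "open \<Omega>" "weak_gradient \<Omega> u G" "test_fun \<Omega> \<phi>"
  shows "integrable lebesgue (\<lambda>x. partial_deriv i \<phi> x *\<^sub>R u x)" "integrable lebesgue (\<lambda>x. \<phi> x *\<^sub>R G x $ i)"
    "integral\<^sup>L lebesgue (\<lambda>x. partial_deriv i \<phi> x *\<^sub>R u x) = - integral\<^sup>L lebesgue (\<lambda>x. \<phi> x *\<^sub>R G x $ i)"
proof -
  have \<Omega>L: "\<Omega> \<in> sets lebesgue" using assms by simp
  obtain K where K: "compact K" "K \<subseteq> \<Omega>" "\<And>x. x \<notin> K \<Longrightarrow> \<phi> x = 0" "\<And>x i. x \<notin> K \<Longrightarrow> partial_deriv i \<phi> x = 0"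
    by (rule test_funE[OF assms(3)]) (rule that)
  have sm: "smooth_fun \<phi>" using assms by (simp add: test_fun_def)
  note i1 = compact_support_scaleR_integrable[OF smooth_fun_continuous[OF smooth_fun_partial[OF sm, of i]] K(4) K(1)
        weak_gradient_integrable_compact(1)[OF assms(2) K(1,2)]]
  note i2 = compact_support_scaleR_integrable[OF smooth_fun_continuous[OF sm] K(3) K(1)
        weak_gradient_integrable_compact(2)[OF assms(2) K(1,2), of i]]
  show "integrable lebesgue (\<lambda>x. partial_deriv i \<phi> x *\<^sub>R u x)" "integrable lebesgue (\<lambda>x. \<phi> x *\<^sub>R G x $ i)"
    using i1(1) i2(1) by simp_all
  show "integral\<^sup>L lebesgue (\<lambda>x. partial_deriv i \<phi> x *\<^sub>R u x) = - integral\<^sup>L lebesgue (\<lambda>x. \<phi> x *\<^sub>R G x $ i)"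
    using weak_gradient_test[OF assms(2,3), of i] i1(3)[OF _ K(2) \<Omega>L] i2(3)[OF _ K(2) \<Omega>L] by simp
qed

lemma reflected_kernel_test_fun:
  fixes \<eta> :: "real^'n::finite \<Rightarrow> real"
  assumes "smooth_fun \<eta>" "kernel \<eta> d" "cball x d \<subseteq> \<Omega>"
  shows "test_fun \<Omega> (\<lambda>y. \<eta> (x - y))"
proof (rule test_funI[OF smooth_fun_reflect[OF assms(1)] compact_cball assms(3)])
  fix y assume "y \<notin> cball x d"
  then show "\<eta> (x - y) = 0" using assms(2) by (auto simp: kernel_def dist_norm)
qed

text \<open>When the ball around \<open>x\<close> lies in \<open>\<Omega>\<close>, the reflected
  kernel \<open>\<lambda>y. \<eta> (x - y)\<close> is a test function, and the weak gradient takes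
  over its derivative. The sign from the reflection cancels the one from the definition.\<close>

lemma mollify_weak_partial:
  fixes u :: "real^'n::finite \<Rightarrow> 'b::euclidean_space"
  assumes \<Omega>: "open \<Omega>" and w: "weak_gradient \<Omega> u G" and u: "integrable (lebesgue_on \<Omega>) u"
    and \<eta>: "smooth_fun \<eta>" "kernel \<eta> d" and x: "cball x d \<subseteq> \<Omega>"
  shows "partial_deriv i (mollify \<eta> (zero_ext \<Omega> u)) x = mollify \<eta> (zero_ext \<Omega> (\<lambda>y. G y $ i)) x"
proof -
  have \<Omega>L: "\<Omega> \<in> sets lebesgue" using \<Omega> by simp
  have \<eta>0: "\<eta> z = 0" if "d < norm z" for z using \<eta>(2) that by (auto simp: kernel_def)
  have d\<eta>0: "partial_deriv i \<eta> z = 0" if "d < norm z" for z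
    by (rule partial_deriv_zero_outside[OF open_outside_cball[of d]]) (use that \<eta>0 in auto)
  have ui: "integrable lebesgue (zero_ext \<Omega> u)" using u \<Omega>L by (simp add: lebesgue_on_zero_ext)
  have out: "y \<in> \<Omega>" if "norm (x - y) \<le> d" for y using x that by (auto simp: subset_iff dist_norm)
  note t = reflected_kernel_test_fun[OF \<eta> x]
  have "partial_deriv i (mollify \<eta> (zero_ext \<Omega> u)) x = mollify (partial_deriv i \<eta>) (zero_ext \<Omega> u) x"
    by (rule mollify_partial_deriv[where d = d, OF \<eta>(1) \<eta>0 ui])
  also have "\<dots> = integral\<^sup>L lebesgue (\<lambda>y. - (partial_deriv i (\<lambda>y. \<eta> (x - y)) y *\<^sub>R u y))"
    unfolding mollify_def
  proof (rule Bochner_Integration.integral_cong[OF refl])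
    fix y
    show "partial_deriv i \<eta> (x - y) *\<^sub>R zero_ext \<Omega> u y = - (partial_deriv i (\<lambda>y. \<eta> (x - y)) y *\<^sub>R u y)"
      using out[of y] d\<eta>0[of "x - y"] partial_deriv_reflect(2)[OF smooth_fun_differentiable[OF \<eta>(1)], of i x y]
      by (cases "norm (x - y) \<le> d") (auto simp: zero_ext_def)
  qed
  also have "\<dots> = integral\<^sup>L lebesgue (\<lambda>y. \<eta> (x - y) *\<^sub>R G y $ i)"
    using weak_gradient_test'(3)[OF \<Omega> w t, of i] by simp
  also have "\<dots> = mollify \<eta> (zero_ext \<Omega> (\<lambda>y. G y $ i)) x"
    unfolding mollify_def
  proof (rule Bochner_Integration.integral_cong[OF refl])
    fix y
    show "\<eta> (x - y) *\<^sub>R G y $ i = \<eta> (x - y) *\<^sub>R zero_ext \<Omega> (\<lambda>y. G y $ i) y"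
      using out[of y] \<eta>0[of "x - y"] by (cases "norm (x - y) \<le> d") (auto simp: zero_ext_def)
  qed
  finally show ?thesis .
qed

lemma mollify_mollifier:
  fixes f :: "real^'n::finite \<Rightarrow> 'b::euclidean_space"
  assumes "integrable lebesgue f"
  shows "smooth_fun (mollify (mollifier k) f)" "mollify (mollifier k) f \<in> borel_measurable borel"
proof -
  have 0: "mollifier k x = (0::real)" if "1 / real (Suc k) < norm x" for x :: "real^'n"
    using mollifier(2)[of k] that unfolding kernel_def by (metis less_imp_le)
  show s: "smooth_fun (mollify (mollifier k) f)"
    by (rule mollify_smooth[where d = "1 / real (Suc k)", OF mollifier(1) 0 assms])
  show "mollify (mollifier k) f \<in> borel_measurable borel"
    by (rule borel_measurable_continuous_onI[OF smooth_fun_continuous[OF s]])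
qed

lemma eventually_mollifier_radius:
  assumes "e > 0"
  shows "\<forall>\<^sub>F k in sequentially. 1 / real (Suc k) \<le> e"
proof -
  have "(\<lambda>k. 1 / real (Suc k)) \<longlonglongrightarrow> 0" by (rule LIMSEQ_Suc[OF lim_1_over_n])
  from order_tendstoD(2)[OF this assms] show ?thesis by (auto elim: eventually_mono)
qed

text \<open>Reflected kernels are test functions, so on a compact subset of \<open>\<Omega>\<close>
  the mollifications of \<open>f\<close> vanish once the radius is small; yet they converge to
  \<open>f\<close> in \<open>L1\<close>. Countably many compact sets exhaust
  \<open>\<Omega>\<close>.\<close>

lemma fundamental_lemma_calculus_of_variations:
  fixes f :: "real^'n::finite \<Rightarrow> 'b::euclidean_space"
  assumes \<Omega>: "open \<Omega>" and loc: "\<And>K. compact K \<Longrightarrow> K \<subseteq> \<Omega> \<Longrightarrow> integrable (lebesgue_on K) f"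
    and orth: "\<And>\<phi>::real^'n \<Rightarrow> real. test_fun \<Omega> \<phi> \<Longrightarrow> integral\<^sup>L lebesgue (\<lambda>x. \<phi> x *\<^sub>R f x) = 0"
  shows "AE x in lebesgue. x \<in> \<Omega> \<longrightarrow> f x = 0"
proof -
  have compact_case: "AE x in lebesgue. x \<in> K \<longrightarrow> f x = 0" if K: "compact K" "K \<subseteq> \<Omega>" for K
  proof -
    obtain \<epsilon> where e: "\<epsilon> > 0" "(\<Union>x\<in>K. cball x \<epsilon>) \<subseteq> \<Omega>"
      using compact_subset_open_imp_cball_epsilon_subset[OF K(1) \<Omega> K(2)] by metis
    \<comment> \<open>As \<open>f\<close> is only locally integrable, it is cut off to a compact
      neighbourhood \<open>L\<close> of \<open>K\<close>; kernels of radius at most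
      \<open>\<epsilon>\<close> centred in \<open>K\<close> do not see the cut.\<close>
    define L where "L = (\<Union>x\<in>K. cball x \<epsilon>)"
    have L: "compact L" unfolding L_def by (rule compact_minkowski_sum_cball[OF K(1)])
    then have LL: "L \<in> sets lebesgue" by (simp add: compact_imp_closed)
    have fi: "integrable lebesgue (zero_ext L f)"
      using loc[OF L] e LL by (simp add: L_def[symmetric] lebesgue_on_zero_ext)
    have KL [measurable]: "K \<in> sets lebesgue" using K by (simp add: compact_imp_closed)
    let ?m = "\<lambda>k. mollify (mollifier k) (zero_ext L f)"
    have m0: "?m k x = 0" if "x \<in> K" "1 / real (Suc k) \<le> \<epsilon>" for x k
    proof -
      have k: "kernel (mollifier k :: real^'n \<Rightarrow> real) \<epsilon>"
        using mollifier(2)[of k] that(2) unfolding kernel_def by (meson order_trans)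
      have sub: "cball x \<epsilon> \<subseteq> L" using that by (auto simp: L_def)
      have "?m k x = integral\<^sup>L lebesgue (\<lambda>y. mollifier k (x - y) *\<^sub>R f y)"
        unfolding mollify_def
      proof (rule Bochner_Integration.integral_cong[OF refl])
        fix y show "mollifier k (x - y) *\<^sub>R zero_ext L f y = mollifier k (x - y) *\<^sub>R f y"
          using sub k by (cases "norm (x - y) \<le> \<epsilon>") (auto simp: zero_ext_def kernel_def subset_iff dist_norm)
      qed
      also have "\<dots> = 0"
        by (rule orth[OF reflected_kernel_test_fun[OF mollifier(1) k]]) (use sub e in \<open>auto simp: L_def\<close>)
      finally show ?thesis .
    qed
    have lim: "(\<lambda>k. \<integral>\<^sup>+x. ennreal (norm (?m k x - zero_ext L f x)) \<partial>lebesgue) \<longlonglongrightarrow> 0"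
      by (rule mollify_tendsto(1)[OF mollifier(2) fi mollify_mollifier(2)[OF fi]])
    have "(\<integral>\<^sup>+x. ennreal (norm (zero_ext K f x)) \<partial>lebesgue) \<le> 0"
    proof (rule tendsto_lowerbound[OF lim])
      show "\<forall>\<^sub>F k in sequentially. (\<integral>\<^sup>+x. ennreal (norm (zero_ext K f x)) \<partial>lebesgue)
         \<le> (\<integral>\<^sup>+x. ennreal (norm (?m k x - zero_ext L f x)) \<partial>lebesgue)"
        using eventually_mollifier_radius[OF e(1)]
      proof eventually_elim
        case (elim k)
        show ?case
        proof (rule nn_integral_mono)
          fix x
          have "K \<subseteq> L" using e(1) by (auto simp: L_def)
          then show "ennreal (norm (zero_ext K f x)) \<le> ennreal (norm (?m k x - zero_ext L f x))"
            using m0[OF _ elim, of x] by (cases "x \<in> K") (auto simp: zero_ext_def)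
        qed
      qed
    qed simp
    then have "AE x in lebesgue. ennreal (norm (zero_ext K f x)) = 0"
      using borel_measurable_integrable[OF loc[OF K]] KL
      by (subst nn_integral_0_iff_AE[symmetric]) (auto simp: lebesgue_on_zero_ext)
    then show ?thesis by (auto elim!: eventually_mono simp: zero_ext_def)
  qed
  obtain C :: "nat \<Rightarrow> (real^'n) set" where C: "\<And>n. compact (C n)" "\<And>n. C n \<subseteq> \<Omega>" "\<Omega> = \<Union>(range C)"
    using open_Union_compact_subsets[OF \<Omega>] by metis
  have "AE x in lebesgue. \<forall>n. x \<in> C n \<longrightarrow> f x = 0"
    unfolding AE_all_countable using compact_case[OF C(1,2)] by blast
  then show ?thesis by (rule eventually_mono) (use C in auto)
qed

text \<open>This makes the choice hidden in \<open>sobolev_grad\<close> harmless: the energy may be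
  computed with any weak gradient at hand.\<close>

lemma weak_gradient_unique:
  fixes u :: "real^'n::finite \<Rightarrow> 'b::euclidean_space"
  assumes \<Omega>: "open \<Omega>" and G: "weak_gradient \<Omega> u G" and H: "weak_gradient \<Omega> u H"
  shows "AE x in lebesgue_on \<Omega>. G x = H x"
proof -
  have "AE x in lebesgue. x \<in> \<Omega> \<longrightarrow> G x $ i - H x $ i = 0" for i
  proof (rule fundamental_lemma_calculus_of_variations[OF \<Omega>])
    fix \<phi> :: "real^'n \<Rightarrow> real" assume \<phi>: "test_fun \<Omega> \<phi>"
    show "integral\<^sup>L lebesgue (\<lambda>x. \<phi> x *\<^sub>R (G x $ i - H x $ i)) = 0"
      using weak_gradient_test'[OF \<Omega> G \<phi>, of i] weak_gradient_test'[OF \<Omega> H \<phi>, of i]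
      by (simp add: scaleR_diff_right)
  qed (use weak_gradient_integrable_compact[OF G] weak_gradient_integrable_compact[OF H] in auto)
  then have "AE x in lebesgue. \<forall>i. x \<in> \<Omega> \<longrightarrow> G x $ i - H x $ i = 0" unfolding AE_all_countable by blast
  then have "AE x in lebesgue. x \<in> \<Omega> \<longrightarrow> G x = H x" by (auto elim!: eventually_mono simp: vec_eq_iff)
  then show ?thesis using \<Omega> by (simp add: AE_restrict_space_iff)
qed

lemma test_fun_weak_gradient:
  fixes \<psi> :: "real^'n::finite \<Rightarrow> real"
  assumes \<Omega>: "open \<Omega>" and \<psi>: "test_fun \<Omega> \<psi>"
  shows "weak_gradient \<Omega> \<psi> (\<lambda>x. \<chi> i. partial_deriv i \<psi> x)"
proof (rule weak_gradientI[OF \<Omega>])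
  have \<Omega>L: "\<Omega> \<in> sets lebesgue" using \<Omega> by simp
  obtain K where K: "compact K" "K \<subseteq> \<Omega>" "\<And>x. x \<notin> K \<Longrightarrow> \<psi> x = 0" "\<And>x i. x \<notin> K \<Longrightarrow> partial_deriv i \<psi> x = 0"
    by (rule test_funE[OF \<psi>]) (rule that)
  have sm: "smooth_fun \<psi>" using \<psi> by (simp add: test_fun_def)
  have "integrable (lebesgue_on K) (\<lambda>x. 1::real)"
    using lmeasurable_compact[OF K(1)] K(1) by (simp add: integrable_restrict_space compact_imp_closed lmeasurable_iff_integrable)
  then show "integrable (lebesgue_on \<Omega>) \<psi>" "\<And>i. integrable (lebesgue_on \<Omega>) (\<lambda>x. (\<chi> i. partial_deriv i \<psi> x) $ i)"
    using compact_support_scaleR_integrable(2)[OF smooth_fun_continuous[OF sm] K(3) K(1) _ K(2) \<Omega>L, of "\<lambda>_. 1::real"]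
      compact_support_scaleR_integrable(2)[OF smooth_fun_continuous[OF smooth_fun_partial[OF sm]] K(4) K(1) _ K(2) \<Omega>L, of "\<lambda>_. 1::real"]
    by simp_all
  fix i and \<phi> :: "real^'n \<Rightarrow> real" assume \<phi>: "test_fun \<Omega> \<phi>"
  have smp: "smooth_fun \<phi>" using \<phi> by (simp add: test_fun_def)
  obtain d where d: "\<And>x. x \<in> K \<Longrightarrow> norm x \<le> d" using compact_imp_bounded[OF K(1)] by (auto simp: bounded_iff)
  have z: "\<psi> x = 0 \<and> partial_deriv i \<psi> x = 0" if "d < norm x" for x using K(3,4)[of x] d[of x] that by fastforce
  have "integral\<^sup>L lebesgue (\<lambda>x. (\<Sum>j\<in>UNIV. axis i 1 $ j *\<^sub>R partial_deriv j \<phi> x) *\<^sub>R \<psi> x)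
    = - integral\<^sup>L lebesgue (\<lambda>x. \<phi> x *\<^sub>R (\<Sum>j\<in>UNIV. axis i 1 $ j *\<^sub>R partial_deriv j \<psi> x))"
    using z
    by (intro integration_by_parts[where d = d] has_derivative_partials smooth_fun_differentiable sm smp)
       (auto simp only: sum_axis intro!: smooth_fun_continuous smooth_fun_partial sm smp)
  then show "integral\<^sup>L lebesgue (\<lambda>x. partial_deriv i \<phi> x *\<^sub>R \<psi> x) = - integral\<^sup>L lebesgue (\<lambda>x. \<phi> x *\<^sub>R (\<chi> i. partial_deriv i \<psi> x) $ i)"
    by (simp only: sum_axis vec_lambda_beta)
qed

subsection \<open>The chain rule\<close>

text \<open>Turns a product of compositions into a single \<open>C1\<close> function of a pair, so
  that the chain rule also serves as product rule.\<close>

lemma weak_gradient_Pair: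
  fixes f :: "real^'n::finite \<Rightarrow> 'b::euclidean_space" and g :: "real^'n \<Rightarrow> 'c::euclidean_space"
  assumes \<Omega>: "open \<Omega>" and f: "weak_gradient \<Omega> f F" and g: "weak_gradient \<Omega> g G"
    and i: "integrable (lebesgue_on \<Omega>) f" "integrable (lebesgue_on \<Omega>) g"
      "\<And>i. integrable (lebesgue_on \<Omega>) (\<lambda>x. F x $ i)" "\<And>i. integrable (lebesgue_on \<Omega>) (\<lambda>x. G x $ i)"
  shows "weak_gradient \<Omega> (\<lambda>x. (f x, g x)) (\<lambda>x. \<chi> i. (F x $ i, G x $ i))"
proof -
  have pair: "integrable M (\<lambda>x. (p x, q x))" "integral\<^sup>L M (\<lambda>x. (p x, q x)) = (integral\<^sup>L M p, integral\<^sup>L M q)"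
    if "integrable M p" "integrable M q" for M :: "(real^'n) measure" and p :: "_ \<Rightarrow> 'b" and q :: "_ \<Rightarrow> 'c"
  proof -
    have b1: "bounded_linear (\<lambda>x::'b. (x, 0::'c))" and b2: "bounded_linear (\<lambda>x::'c. (0::'b, x))"
      by (intro bounded_linear_Pair bounded_linear_ident bounded_linear_zero)+
    have eq: "(\<lambda>x. (p x, q x)) = (\<lambda>x. (p x, 0) + (0, q x))" by auto
    note i1 = integrable_bounded_linear[OF b1 that(1)] and i2 = integrable_bounded_linear[OF b2 that(2)]
    show "integrable M (\<lambda>x. (p x, q x))" unfolding eq by (intro Bochner_Integration.integrable_add i1 i2)
    show "integral\<^sup>L M (\<lambda>x. (p x, q x)) = (integral\<^sup>L M p, integral\<^sup>L M q)"
      unfolding eq Bochner_Integration.integral_add[OF i1 i2]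
        integral_bounded_linear[OF b1 that(1)] integral_bounded_linear[OF b2 that(2)] by simp
  qed
  show ?thesis
  proof (rule weak_gradientI[OF \<Omega>])
    show "integrable (lebesgue_on \<Omega>) (\<lambda>x. (f x, g x))" by (intro pair i)
    show "integrable (lebesgue_on \<Omega>) (\<lambda>x. (\<chi> i. (F x $ i, G x $ i)) $ j)" for j
      using pair(1)[OF i(3,4), of j j] by simp
    fix j and \<phi> :: "real^'n \<Rightarrow> real" assume \<phi>: "test_fun \<Omega> \<phi>"
    note a = weak_gradient_test'[OF \<Omega> f \<phi>, of j] and b = weak_gradient_test'[OF \<Omega> g \<phi>, of j]
    show "integral\<^sup>L lebesgue (\<lambda>x. partial_deriv j \<phi> x *\<^sub>R (f x, g x))
      = - integral\<^sup>L lebesgue (\<lambda>x. \<phi> x *\<^sub>R (\<chi> i. (F x $ i, G x $ i)) $ j)"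
      using pair(2)[OF a(1) b(1)] pair(2)[OF a(2) b(2)] a(3) b(3) by simp
  qed
qed

section \<open>Composition with \<open>C1\<close> maps of bounded derivative\<close>

lemma power_sum_le:
  fixes s t :: real
  assumes "0 \<le> s" "0 \<le> t"
  shows "(s + t) ^ p \<le> 2 ^ p * (s ^ p + t ^ p)"
proof -
  have "(s + t) ^ p \<le> (2 * max s t) ^ p" using assms by (intro power_mono) auto
  also have "\<dots> = 2 ^ p * (max s t) ^ p" by (simp add: power_mult_distrib)
  also have "(max s t) ^ p \<le> s ^ p + t ^ p" using assms by (auto simp: max_def)
  finally show ?thesis by simp
qed

text \<open>In finite dimension, continuity of \<open>F' w h\<close> in \<open>w\<close> for each
  fixed direction \<open>h\<close> already means \<open>C1\<close>. The bound \<open>B\<close> makes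
  \<open>F\<close> Lipschitz, so convergence in the mean passes through \<open>F\<close>.\<close>

locale bounded_C1 =
  fixes F :: "'b::euclidean_space \<Rightarrow> 'c::euclidean_space" and F' :: "'b \<Rightarrow> 'b \<Rightarrow> 'c" and B :: real
  assumes deriv: "\<And>w. (F has_derivative F' w) (at w)"
    and deriv_cont: "\<And>h. continuous_on UNIV (\<lambda>w. F' w h)"
    and deriv_bound: "\<And>w h. norm (F' w h) \<le> B * norm h"
begin

lemma B_nonneg: "B \<ge> 0"
proof -
  obtain b :: 'b where "b \<in> Basis" using nonempty_Basis by blast
  then have "norm (F' 0 b) \<le> B" using deriv_bound[of 0 b] by simp
  then show ?thesis using norm_ge_zero order_trans by blast
qed

lemma lin: "linear (F' w)" using deriv has_derivative_linear by blast

lemma expand: "F' w h = (\<Sum>b\<in>Basis. (h \<bullet> b) *\<^sub>R F' w b)"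
proof -
  have "F' w h = F' w (\<Sum>b\<in>Basis. (h \<bullet> b) *\<^sub>R b)" by (simp add: euclidean_representation)
  then show ?thesis by (simp only: linear_sum[OF lin] linear_cmul[OF lin])
qed

lemma F_cont: "continuous_on UNIV F"
  using deriv by (auto intro!: continuous_at_imp_continuous_on has_derivative_continuous)

lemma lipschitz: "norm (F v - F w) \<le> B * norm (v - w)"
proof (rule differentiable_bound[of UNIV])
  show "(F has_derivative F' w) (at w within UNIV)" for w using deriv by simp
  show "onorm (F' w) \<le> B" for w by (rule onorm_le) (rule deriv_bound)
qed auto

lemma F_measurable [measurable]:
  assumes "U \<in> borel_measurable M"
  shows "(\<lambda>x. F (U x)) \<in> borel_measurable M"
  using measurable_compose[OF assms borel_measurable_continuous_onI[OF F_cont]] .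

lemma F'_measurable [measurable]:
  assumes U: "U \<in> borel_measurable M" and H [measurable]: "H \<in> borel_measurable M"
  shows "(\<lambda>x. F' (U x) (H x)) \<in> borel_measurable M"
proof -
  have [measurable]: "(\<lambda>x. F' (U x) b) \<in> borel_measurable M" for b
    using measurable_compose[OF U borel_measurable_continuous_onI[OF deriv_cont]] .
  show ?thesis by (subst expand) measurable
qed

lemma continuous_chain:
  assumes "continuous_on UNIV U" "continuous_on UNIV H"
  shows "continuous_on UNIV (\<lambda>x. F' (U x) (H x))"
proof -
  have "continuous_on UNIV (\<lambda>x. F' (U x) b)" for b
    by (rule continuous_on_compose2[OF deriv_cont assms(1)]) auto
  then show ?thesis by (subst expand) (intro continuous_intros assms)
qed

lemma tendsto_chain:
  assumes "(\<lambda>k. u k) \<longlonglongrightarrow> w"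
  shows "(\<lambda>k. F' (u k) h) \<longlonglongrightarrow> F' w h"
  using deriv_cont[of h] assms by (auto simp: continuous_on_eq_continuous_at intro: continuous_imp_tendsto[of w, unfolded comp_def] isCont_tendsto_compose)

lemma F_integrable:
  assumes "integrable (lebesgue_on K) u" "compact K"
  shows "integrable (lebesgue_on K) (\<lambda>x. F (u x))"
proof (rule Bochner_Integration.integrable_bound)
  have "integrable (lebesgue_on K) (\<lambda>x. norm (F 0))"
    using lmeasurable_compact[OF assms(2)] assms(2)
    by (simp add: integrable_restrict_space compact_imp_closed lmeasurable_iff_integrable)
  then show "integrable (lebesgue_on K) (\<lambda>x. norm (F 0) + B * norm (u x))" using assms by simp
  show "(\<lambda>x. F (u x)) \<in> borel_measurable (lebesgue_on K)" using assms by (intro F_measurable) auto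
  show "AE x in lebesgue_on K. norm (F (u x)) \<le> norm (norm (F 0) + B * norm (u x))"
  proof (intro AE_I2)
    fix x
    have "norm (F (u x)) \<le> norm (F 0) + norm (F (u x) - F 0)" by (metis add.commute diff_add_cancel norm_triangle_ineq)
    then show "norm (F (u x)) \<le> norm (norm (F 0) + B * norm (u x))"
      using lipschitz[of "u x" 0] by simp
  qed
qed

lemma F'_integrable:
  assumes "u \<in> borel_measurable M" "integrable M g"
  shows "integrable M (\<lambda>x. F' (u x) (g x))"
proof (rule Bochner_Integration.integrable_bound)
  show "integrable M (\<lambda>x. B * norm (g x))" using assms by simp
  show "(\<lambda>x. F' (u x) (g x)) \<in> borel_measurable M" using assms by (intro F'_measurable) auto
  show "AE x in M. norm (F' (u x) (g x)) \<le> norm (B * norm (g x))"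
    using deriv_bound B_nonneg by simp
qed

text \<open>The difference splits into \<open>F' (u k x) (h k x - H x)\<close>, controlled by
  \<open>B\<close> and the convergence of \<open>h k\<close>, and
  \<open>F' (u k x) (H x) - F' (U x) (H x)\<close>, which tends to \<open>0\<close> by domination
  with \<open>2 * B * norm (H x)\<close>. The case \<open>p = 1\<close> serves the chain rule,
  \<open>p = 2\<close> the space \<open>sobolev_W12_0\<close>.\<close>

lemma F'_power_limit:
  assumes p: "0 < p" and U: "\<And>k. u k \<in> borel_measurable M" "U \<in> borel_measurable M" "AE x in M. (\<lambda>k. u k x) \<longlonglongrightarrow> U x"
    and H: "H \<in> borel_measurable M" "integrable M (\<lambda>x. (norm (H x))^p)"
    and h: "\<And>k. h k \<in> borel_measurable M" "(\<lambda>k. \<integral>\<^sup>+x. ennreal ((norm (h k x - H x))^p) \<partial>M) \<longlonglongrightarrow> 0"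
  shows "(\<lambda>k. \<integral>\<^sup>+x. ennreal ((norm (F' (u k x) (h k x) - F' (U x) (H x)))^p) \<partial>M) \<longlonglongrightarrow> 0"
proof (rule tendsto_sandwich[OF _ _ tendsto_const])
  note [measurable] = U(1,2) H(1) h(1)
  let ?a = "\<lambda>k x. (norm (h k x - H x))^p"
  let ?e = "\<lambda>k x. (norm (F' (u k x) (H x) - F' (U x) (H x)))^p"
  let ?d = "\<lambda>k x. (norm (F' (u k x) (h k x) - F' (U x) (H x)))^p"
  let ?c = "2^p * B^p"
  let ?R = "\<lambda>k. ennreal ?c * (\<integral>\<^sup>+x. ennreal (?a k x) \<partial>M) + ennreal (2^p) * (\<integral>\<^sup>+x. ennreal (?e k x) \<partial>M)"
  have "(\<lambda>k. \<integral>\<^sup>+x. ennreal (?e k x) \<partial>M) \<longlonglongrightarrow> (\<integral>\<^sup>+x. 0 \<partial>M)"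
  proof (rule nn_integral_dominated_convergence[where w = "\<lambda>x. ennreal ((2 * B)^p * (norm (H x))^p)"])
    show "AE x in M. ennreal (?e k x) \<le> ennreal ((2 * B)^p * (norm (H x))^p)" for k
    proof (intro AE_I2 ennreal_leI)
      fix x
      have "norm (F' (u k x) (H x) - F' (U x) (H x)) \<le> B * norm (H x) + B * norm (H x)"
        by (rule order_trans[OF norm_triangle_ineq4 add_mono[OF deriv_bound deriv_bound]])
      then have "?e k x \<le> (2 * B * norm (H x))^p" by (intro power_mono) auto
      then show "?e k x \<le> (2 * B)^p * (norm (H x))^p" by (simp add: power_mult_distrib)
    qed
    have "integrable M (\<lambda>x. (2 * B)^p * (norm (H x))^p)" using H(2) by simp
    from nn_integral_eq_integral[OF this] show "(\<integral>\<^sup>+x. ennreal ((2 * B)^p * (norm (H x))^p) \<partial>M) < \<infinity>"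
      using B_nonneg by simp
    show "AE x in M. (\<lambda>k. ennreal (?e k x)) \<longlonglongrightarrow> 0"
      using U(3)
    proof eventually_elim
      case (elim x)
      have "(\<lambda>k. ennreal (?e k x)) \<longlonglongrightarrow> ennreal ((norm (F' (U x) (H x) - F' (U x) (H x)))^p)"
        by (intro tendsto_intros tendsto_chain elim tendsto_ennrealI)
      then show ?case by (simp only: diff_self norm_zero zero_power[OF p] ennreal_0)
    qed
  qed measurable
  then have e: "(\<lambda>k. \<integral>\<^sup>+x. ennreal (?e k x) \<partial>M) \<longlonglongrightarrow> 0" by simp
  have "?R \<longlonglongrightarrow> ennreal ?c * 0 + ennreal (2^p) * 0" by (intro tendsto_intros h(2) e) auto
  then show "?R \<longlonglongrightarrow> 0" by simp
  have "?d k x \<le> ?c * ?a k x + 2^p * ?e k x" for k x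
  proof -
    have "norm (F' (u k x) (h k x) - F' (U x) (H x))
      = norm (F' (u k x) (h k x - H x) + (F' (u k x) (H x) - F' (U x) (H x)))"
      by (simp add: linear_diff[OF lin])
    also have "\<dots> \<le> B * norm (h k x - H x) + norm (F' (u k x) (H x) - F' (U x) (H x))"
      by (rule order_trans[OF norm_triangle_ineq add_right_mono[OF deriv_bound]])
    finally have "?d k x \<le> (B * norm (h k x - H x) + norm (F' (u k x) (H x) - F' (U x) (H x)))^p"
      by (intro power_mono) auto
    also have "\<dots> \<le> 2^p * ((B * norm (h k x - H x))^p + ?e k x)"
      using B_nonneg by (intro power_sum_le) auto
    finally show ?thesis by (simp add: power_mult_distrib algebra_simps)
  qed
  then have "(\<integral>\<^sup>+x. ennreal (?d k x) \<partial>M) \<le> (\<integral>\<^sup>+x. ennreal ?c * ennreal (?a k x) + ennreal (2^p) * ennreal (?e k x) \<partial>M)" for k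
    using B_nonneg by (intro nn_integral_mono) (simp add: ennreal_leI flip: ennreal_mult ennreal_plus)
  then show "\<forall>\<^sub>F k in sequentially. (\<integral>\<^sup>+x. ennreal (?d k x) \<partial>M) \<le> ?R k"
    by (simp add: nn_integral_add nn_integral_cmult)
qed auto

end

lemma AE_convergent_subsequence:
  fixes u :: "nat \<Rightarrow> 'a \<Rightarrow> 'b::euclidean_space"
  assumes [measurable]: "\<And>k. u k \<in> borel_measurable M" "U \<in> borel_measurable M"
    and lim: "(\<lambda>k. \<integral>\<^sup>+x. ennreal (norm (u k x - U x)) \<partial>M) \<longlonglongrightarrow> 0"
  obtains r :: "nat \<Rightarrow> nat" where "strict_mono r" "AE x in M. (\<lambda>k. u (r k) x) \<longlonglongrightarrow> U x"
proof -
  \<comment> \<open>\<open>tendsto_L1_AE_subseq\<close> wants every member integrable, but the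
    integrals are finite only from some index on, so an initial segment is dropped.\<close>
  have "\<forall>\<^sub>F k in sequentially. (\<integral>\<^sup>+x. ennreal (norm (u k x - U x)) \<partial>M) < 1"
    using order_tendstoD(2)[OF lim, of 1] by simp
  then obtain n where n: "\<And>k. k \<ge> n \<Longrightarrow> (\<integral>\<^sup>+x. ennreal (norm (u k x - U x)) \<partial>M) < 1"
    by (auto simp: eventually_sequentially)
  let ?w = "\<lambda>k x. u (k + n) x - U x"
  have fin: "(\<integral>\<^sup>+x. ennreal (norm (?w k x)) \<partial>M) < 1" for k using n[of "k + n"] by simp
  have int: "integrable M (?w k)" for k
    using less_trans[OF fin ennreal_one_less_top] by (simp add: integrable_iff_bounded)
  have "(\<lambda>k. ennreal (integral\<^sup>L M (\<lambda>x. norm (?w k x)))) \<longlonglongrightarrow> ennreal 0"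
    using LIMSEQ_ignore_initial_segment[OF lim, of n] int by (simp add: nn_integral_eq_integral)
  then have "(\<lambda>k. integral\<^sup>L M (\<lambda>x. norm (?w k x))) \<longlonglongrightarrow> 0"
    by (subst (asm) tendsto_ennreal_iff) auto
  from tendsto_L1_AE_subseq[of M ?w, OF int this]
  obtain r where r: "strict_mono r" "AE x in M. (\<lambda>k. ?w (r k) x) \<longlonglongrightarrow> 0" by blast
  show ?thesis
  proof (rule that[of "\<lambda>k. r k + n"])
    show "strict_mono (\<lambda>k. r k + n)" using r(1) by (simp add: strict_mono_def)
    show "AE x in M. (\<lambda>k. u (r k + n) x) \<longlonglongrightarrow> U x"
      using r(2) by (auto elim!: eventually_mono simp: LIM_zero_iff)
  qed
qed

lemma bounded_scaleR_L1_limit: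
  fixes f :: "nat \<Rightarrow> 'a \<Rightarrow> 'b::euclidean_space"
  assumes b: "\<And>x. \<bar>b x\<bar> \<le> C" and [measurable]: "\<And>k. f k \<in> borel_measurable M" "g \<in> borel_measurable M" "b \<in> borel_measurable M"
    and lim: "(\<lambda>k. \<integral>\<^sup>+x. ennreal (norm (f k x - g x)) \<partial>M) \<longlonglongrightarrow> 0"
    and int: "\<And>k. integrable M (\<lambda>x. b x *\<^sub>R f k x)" "integrable M (\<lambda>x. b x *\<^sub>R g x)"
  shows "(\<lambda>k. integral\<^sup>L M (\<lambda>x. b x *\<^sub>R f k x)) \<longlonglongrightarrow> integral\<^sup>L M (\<lambda>x. b x *\<^sub>R g x)"
proof (rule tendsto_L1_int[OF int])
  have C: "C \<ge> 0" using b[of undefined] by linarith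
  show "(\<lambda>k. \<integral>\<^sup>+x. ennreal (norm (b x *\<^sub>R f k x - b x *\<^sub>R g x)) \<partial>M) \<longlonglongrightarrow> 0"
  proof (rule tendsto_sandwich[OF _ _ tendsto_const])
    have "(\<lambda>k. ennreal C * (\<integral>\<^sup>+x. ennreal (norm (f k x - g x)) \<partial>M)) \<longlonglongrightarrow> ennreal C * 0"
      by (intro tendsto_intros lim) auto
    then show "(\<lambda>k. ennreal C * (\<integral>\<^sup>+x. ennreal (norm (f k x - g x)) \<partial>M)) \<longlonglongrightarrow> 0" by simp
    show "\<forall>\<^sub>F k in sequentially. (\<integral>\<^sup>+x. ennreal (norm (b x *\<^sub>R f k x - b x *\<^sub>R g x)) \<partial>M)
       \<le> ennreal C * (\<integral>\<^sup>+x. ennreal (norm (f k x - g x)) \<partial>M)"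
    proof (intro always_eventually allI)
      fix k
      have "(\<integral>\<^sup>+x. ennreal (norm (b x *\<^sub>R f k x - b x *\<^sub>R g x)) \<partial>M)
        \<le> (\<integral>\<^sup>+x. ennreal C * ennreal (norm (f k x - g x)) \<partial>M)"
        using b C by (intro nn_integral_mono)
          (auto simp: ennreal_leI mult_right_mono simp flip: scaleR_diff_right ennreal_mult)
      also have "\<dots> = ennreal C * (\<integral>\<^sup>+x. ennreal (norm (f k x - g x)) \<partial>M)" by (rule nn_integral_cmult) measurable
      finally show "(\<integral>\<^sup>+x. ennreal (norm (b x *\<^sub>R f k x - b x *\<^sub>R g x)) \<partial>M) \<le> \<dots>" .
    qed
  qed auto
qed

context bounded_C1
begin

text \<open>For mollifications of \<open>u\<close> the classical chain rule and integration by parts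
  apply, and near the support of the test function their gradients are mollifications of
  \<open>G\<close>. In the limit the left side needs only that \<open>F\<close> is Lipschitz, the
  right side uses \<open>F'_power_limit\<close>.\<close>

lemma weak_gradient_chain:
  fixes u :: "real^'n::finite \<Rightarrow> 'b"
  assumes \<Omega>: "open \<Omega>" and w: "weak_gradient \<Omega> u G"
    and u: "integrable (lebesgue_on \<Omega>) u" and G: "\<And>i. integrable (lebesgue_on \<Omega>) (\<lambda>x. G x $ i)"
    and Fu: "integrable (lebesgue_on \<Omega>) (\<lambda>x. F (u x))"
  shows "weak_gradient \<Omega> (\<lambda>x. F (u x)) (\<lambda>x. \<chi> i. F' (u x) (G x $ i))"
proof (rule weak_gradientI[OF \<Omega> Fu])
  have \<Omega>L: "\<Omega> \<in> sets lebesgue" using \<Omega> by simp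
  show "integrable (lebesgue_on \<Omega>) (\<lambda>x. (\<chi> i. F' (u x) (G x $ i)) $ i)" for i
    using F'_integrable[OF borel_measurable_integrable[OF u] G] by simp
  fix i and \<phi> :: "real^'n \<Rightarrow> real" assume \<phi>: "test_fun \<Omega> \<phi>"
  obtain K where K: "compact K" "K \<subseteq> \<Omega>" "\<And>x. x \<notin> K \<Longrightarrow> \<phi> x = 0" "\<And>x i. x \<notin> K \<Longrightarrow> partial_deriv i \<phi> x = 0"
    by (rule test_funE[OF \<phi>]) (rule that)
  have KL: "K \<in> sets lebesgue" using K by (simp add: compact_imp_closed)
  have sm: "smooth_fun \<phi>" using \<phi> by (simp add: test_fun_def)
  have c\<phi>: "continuous_on UNIV \<phi>" "continuous_on UNIV (partial_deriv i \<phi>)"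
    by (intro smooth_fun_continuous smooth_fun_partial sm)+
  have \<phi>m [measurable]: "\<phi> \<in> borel_measurable lebesgue" "partial_deriv i \<phi> \<in> borel_measurable lebesgue"
    using c\<phi>[THEN borel_measurable_continuous_onI] by (auto intro!: measurable_completion)
  obtain d where d: "\<And>x. x \<in> K \<Longrightarrow> norm x \<le> d" using compact_imp_bounded[OF K(1)] by (auto simp: bounded_iff)
  have out: "x \<notin> K" if "d + 1 \<le> norm x" for x using d[of x] that by fastforce
  obtain b1 where b1: "\<And>x. norm (\<phi> x) \<le> b1"
    using compact_support_bounded[where d = "d + 1", OF c\<phi>(1) K(3)[OF out]] by metis
  obtain b2 where b2: "\<And>x. norm (partial_deriv i \<phi> x) \<le> b2"
    using compact_support_bounded[where d = "d + 1", OF c\<phi>(2) K(4)[OF out]] by metis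
  define U where "U = zero_ext \<Omega> u"
  define H where "H = zero_ext \<Omega> (\<lambda>x. G x $ i)"
  have Ui: "integrable lebesgue U" and Hi: "integrable lebesgue H"
    using u G[of i] \<Omega>L by (simp_all add: U_def H_def lebesgue_on_zero_ext)
  note Um [measurable] = borel_measurable_integrable[OF Ui]
  note Hm [measurable] = borel_measurable_integrable[OF Hi]
  define m where "m k = mollify (mollifier k) U" for k
  define n where "n k = mollify (mollifier k) H" for k
  have msm: "smooth_fun (m k)" "smooth_fun (n k)" for k
    unfolding m_def n_def using mollify_mollifier(1) Ui Hi by blast+
  have mc: "continuous_on UNIV (m k)" "continuous_on UNIV (n k)" for k
    by (intro smooth_fun_continuous msm)+
  have mm [measurable]: "m k \<in> borel_measurable lebesgue" "n k \<in> borel_measurable lebesgue" for k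
    using mc[THEN borel_measurable_continuous_onI] by (auto intro!: measurable_completion)
  have mlim: "(\<lambda>k. \<integral>\<^sup>+x. ennreal (norm (m k x - U x)) \<partial>lebesgue) \<longlonglongrightarrow> 0"
    unfolding m_def by (rule mollify_tendsto(1)[OF mollifier(2) Ui mollify_mollifier(2)[OF Ui]])
  have nlim: "(\<lambda>k. \<integral>\<^sup>+x. ennreal (norm (n k x - H x)) \<partial>lebesgue) \<longlonglongrightarrow> 0"
    unfolding n_def by (rule mollify_tendsto(1)[OF mollifier(2) Hi mollify_mollifier(2)[OF Hi]])
  \<comment> \<open>\<open>F'\<close> is merely continuous, so its argument has to converge
    pointwise; this costs a subsequence.\<close>
  obtain r where r: "strict_mono r" "AE x in lebesgue. (\<lambda>k. m (r k) x) \<longlonglongrightarrow> U x"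
    by (rule AE_convergent_subsequence[OF mm(1) Um mlim]) (rule that)
  obtain \<epsilon> where e: "\<epsilon> > 0" "(\<Union>x\<in>K. cball x \<epsilon>) \<subseteq> \<Omega>"
    using compact_subset_open_imp_cball_epsilon_subset[OF K(1) \<Omega> K(2)] by metis
  have partial_m: "partial_deriv i (m k) x = n k x" if "x \<in> K" "1 / real (Suc k) \<le> \<epsilon>" for k x
  proof -
    have k: "kernel (mollifier k :: real^'n \<Rightarrow> real) \<epsilon>"
      using mollifier(2)[of k] that(2) unfolding kernel_def by (meson order_trans)
    show ?thesis unfolding m_def n_def U_def H_def
      by (rule mollify_weak_partial[OF \<Omega> w u mollifier(1) k]) (use that(1) e in auto)
  qed
  have parts: "integral\<^sup>L lebesgue (\<lambda>x. partial_deriv i \<phi> x *\<^sub>R F (m k x)) = - integral\<^sup>L lebesgue (\<lambda>x. \<phi> x *\<^sub>R F' (m k x) (n k x))"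
    if k: "1 / real (Suc k) \<le> \<epsilon>" for k
  proof -
    have cp: "continuous_on UNIV (partial_deriv i (m k))"
      by (intro smooth_fun_continuous smooth_fun_partial msm)
    have "integral\<^sup>L lebesgue (\<lambda>x. (\<Sum>j\<in>UNIV. axis i 1 $ j *\<^sub>R partial_deriv j \<phi> x) *\<^sub>R F (m k x))
      = - integral\<^sup>L lebesgue (\<lambda>x. \<phi> x *\<^sub>R F' (m k x) (\<Sum>j\<in>UNIV. axis i 1 $ j *\<^sub>R partial_deriv j (m k) x))"
    proof (rule integration_by_parts[where d = "d + 1"])
      show "(\<phi> has_derivative (\<lambda>h. \<Sum>j\<in>UNIV. h $ j *\<^sub>R partial_deriv j \<phi> x)) (at x)"
        and "((\<lambda>x. F (m k x)) has_derivative (\<lambda>h. F' (m k x) (\<Sum>j\<in>UNIV. h $ j *\<^sub>R partial_deriv j (m k) x))) (at x)" for x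
        by (intro has_derivative_partials smooth_fun_differentiable sm has_derivative_compose[OF _ deriv] msm)+
    qed (use c\<phi> continuous_chain[OF mc(1) cp] K(3,4)[OF out] in \<open>auto simp: sum_axis simp del: real_scaleR_def\<close>)
    \<comment> \<open>The gradient of \<open>m k\<close> is known to be \<open>n k\<close> only on
      \<open>K\<close>, which suffices because \<open>\<phi>\<close> vanishes elsewhere.\<close>
    moreover have "\<phi> x *\<^sub>R F' (m k x) (partial_deriv i (m k) x) = \<phi> x *\<^sub>R F' (m k x) (n k x)" for x
      using partial_m[OF _ k, of x] K(3)[of x] by (cases "x \<in> K") auto
    ultimately show ?thesis by (simp only: sum_axis)
  qed
  have contK: "integrable lebesgue (\<lambda>x. g x *\<^sub>R f x)"
    if "continuous_on UNIV g" "\<And>x. x \<notin> K \<Longrightarrow> g x = 0" "continuous_on UNIV f" for g and f :: "real^'n \<Rightarrow> 'c"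
  proof -
    have c: "continuous_on UNIV (\<lambda>x. g x *\<^sub>R f x)" by (intro continuous_intros that)
    have "integrable lborel (\<lambda>x. g x *\<^sub>R f x)"
      by (rule continuous_compact_support_integrable[OF c, of "d + 1"]) (use that(2)[OF out] in simp)
    then show ?thesis using borel_measurable_continuous_onI[OF c] by (simp add: integrable_completion)
  qed
  have onK: "integrable (lebesgue_on K) f" if "integrable lebesgue f" for f :: "real^'n \<Rightarrow> 'b"
    using KL integrable_mult_indicator[OF KL that] by (simp add: integrable_restrict_space)
  have limA: "(\<lambda>k. integral\<^sup>L lebesgue (\<lambda>x. partial_deriv i \<phi> x *\<^sub>R F (m k x))) \<longlonglongrightarrow>
      integral\<^sup>L lebesgue (\<lambda>x. partial_deriv i \<phi> x *\<^sub>R F (U x))"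
  proof (rule bounded_scaleR_L1_limit)
    show "\<bar>partial_deriv i \<phi> x\<bar> \<le> b2" for x using b2[of x] by simp
    show "(\<lambda>k. \<integral>\<^sup>+x. ennreal (norm (F (m k x) - F (U x))) \<partial>lebesgue) \<longlonglongrightarrow> 0"
    proof (rule tendsto_sandwich[OF _ _ tendsto_const])
      have "(\<lambda>k. ennreal B * (\<integral>\<^sup>+x. ennreal (norm (m k x - U x)) \<partial>lebesgue)) \<longlonglongrightarrow> ennreal B * 0"
        by (intro tendsto_intros mlim) auto
      then show "(\<lambda>k. ennreal B * (\<integral>\<^sup>+x. ennreal (norm (m k x - U x)) \<partial>lebesgue)) \<longlonglongrightarrow> 0" by simp
      have "(\<integral>\<^sup>+x. ennreal (norm (F (m k x) - F (U x))) \<partial>lebesgue) \<le> (\<integral>\<^sup>+x. ennreal B * ennreal (norm (m k x - U x)) \<partial>lebesgue)" for k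
        using lipschitz B_nonneg by (intro nn_integral_mono) (auto simp: ennreal_leI simp flip: ennreal_mult)
      then show "\<forall>\<^sub>F k in sequentially. (\<integral>\<^sup>+x. ennreal (norm (F (m k x) - F (U x))) \<partial>lebesgue)
          \<le> ennreal B * (\<integral>\<^sup>+x. ennreal (norm (m k x - U x)) \<partial>lebesgue)"
        by (auto simp: nn_integral_cmult intro!: always_eventually)
    qed auto
    show "integrable lebesgue (\<lambda>x. partial_deriv i \<phi> x *\<^sub>R F (m k x))" for k
      by (intro contK c\<phi> K(4) continuous_on_compose2[OF F_cont] mc subset_UNIV)
    show "integrable lebesgue (\<lambda>x. partial_deriv i \<phi> x *\<^sub>R F (U x))"
      by (rule compact_support_scaleR_integrable(1)[OF c\<phi>(2) K(4) K(1) F_integrable[OF onK[OF Ui] K(1)]])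
  qed measurable
  have limB: "(\<lambda>k. integral\<^sup>L lebesgue (\<lambda>x. \<phi> x *\<^sub>R F' (m (r k) x) (n (r k) x))) \<longlonglongrightarrow>
      integral\<^sup>L lebesgue (\<lambda>x. \<phi> x *\<^sub>R F' (U x) (H x))"
  proof (rule bounded_scaleR_L1_limit)
    show "\<bar>\<phi> x\<bar> \<le> b1" for x using b1[of x] by simp
    show "(\<lambda>k. \<integral>\<^sup>+x. ennreal (norm (F' (m (r k) x) (n (r k) x) - F' (U x) (H x))) \<partial>lebesgue) \<longlonglongrightarrow> 0"
      by (rule F'_power_limit[where p = 1, simplified, OF mm(1) Um r(2) Hm _ mm(2)])
         (use Hi LIMSEQ_subseq_LIMSEQ[OF nlim r(1)] in \<open>simp_all add: comp_def\<close>)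
    show "integrable lebesgue (\<lambda>x. \<phi> x *\<^sub>R F' (m (r k) x) (n (r k) x))" for k
      by (intro contK c\<phi> K(3) continuous_chain mc)
    have FUH: "integrable lebesgue (\<lambda>x. F' (U x) (H x))" by (rule F'_integrable[OF _ Hi]) measurable
    then have "integrable (lebesgue_on K) (\<lambda>x. F' (U x) (H x))"
      using KL integrable_mult_indicator[OF KL FUH] by (simp add: integrable_restrict_space)
    from compact_support_scaleR_integrable(1)[OF c\<phi>(1) K(3) K(1) this]
    show "integrable lebesgue (\<lambda>x. \<phi> x *\<^sub>R F' (U x) (H x))" .
  qed measurable
  have "\<forall>\<^sub>F k in sequentially. integral\<^sup>L lebesgue (\<lambda>x. partial_deriv i \<phi> x *\<^sub>R F (m (r k) x))
      = - integral\<^sup>L lebesgue (\<lambda>x. \<phi> x *\<^sub>R F' (m (r k) x) (n (r k) x))"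
    using eventually_subseq[OF r(1) eventually_mollifier_radius[OF e(1)]]
    by eventually_elim (rule parts)
  from Lim_transform_eventually[OF LIMSEQ_subseq_LIMSEQ[OF limA r(1), unfolded comp_def] this]
  have "integral\<^sup>L lebesgue (\<lambda>x. partial_deriv i \<phi> x *\<^sub>R F (U x)) = - integral\<^sup>L lebesgue (\<lambda>x. \<phi> x *\<^sub>R F' (U x) (H x))"
    using tendsto_minus[OF limB] LIMSEQ_unique by blast
  moreover have "partial_deriv i \<phi> x *\<^sub>R F (U x) = partial_deriv i \<phi> x *\<^sub>R F (u x)" for x
    using K(2,4) by (cases "x \<in> K") (auto simp: U_def zero_ext_def)
  moreover have "\<phi> x *\<^sub>R F' (U x) (H x) = \<phi> x *\<^sub>R (\<chi> i. F' (u x) (G x $ i)) $ i" for x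
    using K(2,3) by (cases "x \<in> K") (auto simp: U_def H_def zero_ext_def)
  ultimately show "integral\<^sup>L lebesgue (\<lambda>x. partial_deriv i \<phi> x *\<^sub>R F (u x))
      = - integral\<^sup>L lebesgue (\<lambda>x. \<phi> x *\<^sub>R (\<chi> i. F' (u x) (G x $ i)) $ i)"
    by simp
qed

end

subsection \<open>Functions vanishing on the boundary\<close>

text \<open>A short mollification of a compactly supported function is still supported in
  \<open>\<Omega>\<close>, hence a test function, and it converges in \<open>L2\<close> together
  with its gradient.\<close>

lemma compact_support_approx:
  fixes f :: "real^'n::finite \<Rightarrow> 'b::euclidean_space"
  assumes \<Omega>: "open \<Omega>" and w: "weak_gradient \<Omega> f G"
    and f: "integrable (lebesgue_on \<Omega>) f" "integrable (lebesgue_on \<Omega>) (\<lambda>x. (norm (f x))\<^sup>2)"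
    and G: "\<And>i. integrable (lebesgue_on \<Omega>) (\<lambda>x. G x $ i)" "\<And>i. integrable (lebesgue_on \<Omega>) (\<lambda>x. (norm (G x $ i))\<^sup>2)"
    and K: "compact K" "K \<subseteq> \<Omega>" and f0: "\<And>x. x \<notin> K \<Longrightarrow> f x = 0" and G0: "\<And>x i. x \<notin> K \<Longrightarrow> G x $ i = 0"
    and pos: "e > 0"
  shows "\<exists>\<psi>. test_fun \<Omega> \<psi> \<and> (\<integral>\<^sup>+x. ennreal ((norm (\<psi> x - f x))\<^sup>2
    + (\<Sum>i\<in>UNIV. (norm (partial_deriv i \<psi> x - G x $ i))\<^sup>2)) \<partial>lebesgue_on \<Omega>) \<le> ennreal e"
proof -
  have \<Omega>L [measurable]: "\<Omega> \<in> sets lebesgue" using \<Omega> by simp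
  define U where "U = zero_ext \<Omega> f"
  define H where "H i = zero_ext \<Omega> (\<lambda>x. G x $ i)" for i
  have Ui: "integrable lebesgue U" and Hi: "integrable lebesgue (H i)" for i
    using f(1) G(1)[of i] \<Omega>L by (simp_all add: U_def H_def lebesgue_on_zero_ext)
  have sqe: "zero_ext \<Omega> (\<lambda>x. (norm (g x))\<^sup>2) = (\<lambda>x. (norm (zero_ext \<Omega> g x))\<^sup>2)" for g :: "real^'n \<Rightarrow> 'b"
    by (auto simp: fun_eq_iff zero_ext_def indicator_def)
  have U2: "integrable lebesgue (\<lambda>x. (norm (U x))\<^sup>2)" and H2: "integrable lebesgue (\<lambda>x. (norm (H i x))\<^sup>2)" for i
    using f(2) G(2)[of i] \<Omega>L unfolding U_def H_def by (simp_all only: lebesgue_on_zero_ext sqe)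
  note [measurable] = borel_measurable_integrable[OF Ui] borel_measurable_integrable[OF Hi]
  have U0: "U x = 0" and H0: "H i x = 0" if "x \<notin> K" for x i
    using that f0[of x] G0[of x i] by (auto simp: U_def H_def zero_ext_def)
  define m where "m k = mollify (mollifier k) U" for k
  define n where "n k i = mollify (mollifier k) (H i)" for k i
  have msm: "smooth_fun (m k)" "smooth_fun (n k i)" for k i
    unfolding m_def n_def using mollify_mollifier(1) Ui Hi by blast+
  have mm [measurable]: "m k \<in> borel_measurable lebesgue" "n k i \<in> borel_measurable lebesgue" for k i
    using msm[THEN smooth_fun_continuous, THEN borel_measurable_continuous_onI] by (auto intro!: measurable_completion)
  have mlim: "(\<lambda>k. \<integral>\<^sup>+x. ennreal ((norm (m k x - U x))\<^sup>2) \<partial>lebesgue) \<longlonglongrightarrow> 0"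
    unfolding m_def by (rule mollify_tendsto(2)[OF mollifier(2) Ui mollify_mollifier(2)[OF Ui] U2])
  have nlim: "(\<lambda>k. \<integral>\<^sup>+x. ennreal ((norm (n k i x - H i x))\<^sup>2) \<partial>lebesgue) \<longlonglongrightarrow> 0" for i
    unfolding n_def by (rule mollify_tendsto(2)[OF mollifier(2) Hi mollify_mollifier(2)[OF Hi] H2])
  obtain \<epsilon> where e: "\<epsilon> > 0" "(\<Union>x\<in>K. cball x \<epsilon>) \<subseteq> \<Omega>"
    using compact_subset_open_imp_cball_epsilon_subset[OF K(1) \<Omega> K(2)] by metis
  \<comment> \<open>Half the radius is kept in reserve: mollifications of radius at most
    \<open>\<epsilon> / 2\<close> are supported in \<open>L\<close>, while balls of radius
    \<open>\<epsilon> / 2\<close> around points of \<open>L\<close> still lie in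
    \<open>\<Omega>\<close>.\<close>
  define L where "L = (\<Union>x\<in>K. cball x (\<epsilon> / 2))"
  have L: "compact L" unfolding L_def by (rule compact_minkowski_sum_cball[OF K(1)])
  have "cball x (\<epsilon> / 2) \<subseteq> cball x \<epsilon>" for x :: "real^'n" using e(1) by auto
  then have L\<Omega>: "L \<subseteq> \<Omega>" using e(2) unfolding L_def by blast
  have Lball: "cball x (\<epsilon> / 2) \<subseteq> \<Omega>" if x: "x \<in> L" for x
  proof
    fix y assume y: "y \<in> cball x (\<epsilon> / 2)"
    from x obtain z where z: "z \<in> K" "dist z x \<le> \<epsilon> / 2" by (auto simp: L_def)
    have "y \<in> cball z \<epsilon>" using dist_triangle[of z y x] y z by simp
    then show "y \<in> \<Omega>" using z(1) e(2) by blast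
  qed
  have tests: "test_fun \<Omega> (m k)" and partials: "partial_deriv i (m k) x = n k i x"
    if k: "1 / real (Suc k) \<le> \<epsilon> / 2" for k i x
  proof -
    have ker: "kernel (mollifier k :: real^'n \<Rightarrow> real) (\<epsilon> / 2)"
      using mollifier(2)[of k] k unfolding kernel_def by (meson order_trans)
    have far: "y \<notin> K" if "x \<notin> L" "norm (x - y) \<le> \<epsilon> / 2" for x y
      using that by (auto simp: L_def dist_norm norm_minus_commute)
    have ker0: "mollifier k z = 0" "partial_deriv i (mollifier k) z = 0" if "\<epsilon> / 2 < norm z" for z :: "real^'n" and i
    proof -
      show "mollifier k z = 0" using ker that by (auto simp: kernel_def)
      show "partial_deriv i (mollifier k) z = 0"
        by (rule partial_deriv_zero_outside[OF open_outside_cball[of "\<epsilon> / 2"]]) (use that ker in \<open>auto simp: kernel_def\<close>)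
    qed
    have van: "mollify g h x = 0" if "x \<notin> L" "\<And>z. \<epsilon> / 2 < norm z \<Longrightarrow> g z = 0" "\<And>y. y \<notin> K \<Longrightarrow> h y = 0"
      for g and h :: "real^'n \<Rightarrow> 'b" and x
    proof -
      have "g (x - y) *\<^sub>R h y = 0" for y
        using far[OF that(1), of y] that(2)[of "x - y"] that(3)[of y] by (cases "norm (x - y) \<le> \<epsilon> / 2") auto
      then have "(\<lambda>y. g (x - y) *\<^sub>R h y) = (\<lambda>_. 0)" by (rule ext)
      then show ?thesis unfolding mollify_def by (simp only: Bochner_Integration.integral_zero)
    qed
    show "test_fun \<Omega> (m k)"
      by (rule test_funI[OF msm(1) L L\<Omega>]) (auto simp: m_def intro: van ker0 U0)
    show "partial_deriv i (m k) x = n k i x"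
    \<comment> \<open>On \<open>L\<close> the weak gradient may be tested with the reflected kernel;
      off \<open>L\<close> the kernel does not reach \<open>K\<close>, and both sides are
      \<open>0\<close>.\<close>
    proof (cases "x \<in> L")
      case True
      then show ?thesis unfolding m_def n_def U_def H_def
        by (intro mollify_weak_partial[OF \<Omega> w f(1) mollifier(1) ker] Lball)
    next
      case False
      have "partial_deriv i (m k) x = mollify (partial_deriv i (mollifier k)) U x"
        unfolding m_def by (rule mollify_partial_deriv[where d = "\<epsilon> / 2", OF mollifier(1) ker0(1) Ui])
      also have "\<dots> = 0" by (rule van[OF False ker0(2) U0])
      also have "0 = n k i x" unfolding n_def by (rule van[OF False ker0(1) H0, symmetric])
      finally show ?thesis .
    qed
  qed
  let ?E = "\<lambda>k. (\<integral>\<^sup>+x. ennreal ((norm (m k x - U x))\<^sup>2) \<partial>lebesgue) + (\<Sum>i\<in>UNIV. \<integral>\<^sup>+x. ennreal ((norm (n k i x - H i x))\<^sup>2) \<partial>lebesgue)"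
  have "?E \<longlonglongrightarrow> 0 + (\<Sum>i\<in>(UNIV::'n set). 0)" by (intro tendsto_intros mlim nlim)
  then have "\<forall>\<^sub>F k in sequentially. ?E k < ennreal e" using pos by (intro order_tendstoD(2)) auto
  from eventually_happens[OF eventually_conj[OF this eventually_mollifier_radius[of "\<epsilon> / 2"]]] e(1)
  obtain k where k: "?E k < ennreal e" "1 / real (Suc k) \<le> \<epsilon> / 2" by auto
  have "(\<integral>\<^sup>+x. ennreal ((norm (m k x - f x))\<^sup>2 + (\<Sum>i\<in>UNIV. (norm (partial_deriv i (m k) x - G x $ i))\<^sup>2)) \<partial>lebesgue_on \<Omega>)
    \<le> (\<integral>\<^sup>+x. ennreal ((norm (m k x - U x))\<^sup>2) + (\<Sum>i\<in>UNIV. ennreal ((norm (n k i x - H i x))\<^sup>2)) \<partial>lebesgue)"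
    unfolding partials[OF k(2)] using \<Omega>L
    by (subst nn_integral_restrict_space)
       (auto intro!: nn_integral_mono simp: indicator_def U_def H_def zero_ext_def sum_nonneg sum_ennreal simp flip: ennreal_plus)
  also have "\<dots> = ?E k" by (subst nn_integral_add) (auto simp: nn_integral_sum simp del: sum_ennreal)
  finally show ?thesis using tests[OF k(2)] k(1) by (intro exI[of _ "m k"]) auto
qed

section \<open>Square-integrable functions and gradients on bounded open sets\<close>

lemma bounded_open_finite_measure:
  fixes \<Omega> :: "'a::euclidean_space set"
  assumes "open \<Omega>" "bounded \<Omega>"
  shows "finite_measure (lebesgue_on \<Omega>)"
  using assms by (intro finite_measure_lebesgue_on lmeasurable_open) auto

lemma finite_measure_square_integrable:
  fixes f :: "'a \<Rightarrow> 'b::euclidean_space"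
  assumes "finite_measure M" "f \<in> borel_measurable M" "integrable M (\<lambda>x. (norm (f x))\<^sup>2)"
  shows "integrable M f"
proof (rule Bochner_Integration.integrable_bound[OF _ assms(2)])
  interpret finite_measure M by fact
  show "integrable M (\<lambda>x. 1 + (norm (f x))\<^sup>2)" using assms(3) by simp
  have "t \<le> 1 + t\<^sup>2" for t :: real
    using zero_le_power2[of "t - 1/2"] by (simp add: power2_eq_square algebra_simps)
  then show "AE x in M. norm (f x) \<le> norm (1 + (norm (f x))\<^sup>2)" by simp
qed

lemma norm_vec_squared: "(norm (x :: 'b::real_normed_vector^'n::finite))\<^sup>2 = (\<Sum>i\<in>UNIV. (norm (x $ i))\<^sup>2)"
  by (simp add: norm_vec_def L2_set_def real_sqrt_pow2 sum_nonneg)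

lemma borel_measurable_vec_iff:
  fixes G :: "'a \<Rightarrow> 'b::euclidean_space^'n::finite"
  shows "G \<in> borel_measurable M \<longleftrightarrow> (\<forall>i. (\<lambda>x. G x $ i) \<in> borel_measurable M)"
proof
  assume G: "G \<in> borel_measurable M"
  have "continuous_on UNIV (\<lambda>x::'b^'n. x $ i)" for i by (intro continuous_intros)
  then show "\<forall>i. (\<lambda>x. G x $ i) \<in> borel_measurable M"
    using measurable_compose[OF G borel_measurable_continuous_onI] by blast
next
  assume G: "\<forall>i. (\<lambda>x. G x $ i) \<in> borel_measurable M"
  show "G \<in> borel_measurable M"
  proof (subst borel_measurable_euclidean_space, intro ballI)
    fix b :: "'b^'n" assume "b \<in> Basis"
    then obtain i c where "b = axis i c" by (auto simp: Basis_vec_def)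
    moreover have [measurable]: "(\<lambda>x. G x $ i) \<in> borel_measurable M" using G by blast
    ultimately show "(\<lambda>x. G x \<bullet> b) \<in> borel_measurable M" by (simp only: inner_axis) measurable
  qed
qed

text \<open>Keeps a concrete gradient with the function, with integrability recorded per component,
  so that chain and pairing rules can compute with it.\<close>

definition sobolev_pair :: "(real^'n::finite) set \<Rightarrow> (real^'n \<Rightarrow> 'b::euclidean_space) \<Rightarrow> (real^'n \<Rightarrow> 'b^'n) \<Rightarrow> bool" where
  "sobolev_pair \<Omega> u G \<longleftrightarrow> weak_gradient \<Omega> u G \<and>
     integrable (lebesgue_on \<Omega>) u \<and> integrable (lebesgue_on \<Omega>) (\<lambda>x. (norm (u x))\<^sup>2) \<and>
     (\<forall>i. integrable (lebesgue_on \<Omega>) (\<lambda>x. G x $ i) \<and> integrable (lebesgue_on \<Omega>) (\<lambda>x. (norm (G x $ i))\<^sup>2))"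

lemma sobolev_W12_iff_pair:
  fixes u :: "real^'n::finite \<Rightarrow> 'b::euclidean_space"
  assumes "open \<Omega>" "bounded \<Omega>"
  shows "sobolev_W12 \<Omega> u \<longleftrightarrow> (\<exists>G. sobolev_pair \<Omega> u G)"
proof
  note fin = bounded_open_finite_measure[OF assms]
  assume "sobolev_W12 \<Omega> u"
  then obtain G where G: "weak_gradient \<Omega> u G" "G \<in> borel_measurable (lebesgue_on \<Omega>)"
     "integrable (lebesgue_on \<Omega>) (\<lambda>x. (norm (G x))\<^sup>2)"
    and u: "u \<in> borel_measurable (lebesgue_on \<Omega>)" "integrable (lebesgue_on \<Omega>) (\<lambda>x. (norm (u x))\<^sup>2)"
    by (auto simp: sobolev_W12_def)
  have Gm [measurable]: "(\<lambda>x. G x $ i) \<in> borel_measurable (lebesgue_on \<Omega>)" for i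
    using G(2) by (simp add: borel_measurable_vec_iff)
  have "integrable (lebesgue_on \<Omega>) (\<lambda>x. (norm (G x $ i))\<^sup>2)" for i
  proof (rule Bochner_Integration.integrable_bound[OF G(3)])
    show "AE x in lebesgue_on \<Omega>. norm ((norm (G x $ i))\<^sup>2) \<le> norm ((norm (G x))\<^sup>2)"
      by (auto intro!: power_mono simp: Finite_Cartesian_Product.norm_nth_le)
  qed measurable
  then have "sobolev_pair \<Omega> u G"
    unfolding sobolev_pair_def using G(1) u finite_measure_square_integrable[OF fin] Gm by (intro conjI allI) blast+
  then show "\<exists>G. sobolev_pair \<Omega> u G" by blast
next
  assume "\<exists>G. sobolev_pair \<Omega> u G"
  then obtain G where G: "sobolev_pair \<Omega> u G" by blast
  then have "G \<in> borel_measurable (lebesgue_on \<Omega>)"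
    unfolding sobolev_pair_def borel_measurable_vec_iff using borel_measurable_integrable by blast
  then show "sobolev_W12 \<Omega> u"
    using G by (auto simp: sobolev_pair_def sobolev_W12_def norm_vec_squared intro!: exI[of _ G])
qed

text \<open>The compactly supported \<open>\<Phi> k\<close> need not be smooth. Each is replaced by
  a test function within squared distance \<open>1 / real (Suc k)\<close> of it, and
  \<open>sq\<close> combines the two errors.\<close>

lemma sobolev_W12_0I:
  fixes \<phi> :: "real^'n::finite \<Rightarrow> 'b::euclidean_space"
  assumes \<Omega>: "open \<Omega>" "bounded \<Omega>" and \<phi>: "sobolev_pair \<Omega> \<phi> G"
    and \<Phi>: "\<And>k. sobolev_pair \<Omega> (\<Phi> k) (H k)"
    and K: "\<And>k. compact (K k)" "\<And>k. K k \<subseteq> \<Omega>" "\<And>k x. x \<notin> K k \<Longrightarrow> \<Phi> k x = 0" "\<And>k x i. x \<notin> K k \<Longrightarrow> H k x $ i = 0"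
    and lim: "(\<lambda>k. \<integral>\<^sup>+x. ennreal ((norm (\<Phi> k x - \<phi> x))\<^sup>2) \<partial>lebesgue_on \<Omega>) \<longlonglongrightarrow> 0"
      "\<And>i. (\<lambda>k. \<integral>\<^sup>+x. ennreal ((norm (H k x $ i - G x $ i))\<^sup>2) \<partial>lebesgue_on \<Omega>) \<longlonglongrightarrow> 0"
  shows "sobolev_W12_0 \<Omega> \<phi>"
proof -
  let ?d = "\<lambda>f F g (G::real^'n \<Rightarrow> 'b^'n) x. (norm (f x - g x))\<^sup>2 + (\<Sum>i\<in>UNIV. (norm (F i x - G x $ i))\<^sup>2)"
  let ?good = "\<lambda>k \<psi>. test_fun \<Omega> \<psi> \<and> (\<integral>\<^sup>+x. ennreal (?d \<psi> (\<lambda>i. partial_deriv i \<psi>) (\<Phi> k) (H k) x) \<partial>lebesgue_on \<Omega>) \<le> ennreal (1 / real (Suc k))"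
  have "\<exists>\<psi>. ?good k \<psi>" for k
    using \<Phi>[of k] by (intro compact_support_approx[OF \<Omega>(1) _ _ _ _ _ K(1)[of k] K(2) K(3) K(4)]) (auto simp: sobolev_pair_def)
  then have "\<exists>\<psi>. \<forall>k. ?good k (\<psi> k)" by (intro choice allI)
  then obtain \<psi> where \<psi>': "\<And>k. ?good k (\<psi> k)" by blast
  note \<psi> = conjunct1[OF \<psi>'] conjunct2[OF \<psi>']
  have m [measurable]: "\<phi> \<in> borel_measurable (lebesgue_on \<Omega>)" "(\<lambda>x. G x $ i) \<in> borel_measurable (lebesgue_on \<Omega>)"
     "\<Phi> k \<in> borel_measurable (lebesgue_on \<Omega>)" "(\<lambda>x. H k x $ i) \<in> borel_measurable (lebesgue_on \<Omega>)" for k i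
    using \<phi> \<Phi>[of k] borel_measurable_integrable by (auto simp: sobolev_pair_def)
  have [measurable]: "f \<in> borel_measurable (lebesgue_on \<Omega>)" if "smooth_fun f" for f :: "real^'n \<Rightarrow> 'b"
    using borel_measurable_continuous_onI[OF smooth_fun_continuous[OF that]]
    by (intro measurable_restrict_space1 measurable_completion) simp
  have [measurable]: "\<psi> k \<in> borel_measurable (lebesgue_on \<Omega>)" "partial_deriv i (\<psi> k) \<in> borel_measurable (lebesgue_on \<Omega>)" for k i
    using \<psi>(1)[of k] smooth_fun_partial[of "\<psi> k" i] by (auto simp: test_fun_def)
  have sq: "(norm (a - c))\<^sup>2 \<le> 2 * (norm (a - b))\<^sup>2 + 2 * (norm (b - c))\<^sup>2" for a b c :: 'b
  proof -
    have "(norm (a - c))\<^sup>2 \<le> (norm (a - b) + norm (b - c))\<^sup>2"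
      by (intro power_mono norm_diff_triangle_le[of a b]) auto
    also have "\<dots> \<le> 2 * (norm (a - b))\<^sup>2 + 2 * (norm (b - c))\<^sup>2"
      using zero_le_power2[of "norm (a - b) - norm (b - c)"] by (simp add: power2_eq_square algebra_simps)
    finally show ?thesis .
  qed
  have combine: "ennreal c \<le> ennreal 2 * ennreal p + ennreal 2 * ennreal q" if "0 \<le> p" "0 \<le> q" "c \<le> 2 * p + 2 * q" for c p q :: real
  proof -
    have "ennreal c \<le> ennreal (2 * p + 2 * q)" by (rule ennreal_leI[OF that(3)])
    also have "\<dots> = ennreal 2 * ennreal p + ennreal 2 * ennreal q"
      using that(1,2) by (simp only: ennreal_plus ennreal_mult mult_nonneg_nonneg zero_le_numeral)
    finally show ?thesis .
  qed
  let ?B = "\<lambda>k. ennreal 2 * ennreal (1 / real (Suc k)) + ennreal 2 * ((\<integral>\<^sup>+x. ennreal ((norm (\<Phi> k x - \<phi> x))\<^sup>2) \<partial>lebesgue_on \<Omega>)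
     + (\<Sum>i\<in>UNIV. \<integral>\<^sup>+x. ennreal ((norm (H k x $ i - G x $ i))\<^sup>2) \<partial>lebesgue_on \<Omega>))"
  have bound: "(\<integral>\<^sup>+x. ennreal (?d (\<psi> k) (\<lambda>i. partial_deriv i (\<psi> k)) \<phi> G x) \<partial>lebesgue_on \<Omega>) \<le> ?B k" for k
  proof -
    have "(\<integral>\<^sup>+x. ennreal (?d (\<psi> k) (\<lambda>i. partial_deriv i (\<psi> k)) \<phi> G x) \<partial>lebesgue_on \<Omega>)
      \<le> (\<integral>\<^sup>+x. ennreal 2 * ennreal (?d (\<psi> k) (\<lambda>i. partial_deriv i (\<psi> k)) (\<Phi> k) (H k) x)
         + ennreal 2 * ennreal (?d (\<Phi> k) (\<lambda>i x. H k x $ i) \<phi> G x) \<partial>lebesgue_on \<Omega>)"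
    proof (rule nn_integral_mono)
      fix x
      have "?d (\<psi> k) (\<lambda>i. partial_deriv i (\<psi> k)) \<phi> G x
        \<le> (2 * (norm (\<psi> k x - \<Phi> k x))\<^sup>2 + 2 * (norm (\<Phi> k x - \<phi> x))\<^sup>2)
          + (\<Sum>i\<in>UNIV. 2 * (norm (partial_deriv i (\<psi> k) x - H k x $ i))\<^sup>2 + 2 * (norm (H k x $ i - G x $ i))\<^sup>2)"
        by (intro add_mono sum_mono sq)
      also have "\<dots> = 2 * ?d (\<psi> k) (\<lambda>i. partial_deriv i (\<psi> k)) (\<Phi> k) (H k) x + 2 * ?d (\<Phi> k) (\<lambda>i x. H k x $ i) \<phi> G x"
        by (simp add: sum.distrib sum_distrib_left)
      finally show "ennreal (?d (\<psi> k) (\<lambda>i. partial_deriv i (\<psi> k)) \<phi> G x)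
        \<le> ennreal 2 * ennreal (?d (\<psi> k) (\<lambda>i. partial_deriv i (\<psi> k)) (\<Phi> k) (H k) x)
         + ennreal 2 * ennreal (?d (\<Phi> k) (\<lambda>i x. H k x $ i) \<phi> G x)"
        by (rule combine[rotated 2]) (auto intro!: add_nonneg_nonneg sum_nonneg)
    qed
    also have "\<dots> = ennreal 2 * (\<integral>\<^sup>+x. ennreal (?d (\<psi> k) (\<lambda>i. partial_deriv i (\<psi> k)) (\<Phi> k) (H k) x) \<partial>lebesgue_on \<Omega>)
        + ennreal 2 * (\<integral>\<^sup>+x. ennreal (?d (\<Phi> k) (\<lambda>i x. H k x $ i) \<phi> G x) \<partial>lebesgue_on \<Omega>)"
      by (subst nn_integral_add) (auto simp: nn_integral_cmult simp del: ennreal_numeral)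
    also have "(\<integral>\<^sup>+x. ennreal (?d (\<Phi> k) (\<lambda>i x. H k x $ i) \<phi> G x) \<partial>lebesgue_on \<Omega>)
       = (\<integral>\<^sup>+x. ennreal ((norm (\<Phi> k x - \<phi> x))\<^sup>2) \<partial>lebesgue_on \<Omega>)
     + (\<Sum>i\<in>UNIV. \<integral>\<^sup>+x. ennreal ((norm (H k x $ i - G x $ i))\<^sup>2) \<partial>lebesgue_on \<Omega>)"
      by (subst nn_integral_sum[symmetric], measurable, subst nn_integral_add[symmetric], measurable)
         (auto intro!: nn_integral_cong simp: sum_ennreal sum_nonneg)
    finally show ?thesis using \<psi>(2)[of k] by (auto elim!: order_trans intro!: add_mono mult_left_mono)
  qed
  have "?B \<longlonglongrightarrow> ennreal 2 * ennreal 0 + ennreal 2 * (0 + (\<Sum>i\<in>(UNIV::'n set). 0))"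
    by (intro tendsto_intros lim tendsto_ennrealI LIMSEQ_Suc[OF lim_1_over_n]) auto
  then have B: "?B \<longlonglongrightarrow> 0" by simp
  have "(\<lambda>k. \<integral>\<^sup>+x. ennreal (?d (\<psi> k) (\<lambda>i. partial_deriv i (\<psi> k)) \<phi> G x) \<partial>lebesgue_on \<Omega>) \<longlonglongrightarrow> 0"
    by (rule tendsto_sandwich[OF _ _ tendsto_const B]) (use bound in auto)
  moreover have "sobolev_W12 \<Omega> \<phi>" using \<phi> sobolev_W12_iff_pair[OF \<Omega>] by blast
  ultimately show ?thesis using \<phi> \<psi>(1) unfolding sobolev_W12_0_def sobolev_pair_def by blast
qed

lemma sum_squared_le: "(s + t)\<^sup>2 \<le> 2 * s\<^sup>2 + 2 * t\<^sup>2" for s t :: real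
  using zero_le_power2[of "s - t"] by (simp add: power2_eq_square algebra_simps)

text \<open>A Lipschitz \<open>F\<close> grows at most linearly, and constants are square-integrable
  because \<open>\<Omega>\<close> has finite measure; so composition stays in the Sobolev
  space.\<close>

lemma (in bounded_C1) sobolev_pair_chain:
  fixes u :: "real^'n::finite \<Rightarrow> 'b"
  assumes \<Omega>: "open \<Omega>" "bounded \<Omega>" and u: "sobolev_pair \<Omega> u G"
  shows "sobolev_pair \<Omega> (\<lambda>x. F (u x)) (\<lambda>x. \<chi> i. F' (u x) (G x $ i))"
proof -
  note fin = bounded_open_finite_measure[OF \<Omega>]
  have w: "weak_gradient \<Omega> u G" and ui: "integrable (lebesgue_on \<Omega>) u" "integrable (lebesgue_on \<Omega>) (\<lambda>x. (norm (u x))\<^sup>2)"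
    and Gi: "\<And>i. integrable (lebesgue_on \<Omega>) (\<lambda>x. G x $ i)" "\<And>i. integrable (lebesgue_on \<Omega>) (\<lambda>x. (norm (G x $ i))\<^sup>2)"
    using u by (auto simp: sobolev_pair_def)
  note [measurable] = borel_measurable_integrable[OF ui(1)] borel_measurable_integrable[OF Gi(1)]
  have F2: "integrable (lebesgue_on \<Omega>) (\<lambda>x. (norm (F (u x)))\<^sup>2)"
  proof (rule Bochner_Integration.integrable_bound)
    show "integrable (lebesgue_on \<Omega>) (\<lambda>x. 2 * (norm (F 0))\<^sup>2 + 2 * B\<^sup>2 * (norm (u x))\<^sup>2)"
      using ui(2) finite_measure.integrable_const[OF fin] by (intro Bochner_Integration.integrable_add) auto
    show "AE x in lebesgue_on \<Omega>. norm ((norm (F (u x)))\<^sup>2) \<le> norm (2 * (norm (F 0))\<^sup>2 + 2 * B\<^sup>2 * (norm (u x))\<^sup>2)"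
    proof (intro AE_I2)
      fix x
      have "norm (F (u x)) \<le> norm (F 0) + norm (F (u x) - F 0)" by (metis add.commute diff_add_cancel norm_triangle_ineq)
      also have "\<dots> \<le> norm (F 0) + B * norm (u x)" using lipschitz[of "u x" 0] by simp
      finally have "(norm (F (u x)))\<^sup>2 \<le> (norm (F 0) + B * norm (u x))\<^sup>2" by (intro power_mono) auto
      also have "\<dots> \<le> 2 * (norm (F 0))\<^sup>2 + 2 * B\<^sup>2 * (norm (u x))\<^sup>2"
        using sum_squared_le[of "norm (F 0)" "B * norm (u x)"] by (simp add: power_mult_distrib)
      finally show "norm ((norm (F (u x)))\<^sup>2) \<le> norm (2 * (norm (F 0))\<^sup>2 + 2 * B\<^sup>2 * (norm (u x))\<^sup>2)" by simp
    qed
  qed measurable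
  have F1: "integrable (lebesgue_on \<Omega>) (\<lambda>x. F (u x))"
    by (rule finite_measure_square_integrable[OF fin _ F2]) measurable
  have G2: "integrable (lebesgue_on \<Omega>) (\<lambda>x. (norm (F' (u x) (G x $ i)))\<^sup>2)" for i
  proof (rule Bochner_Integration.integrable_bound)
    show "integrable (lebesgue_on \<Omega>) (\<lambda>x. B\<^sup>2 * (norm (G x $ i))\<^sup>2)" using Gi(2)[of i] by simp
    show "AE x in lebesgue_on \<Omega>. norm ((norm (F' (u x) (G x $ i)))\<^sup>2) \<le> norm (B\<^sup>2 * (norm (G x $ i))\<^sup>2)"
      using power_mono[OF deriv_bound norm_ge_zero, of _ _ 2] by (simp add: power_mult_distrib)
  qed measurable
  have G1: "integrable (lebesgue_on \<Omega>) (\<lambda>x. F' (u x) (G x $ i))" for i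
    by (rule finite_measure_square_integrable[OF fin _ G2]) measurable
  show ?thesis unfolding sobolev_pair_def
    using weak_gradient_chain[OF \<Omega>(1) w ui(1) Gi(1) F1] F1 F2 G1 G2 by simp
qed

lemma sobolev_pair_Pair:
  fixes f :: "real^'n::finite \<Rightarrow> 'b::euclidean_space" and g :: "real^'n \<Rightarrow> 'c::euclidean_space"
  assumes \<Omega>: "open \<Omega>" "bounded \<Omega>" and f: "sobolev_pair \<Omega> f F" and g: "sobolev_pair \<Omega> g G"
  shows "sobolev_pair \<Omega> (\<lambda>x. (f x, g x)) (\<lambda>x. \<chi> i. (F x $ i, G x $ i))"
proof -
  note fin = bounded_open_finite_measure[OF \<Omega>]
  note d = f[unfolded sobolev_pair_def] g[unfolded sobolev_pair_def]
  have sq: "integrable M (\<lambda>x. (norm (p x, q x))\<^sup>2)" "integrable M (\<lambda>x. (p x, q x))"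
    if M: "finite_measure M" "integrable M p" "integrable M q" "integrable M (\<lambda>x. (norm (p x))\<^sup>2)" "integrable M (\<lambda>x. (norm (q x))\<^sup>2)"
    for M :: "(real^'n) measure" and p :: "_ \<Rightarrow> 'b" and q :: "_ \<Rightarrow> 'c"
  proof -
    note [measurable] = borel_measurable_integrable[OF M(2)] borel_measurable_integrable[OF M(3)]
    show s: "integrable M (\<lambda>x. (norm (p x, q x))\<^sup>2)" using M(4,5) by (simp add: norm_Pair)
    have "(\<lambda>x. (p x, q x)) \<in> borel_measurable M" by (rule borel_measurable_Pair) measurable
    then show "integrable M (\<lambda>x. (p x, q x))" by (rule finite_measure_square_integrable[OF M(1) _ s])
  qed
  show ?thesis unfolding sobolev_pair_def
    using weak_gradient_Pair[OF \<Omega>(1), of f F g G] sq[OF fin] d by simp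
qed

lemma test_fun_sobolev_pair:
  fixes \<psi> :: "real^'n::finite \<Rightarrow> real"
  assumes \<Omega>: "open \<Omega>" and \<psi>: "test_fun \<Omega> \<psi>"
  shows "sobolev_pair \<Omega> \<psi> (\<lambda>x. \<chi> i. partial_deriv i \<psi> x)"
proof -
  have \<Omega>L: "\<Omega> \<in> sets lebesgue" using \<Omega> by simp
  obtain K where K: "compact K" "K \<subseteq> \<Omega>" "\<And>x. x \<notin> K \<Longrightarrow> \<psi> x = 0" "\<And>x i. x \<notin> K \<Longrightarrow> partial_deriv i \<psi> x = 0"
    by (rule test_funE[OF \<psi>]) (rule that)
  have sm: "smooth_fun \<psi>" using \<psi> by (simp add: test_fun_def)
  have 1: "integrable (lebesgue_on K) (\<lambda>x. 1::real)"
    using lmeasurable_compact[OF K(1)] K(1) by (simp add: integrable_restrict_space compact_imp_closed lmeasurable_iff_integrable)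
  have int: "integrable (lebesgue_on \<Omega>) g" if "continuous_on UNIV g" "\<And>x. x \<notin> K \<Longrightarrow> g x = 0" for g :: "real^'n \<Rightarrow> real"
    using compact_support_scaleR_integrable(2)[OF that K(1) 1 K(2) \<Omega>L] by simp
  have c: "continuous_on UNIV \<psi>" "\<And>i. continuous_on UNIV (partial_deriv i \<psi>)"
    by (intro smooth_fun_continuous smooth_fun_partial sm)+
  have "integrable (lebesgue_on \<Omega>) \<psi>" by (rule int[OF c(1) K(3)])
  moreover have "integrable (lebesgue_on \<Omega>) (\<lambda>x. (\<psi> x)\<^sup>2)"
    by (rule int[OF continuous_on_power[OF c(1)]]) (simp add: K(3))
  moreover have "integrable (lebesgue_on \<Omega>) (partial_deriv i \<psi>)" for i by (rule int[OF c(2) K(4)])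
  moreover have "integrable (lebesgue_on \<Omega>) (\<lambda>x. (partial_deriv i \<psi> x)\<^sup>2)" for i
    by (rule int[OF continuous_on_power[OF c(2)]]) (simp add: K(4))
  ultimately show ?thesis using test_fun_weak_gradient[OF assms] by (simp add: sobolev_pair_def)
qed

text \<open>The gradient named in \<open>sobolev_W12_0\<close> need not be the one from
  \<open>sobolev_W12\<close>; uniqueness identifies them almost everywhere. A subsequence adds the
  pointwise convergence that \<open>F'_power_limit\<close> asks for.\<close>

lemma sobolev_W12_0_approximation:
  fixes v :: "real^'n::finite \<Rightarrow> real"
  assumes \<Omega>: "open \<Omega>" "bounded \<Omega>" and v: "sobolev_W12_0 \<Omega> v"
  obtains G \<phi> where "sobolev_pair \<Omega> v G" "\<And>k. test_fun \<Omega> (\<phi> k)"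
    "(\<lambda>k. \<integral>\<^sup>+x. ennreal ((norm (\<phi> k x - v x))\<^sup>2) \<partial>lebesgue_on \<Omega>) \<longlonglongrightarrow> 0"
    "\<And>i. (\<lambda>k. \<integral>\<^sup>+x. ennreal ((norm (partial_deriv i (\<phi> k) x - G x $ i))\<^sup>2) \<partial>lebesgue_on \<Omega>) \<longlonglongrightarrow> 0"
    "AE x in lebesgue_on \<Omega>. (\<lambda>k. \<phi> k x) \<longlonglongrightarrow> v x"
proof -
  obtain G where G: "sobolev_pair \<Omega> v G"
    using v sobolev_W12_iff_pair[OF \<Omega>, of v] by (auto simp: sobolev_W12_0_def)
  obtain G' \<phi> where G': "weak_gradient \<Omega> v G'" and \<phi>: "\<And>k. test_fun \<Omega> (\<phi> k)"
    and lim: "(\<lambda>k. \<integral>\<^sup>+ x. ennreal ((norm (\<phi> k x - v x))\<^sup>2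
                 + (\<Sum>i\<in>UNIV. (norm (partial_deriv i (\<phi> k) x - G' x $ i))\<^sup>2)) \<partial>lebesgue_on \<Omega>) \<longlonglongrightarrow> 0"
    using v unfolding sobolev_W12_0_def by blast
  have ae: "AE x in lebesgue_on \<Omega>. G' x = G x"
    using weak_gradient_unique[OF \<Omega>(1) G', of G] G by (simp add: sobolev_pair_def)
  have l1: "(\<lambda>k. \<integral>\<^sup>+x. ennreal ((norm (\<phi> k x - v x))\<^sup>2) \<partial>lebesgue_on \<Omega>) \<longlonglongrightarrow> 0"
    by (rule tendsto_sandwich[OF _ _ tendsto_const lim])
       (auto intro!: always_eventually nn_integral_mono ennreal_leI simp: sum_nonneg simp flip: ennreal_plus)
  have l2: "(\<lambda>k. \<integral>\<^sup>+x. ennreal ((norm (partial_deriv i (\<phi> k) x - G x $ i))\<^sup>2) \<partial>lebesgue_on \<Omega>) \<longlonglongrightarrow> 0" for i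
  proof (rule tendsto_sandwich[OF _ _ tendsto_const lim])
    show "\<forall>\<^sub>F k in sequentially. (\<integral>\<^sup>+x. ennreal ((norm (partial_deriv i (\<phi> k) x - G x $ i))\<^sup>2) \<partial>lebesgue_on \<Omega>)
      \<le> (\<integral>\<^sup>+ x. ennreal ((norm (\<phi> k x - v x))\<^sup>2
                 + (\<Sum>i\<in>UNIV. (norm (partial_deriv i (\<phi> k) x - G' x $ i))\<^sup>2)) \<partial>lebesgue_on \<Omega>)"
    proof (rule always_eventually, rule allI, rule nn_integral_mono_AE)
      fix k
      show "AE x in lebesgue_on \<Omega>. ennreal ((norm (partial_deriv i (\<phi> k) x - G x $ i))\<^sup>2) \<le> ennreal ((norm (\<phi> k x - v x))\<^sup>2
                 + (\<Sum>i\<in>UNIV. (norm (partial_deriv i (\<phi> k) x - G' x $ i))\<^sup>2))"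
        using ae
      proof eventually_elim
        case (elim x)
        have "(norm (partial_deriv i (\<phi> k) x - G x $ i))\<^sup>2 \<le> (\<Sum>i\<in>UNIV. (norm (partial_deriv i (\<phi> k) x - G' x $ i))\<^sup>2)"
          unfolding elim by (rule member_le_sum) auto
        then show ?case by (intro ennreal_leI) (simp add: add_increasing)
      qed
    qed
  qed auto
  have m [measurable]: "v \<in> borel_measurable (lebesgue_on \<Omega>)" "\<phi> k \<in> borel_measurable (lebesgue_on \<Omega>)" for k
    using G test_fun_sobolev_pair[OF \<Omega>(1) \<phi>[of k]] borel_measurable_integrable by (auto simp: sobolev_pair_def)
  have "(\<lambda>k. \<integral>\<^sup>+x. ennreal (norm ((\<phi> k x - v x)\<^sup>2 - 0)) \<partial>lebesgue_on \<Omega>) \<longlonglongrightarrow> 0" using l1 by simp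
  then obtain r where r: "strict_mono r" "AE x in lebesgue_on \<Omega>. (\<lambda>k. (\<phi> (r k) x - v x)\<^sup>2) \<longlonglongrightarrow> 0"
    by (rule AE_convergent_subsequence[rotated 2]) auto
  show ?thesis
  proof (rule that[OF G, of "\<lambda>k. \<phi> (r k)"])
    show "test_fun \<Omega> (\<phi> (r k))" for k by (rule \<phi>)
    show "AE x in lebesgue_on \<Omega>. (\<lambda>k. \<phi> (r k) x) \<longlonglongrightarrow> v x"
      using r(2)
    proof eventually_elim
      case (elim x)
      have "(\<lambda>k. sqrt ((\<phi> (r k) x - v x)\<^sup>2)) \<longlonglongrightarrow> sqrt 0" by (intro tendsto_intros elim)
      then have "(\<lambda>k. \<phi> (r k) x - v x) \<longlonglongrightarrow> 0" by (simp add: tendsto_rabs_zero_iff)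
      then show ?case by (rule LIM_zero_cancel)
    qed
  qed (use LIMSEQ_subseq_LIMSEQ[OF l1 r(1)] LIMSEQ_subseq_LIMSEQ[OF l2 r(1)] in \<open>auto simp: comp_def\<close>)
qed

text \<open>The derivative of a product contains both factors undifferentiated, so \<open>T\<close>
  and \<open>N\<close> have to be bounded along with their derivatives.\<close>

lemma bounded_C1_product:
  fixes T T' :: "real \<Rightarrow> real" and N :: "'b::euclidean_space \<Rightarrow> 'c::euclidean_space"
  assumes T: "\<And>t. (T has_real_derivative T' t) (at t)" "continuous_on UNIV T'" "\<And>t. \<bar>T t\<bar> \<le> C" "\<And>t. \<bar>T' t\<bar> \<le> C"
    and N: "bounded_C1 N N' B" "\<And>w. norm (N w) \<le> B"
  shows "bounded_C1 (\<lambda>p. T (fst p) *\<^sub>R N (snd p))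
    (\<lambda>p q. T (fst p) *\<^sub>R N' (snd p) (snd q) + (fst q * T' (fst p)) *\<^sub>R N (snd p)) (C * B + C * B)"
proof -
  interpret N: bounded_C1 N N' B by (rule N(1))
  have cT: "continuous_on UNIV T"
    using T(1) by (meson DERIV_isCont continuous_at_imp_continuous_on)
  have C: "C \<ge> 0" using T(3)[of 0] by linarith
  show ?thesis
  proof
    fix p :: "real \<times> 'b"
    have 1: "((\<lambda>p. T (fst p)) has_derivative (\<lambda>q. fst q * T' (fst p))) (at p)"
      using has_derivative_compose[OF has_derivative_fst[OF has_derivative_ident] T(1)[unfolded has_field_derivative_def], of p UNIV]
      by (simp add: mult.commute)
    have 2: "((\<lambda>p. N (snd p)) has_derivative (\<lambda>q. N' (snd p) (snd q))) (at p)"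
      using has_derivative_compose[OF has_derivative_snd[OF has_derivative_ident] N.deriv, of p UNIV] by simp
    show "((\<lambda>p. T (fst p) *\<^sub>R N (snd p)) has_derivative
        (\<lambda>q. T (fst p) *\<^sub>R N' (snd p) (snd q) + (fst q * T' (fst p)) *\<^sub>R N (snd p))) (at p)"
      by (rule has_derivative_scaleR[OF 1 2])
  next
    fix q :: "real \<times> 'b"
    show "continuous_on UNIV (\<lambda>p. T (fst p) *\<^sub>R N' (snd p) (snd q) + (fst q * T' (fst p)) *\<^sub>R N (snd p))"
      by (intro continuous_intros continuous_on_compose2[OF cT] continuous_on_compose2[OF T(2)]
          continuous_on_compose2[OF N.F_cont] continuous_on_compose2[OF N.deriv_cont] subset_UNIV)
  next
    fix p q :: "real \<times> 'b"
    have "norm (T (fst p) *\<^sub>R N' (snd p) (snd q) + (fst q * T' (fst p)) *\<^sub>R N (snd p))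
      \<le> \<bar>T (fst p)\<bar> * norm (N' (snd p) (snd q)) + \<bar>T' (fst p)\<bar> * norm (N (snd p)) * \<bar>fst q\<bar>"
      by (rule order_trans[OF norm_triangle_ineq]) (simp add: abs_mult mult_ac)
    also have "\<dots> \<le> C * (B * norm q) + C * B * norm q"
    proof (intro add_mono mult_mono T N(2))
      show "norm (N' (snd p) (snd q)) \<le> B * norm q"
        using mult_left_mono[OF norm_snd_le[of "snd q" "fst q"] N.B_nonneg] N.deriv_bound[of "snd p" "snd q"] by simp
      show "\<bar>fst q\<bar> \<le> norm q" using norm_fst_le[of "fst q" "snd q"] by simp
    qed (use C N.B_nonneg in auto)
    finally show "norm (T (fst p) *\<^sub>R N' (snd p) (snd q) + (fst q * T' (fst p)) *\<^sub>R N (snd p)) \<le> (C * B + C * B) * norm q"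
      by (simp add: algebra_simps)
  qed
qed

text \<open>Replacing \<open>v\<close> by test functions \<open>\<phi> k\<close> makes \<open>T (\<phi> k) N (u)\<close> compactly supported; boundedness of \<open>T\<close> is what
  lets the term \<open>T (\<phi> k) \<nabla>(N (u))\<close> converge, as \<open>\<phi> k\<close> need not be uniformly bounded.\<close>

lemma sobolev_W12_0_product:
  fixes v :: "real^'n::finite \<Rightarrow> real" and u :: "real^'n \<Rightarrow> 'b::euclidean_space" and N :: "'b \<Rightarrow> 'c::euclidean_space"
  assumes \<Omega>: "open \<Omega>" "bounded \<Omega>" and v: "sobolev_W12_0 \<Omega> v" and u: "sobolev_pair \<Omega> u G"
    and T: "\<And>t. (T has_real_derivative T' t) (at t)" "continuous_on UNIV T'" "\<And>t. \<bar>T t\<bar> \<le> C" "\<And>t. \<bar>T' t\<bar> \<le> C" "T 0 = 0" "T' 0 = 0"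
    and N: "bounded_C1 N N' B" "\<And>w. norm (N w) \<le> B"
  shows "sobolev_W12_0 \<Omega> (\<lambda>x. T (v x) *\<^sub>R N (u x))"
proof -
  interpret P: bounded_C1 "\<lambda>p. T (fst p) *\<^sub>R N (snd p)"
    "\<lambda>p q. T (fst p) *\<^sub>R N' (snd p) (snd q) + (fst q * T' (fst p)) *\<^sub>R N (snd p)" "C * B + C * B"
    by (rule bounded_C1_product[OF T(1-4) N])
  obtain V \<phi> where V: "sobolev_pair \<Omega> v V" and \<phi>: "\<And>k. test_fun \<Omega> (\<phi> k)"
    and lim: "(\<lambda>k. \<integral>\<^sup>+x. ennreal ((norm (\<phi> k x - v x))\<^sup>2) \<partial>lebesgue_on \<Omega>) \<longlonglongrightarrow> 0"
    "\<And>i. (\<lambda>k. \<integral>\<^sup>+x. ennreal ((norm (partial_deriv i (\<phi> k) x - V x $ i))\<^sup>2) \<partial>lebesgue_on \<Omega>) \<longlonglongrightarrow> 0"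
    and ae: "AE x in lebesgue_on \<Omega>. (\<lambda>k. \<phi> k x) \<longlonglongrightarrow> v x"
    by (rule sobolev_W12_0_approximation[OF \<Omega> v]) (rule that)
  have "\<exists>K. compact K \<and> K \<subseteq> \<Omega> \<and> (\<forall>x. x \<notin> K \<longrightarrow> \<phi> k x = 0)" for k
    by (rule test_funE[OF \<phi>[of k]]) blast
  then obtain K where K: "\<And>k. compact (K k)" "\<And>k. K k \<subseteq> \<Omega>" "\<And>k x. x \<notin> K k \<Longrightarrow> \<phi> k x = 0" by metis
  note p = sobolev_pair_Pair[OF \<Omega> V u]
  note pk = sobolev_pair_Pair[OF \<Omega> test_fun_sobolev_pair[OF \<Omega>(1) \<phi>] u]
  note d = p[unfolded sobolev_pair_def] and dk = pk[unfolded sobolev_pair_def]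
  have m: "(\<lambda>x. (v x, u x)) \<in> borel_measurable (lebesgue_on \<Omega>)" "(\<lambda>x. (V x $ i, G x $ i)) \<in> borel_measurable (lebesgue_on \<Omega>)"
    "(\<lambda>x. (\<phi> k x, u x)) \<in> borel_measurable (lebesgue_on \<Omega>)" "(\<lambda>x. (partial_deriv i (\<phi> k) x, G x $ i)) \<in> borel_measurable (lebesgue_on \<Omega>)" for i k
    using d dk[of k] by (auto dest!: borel_measurable_integrable)
  show ?thesis
  proof (rule sobolev_W12_0I[OF \<Omega> P.sobolev_pair_chain[OF \<Omega> p, simplified] P.sobolev_pair_chain[OF \<Omega> pk, simplified] K(1,2)])
    \<comment> \<open>The gradient representative must vanish off \<open>K k\<close> as well as the
      function: \<open>T 0 = 0\<close> removes the term with \<open>N'\<close>,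
      \<open>T' 0 = 0\<close> the other one.\<close>
    show "T (\<phi> k x) *\<^sub>R N (u x) = 0" if "x \<notin> K k" for k x using K(3)[OF that] T(5) by simp
    show "(\<chi> i. T (\<phi> k x) *\<^sub>R N' (u x) (G x $ i) + (partial_deriv i (\<phi> k) x * T' (\<phi> k x)) *\<^sub>R N (u x)) $ i = 0"
      if "x \<notin> K k" for k x i using K(3)[OF that] T(5,6) by simp
    show "(\<lambda>k. \<integral>\<^sup>+x. ennreal ((norm (T (\<phi> k x) *\<^sub>R N (u x) - T (v x) *\<^sub>R N (u x)))\<^sup>2) \<partial>lebesgue_on \<Omega>) \<longlonglongrightarrow> 0"
    proof (rule tendsto_sandwich[OF _ _ tendsto_const])
      let ?L = "C * B + C * B"
      have "(\<lambda>k. ennreal (?L\<^sup>2) * (\<integral>\<^sup>+x. ennreal ((norm (\<phi> k x - v x))\<^sup>2) \<partial>lebesgue_on \<Omega>)) \<longlonglongrightarrow> ennreal (?L\<^sup>2) * 0"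
        by (intro tendsto_intros lim) auto
      then show "(\<lambda>k. ennreal (?L\<^sup>2) * (\<integral>\<^sup>+x. ennreal ((norm (\<phi> k x - v x))\<^sup>2) \<partial>lebesgue_on \<Omega>)) \<longlonglongrightarrow> 0" by simp
      show "\<forall>\<^sub>F k in sequentially. (\<integral>\<^sup>+x. ennreal ((norm (T (\<phi> k x) *\<^sub>R N (u x) - T (v x) *\<^sub>R N (u x)))\<^sup>2) \<partial>lebesgue_on \<Omega>)
         \<le> ennreal (?L\<^sup>2) * (\<integral>\<^sup>+x. ennreal ((norm (\<phi> k x - v x))\<^sup>2) \<partial>lebesgue_on \<Omega>)"
      proof (intro always_eventually allI)
        fix k
        have mv: "v \<in> borel_measurable (lebesgue_on \<Omega>)" "\<phi> k \<in> borel_measurable (lebesgue_on \<Omega>)"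
          using V test_fun_sobolev_pair[OF \<Omega>(1) \<phi>[of k]] borel_measurable_integrable by (auto simp: sobolev_pair_def)
        note [measurable] = mv
        have "(\<integral>\<^sup>+x. ennreal ((norm (T (\<phi> k x) *\<^sub>R N (u x) - T (v x) *\<^sub>R N (u x)))\<^sup>2) \<partial>lebesgue_on \<Omega>)
          \<le> (\<integral>\<^sup>+x. ennreal (?L\<^sup>2) * ennreal ((norm (\<phi> k x - v x))\<^sup>2) \<partial>lebesgue_on \<Omega>)"
        proof (rule nn_integral_mono)
          fix x
          have "norm (T (\<phi> k x) *\<^sub>R N (u x) - T (v x) *\<^sub>R N (u x)) \<le> ?L * norm (\<phi> k x - v x)"
            using P.lipschitz[of "(\<phi> k x, u x)" "(v x, u x)"] by (simp add: norm_Pair)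
          then have "(norm (T (\<phi> k x) *\<^sub>R N (u x) - T (v x) *\<^sub>R N (u x)))\<^sup>2 \<le> (?L * norm (\<phi> k x - v x))\<^sup>2"
            by (intro power_mono) auto
          then show "ennreal ((norm (T (\<phi> k x) *\<^sub>R N (u x) - T (v x) *\<^sub>R N (u x)))\<^sup>2) \<le> ennreal (?L\<^sup>2) * ennreal ((norm (\<phi> k x - v x))\<^sup>2)"
            by (subst ennreal_mult[symmetric]) (auto intro!: ennreal_leI simp: power_mult_distrib)
        qed
        also have "\<dots> = ennreal (?L\<^sup>2) * (\<integral>\<^sup>+x. ennreal ((norm (\<phi> k x - v x))\<^sup>2) \<partial>lebesgue_on \<Omega>)"
          by (rule nn_integral_cmult) measurable
        finally show "(\<integral>\<^sup>+x. ennreal ((norm (T (\<phi> k x) *\<^sub>R N (u x) - T (v x) *\<^sub>R N (u x)))\<^sup>2) \<partial>lebesgue_on \<Omega>) \<le> \<dots>" .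
      qed
    qed auto
    fix i
    have 1: "AE x in lebesgue_on \<Omega>. (\<lambda>k. (\<phi> k x, u x)) \<longlonglongrightarrow> (v x, u x)"
      using ae by (auto elim!: eventually_mono intro!: tendsto_Pair)
    have 2: "integrable (lebesgue_on \<Omega>) (\<lambda>x. (norm (V x $ i, G x $ i))\<^sup>2)" using d by simp
    have 3: "(\<lambda>k. \<integral>\<^sup>+x. ennreal ((norm ((partial_deriv i (\<phi> k) x, G x $ i) - (V x $ i, G x $ i)))\<^sup>2) \<partial>lebesgue_on \<Omega>) \<longlonglongrightarrow> 0"
      using lim(2)[of i] by (simp add: norm_Pair)
    show "(\<lambda>k. \<integral>\<^sup>+x. ennreal ((norm ((\<chi> i. T (\<phi> k x) *\<^sub>R N' (u x) (G x $ i) + (partial_deriv i (\<phi> k) x * T' (\<phi> k x)) *\<^sub>R N (u x)) $ i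
       - (\<chi> i. T (v x) *\<^sub>R N' (u x) (G x $ i) + (V x $ i * T' (v x)) *\<^sub>R N (u x)) $ i))\<^sup>2) \<partial>lebesgue_on \<Omega>) \<longlonglongrightarrow> 0"
      using P.F'_power_limit[where p = 2, OF pos2 m(3) m(1) 1 m(2) 2 m(4) 3] by simp
  qed
qed

subsection \<open>The radial comparison map\<close>

text \<open>The tool for all later gluing: a constant continues a profile differentiably where the
  profile has slope \<open>0\<close>. At the junction the difference quotient is dominated by that
  of \<open>k\<close>, which tends to \<open>0\<close>.\<close>

lemma deriv_comp_positive_part:
  assumes k: "\<And>s. 0 \<le> s \<Longrightarrow> (k has_real_derivative k' s) (at s)" and k0: "k' 0 = 0"
  shows "((\<lambda>t. k (max 0 t)) has_real_derivative k' (max 0 t)) (at t)"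
proof (cases t "0::real" rule: linorder_cases)
  case less
  have "((\<lambda>_. k 0) has_real_derivative 0) (at t)" by simp
  then have "((\<lambda>t. k (max 0 t)) has_real_derivative 0) (at t)"
    by (rule DERIV_cong_ev[THEN iffD1, rotated -1])
       (use less eventually_nhds_in_open[of "{..<0}" t] in \<open>auto elim!: eventually_mono\<close>)
  then show ?thesis using less k0 by simp
next
  case equal
  have "(\<lambda>h. (k (0 + h) - k 0) / h) \<midarrow>0\<rightarrow> 0"
    using k[of 0] k0 by (simp add: DERIV_def)
  then have "(\<lambda>h. \<bar>(k h - k 0) / h\<bar>) \<midarrow>0\<rightarrow> 0" using tendsto_rabs_zero by fastforce
  then have "(\<lambda>h. (k (max 0 (0 + h)) - k (max 0 0)) / h) \<midarrow>0\<rightarrow> 0"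
    by (rule Lim_null_comparison[rotated]) (auto simp: max_def divide_le_0_iff intro!: always_eventually)
  then show ?thesis using equal k0 by (simp add: DERIV_def)
next
  case greater
  have "(k has_real_derivative k' t) (at t)" using k greater by simp
  then have "((\<lambda>t. k (max 0 t)) has_real_derivative k' t) (at t)"
    by (rule DERIV_cong_ev[THEN iffD1, rotated -1])
       (use greater eventually_nhds_in_open[of "{0<..}" t] in \<open>auto elim!: eventually_mono\<close>)
  then show ?thesis using greater by simp
qed

text \<open>The radial profile is \<open>\<alpha>(r + t) = r + t - h t\<close>: the slope of \<open>h\<close> is a trapezoid rising from \<open>0\<close>
  to a plateau below \<open>2\<close> and descending to \<open>1\<close>, which it reaches exactly when \<open>\<alpha>\<close> reaches \<open>0\<close>, at
  \<open>t = r0 - r\<close>. This needs average slope below \<open>2\<close>, that is \<open>r < r0 / 2\<close>.\<close>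

lemma trapezoid_profile:
  fixes r r0 :: real
  assumes r: "0 < r" "r < r0 / 2"
  obtains h D where "\<And>s. (h has_real_derivative D s) (at s)" "continuous_on UNIV D"
    "\<And>s. s \<le> 0 \<Longrightarrow> h s = 0" "\<And>s. s \<le> 0 \<Longrightarrow> D s = 0"
    "\<And>s. 0 < s \<Longrightarrow> 0 < h s" "\<And>s. 0 < s \<Longrightarrow> h s \<le> s + r" "\<And>s. 0 < s \<Longrightarrow> 0 < D s" "\<And>s. D s < 2"
    "\<And>s. r0 - r \<le> s \<Longrightarrow> h s = s + r"
proof -
  define \<tau> where "\<tau> = r0 - r"
  have \<tau>: "r < \<tau>" "0 < \<tau>" using r by (auto simp: \<tau>_def)
  \<comment> \<open>The plateau of the slope will have height \<open>1 + \<theta>\<close>. Here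
    \<open>\<theta> < 1\<close> keeps it below \<open>2\<close>,
    \<open>\<theta> > r / \<tau>\<close> leaves enough area to reach
    \<open>h \<tau> = \<tau> + r\<close>, and the bound with \<open>1 / 4\<close> makes the ramps
    too short to overlap.\<close>
  have "r / \<tau> < min 1 (r / \<tau> + 1 / 4)" using \<tau> by simp
  then obtain \<theta> where \<theta>: "r / \<tau> < \<theta>" "\<theta> < min 1 (r / \<tau> + 1 / 4)" using dense by blast
  have \<theta>0: "0 < \<theta>" using \<theta>(1) r \<tau> by (meson divide_pos_pos less_trans)
  have \<theta>1: "\<theta> < 1" "r < \<theta> * \<tau>" "\<theta> * \<tau> - r < \<tau> / 4" using \<theta> \<tau> by (auto simp: field_simps)
  \<comment> \<open>With ramps of slope \<open>1 / \<delta>\<close> up to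
    \<open>1 + \<theta>\<close> and down to \<open>1\<close>, the area over
    \<open>[0, \<tau>]\<close> is \<open>(1 + \<theta>) * \<tau> - \<delta> * q\<close>. Equating it
    with \<open>\<tau> + r\<close> determines \<open>\<delta>\<close>.\<close>
  define q where "q = 1 / 2 + \<theta> + \<theta>\<^sup>2"
  have q: "q > 0" using \<theta>0 by (simp add: q_def add_pos_nonneg)
  define \<delta> where "\<delta> = (\<theta> * \<tau> - r) / q"
  have \<delta>: "\<delta> > 0" "\<delta> * q = \<theta> * \<tau> - r" using q \<theta>1 by (auto simp: \<delta>_def)
  define t1 where "t1 = \<delta> * (1 + \<theta>)"
  define t2 where "t2 = \<tau> - \<delta> * \<theta>"
  have sum: "t1 + t2 = \<tau> + \<delta>" by (simp add: t1_def t2_def algebra_simps)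
  have t1: "\<delta> < t1" "t1 < 2 * \<delta>" using \<delta> \<theta>0 \<theta>1 by (auto simp: t1_def)
  have "\<delta> * (1 + 2 * \<theta>) \<le> \<delta> * (2 * q)" using \<delta>(1) by (intro mult_left_mono) (auto simp: q_def)
  also have "\<dots> < \<tau>" using \<delta>(2) \<theta>1(3) \<tau> by simp
  finally have t12: "t1 < t2" by (simp add: t1_def t2_def algebra_simps)
  have t2: "t2 < \<tau>" using \<delta> \<theta>0 by (simp add: t2_def)
  \<comment> \<open>The area condition \<open>h \<tau> = \<tau> + r\<close>, multiplied by
    \<open>2 * \<delta>\<close>.\<close>
  have cond: "\<tau>\<^sup>2 - (\<tau> - t1)\<^sup>2 - (\<tau> - t2)\<^sup>2 = 2 * \<delta> * (\<tau> + r)"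
  proof -
    have "\<tau>\<^sup>2 - (\<tau> - t1)\<^sup>2 - (\<tau> - t2)\<^sup>2 = 2 * \<delta> * (\<tau> + \<theta> * \<tau> - \<delta> * q)"
      by (simp add: t1_def t2_def q_def power2_eq_square field_simps)
    then show ?thesis using \<delta>(2) by simp
  qed
  \<comment> \<open>Antiderivative of the piecewise linear slope: one truncated square for each of
    its kinks \<open>0\<close>, \<open>t1\<close>, \<open>t2\<close>, \<open>\<tau>\<close>.\<close>
  define h where "h s = ((max 0 s)\<^sup>2 - (max 0 (s - t1))\<^sup>2 - (max 0 (s - t2))\<^sup>2 + (max 0 (s - \<tau>))\<^sup>2) / (2 * \<delta>)" for s
  define D where "D s = (max 0 s - max 0 (s - t1) - max 0 (s - t2) + max 0 (s - \<tau>)) / \<delta>" for s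
  have sq: "((\<lambda>s. (max 0 (s - c))\<^sup>2) has_real_derivative 2 * max 0 (s - c)) (at s)" for c s :: real
  proof -
    have "((\<lambda>t. (max 0 t)\<^sup>2) has_real_derivative 2 * max 0 (s - c)) (at (s - c))"
      by (rule deriv_comp_positive_part[where k = "\<lambda>t. t\<^sup>2" and k' = "\<lambda>t. 2 * t"]) (auto intro!: derivative_eq_intros)
    then show ?thesis unfolding diff_conv_add_uminus DERIV_shift .
  qed
  have hD: "(h has_real_derivative D s) (at s)" for s
  proof -
    have "((\<lambda>s. (max 0 s)\<^sup>2 - (max 0 (s - t1))\<^sup>2 - (max 0 (s - t2))\<^sup>2 + (max 0 (s - \<tau>))\<^sup>2) has_real_derivative
      2 * max 0 s - 2 * max 0 (s - t1) - 2 * max 0 (s - t2) + 2 * max 0 (s - \<tau>)) (at s)"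
      using sq[of 0 s] by (intro DERIV_add DERIV_diff sq) simp
    from DERIV_cdivide[OF this, of "2 * \<delta>"] show ?thesis
      unfolding h_def[abs_def] D_def by (rule DERIV_cong) (use \<delta> in \<open>simp add: field_simps\<close>)
  qed
  have cD: "continuous_on UNIV D" unfolding D_def[abs_def] using \<delta> by (intro continuous_intros) auto
  have h0: "h s = 0" "D s = 0" if "s \<le> 0" for s
    using that t1 t12 t2 \<delta> by (auto simp: h_def D_def max_def)
  have hc: "continuous_on S h" for S using hD by (meson DERIV_isCont continuous_at_imp_continuous_on)
  have D\<delta>: "\<delta> * D s = max 0 s - max 0 (s - t1) - max 0 (s - t2) + max 0 (s - \<tau>)" for s using \<delta> by (simp add: D_def)
  have Dpos: "0 < D s" if "0 < s" for s
  proof -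
    have "0 < \<delta> * D s" unfolding D\<delta> using that t1 t12 t2 sum \<delta> by (auto simp: max_def)
    then show ?thesis using \<delta>(1) by (simp add: zero_less_mult_iff)
  qed
  have D2: "D s < 2" for s
  proof -
    have "\<delta> * D s < \<delta> * 2" unfolding D\<delta> using t1 t12 t2 sum \<delta> by (auto simp: max_def)
    then show ?thesis using \<delta>(1) by simp
  qed
  have Dge1: "1 \<le> D s" if "\<delta> \<le> s" for s
  proof -
    have "\<delta> * 1 \<le> \<delta> * D s" unfolding D\<delta> using that t1 t12 t2 sum \<delta> by (auto simp: max_def)
    then show ?thesis using \<delta>(1) by simp
  qed
  have Dle1: "D s \<le> 1" if "s \<le> \<delta>" for s
  proof -
    have "\<delta> * D s \<le> \<delta> * 1" unfolding D\<delta> using that t1 t12 t2 sum \<delta> by (auto simp: max_def)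
    then show ?thesis using \<delta>(1) by simp
  qed
  have hpos: "0 < h s" if "0 < s" for s
  proof -
    have "h 0 < h s"
      by (rule DERIV_pos_imp_increasing_open[OF that]) (use hD Dpos hc in blast)+
    then show ?thesis using h0(1)[of 0] by simp
  qed
  have hend: "h s = s + r" if "\<tau> \<le> s" for s
  proof -
    have "2 * \<delta> * h s = s\<^sup>2 - (s - t1)\<^sup>2 - (s - t2)\<^sup>2 + (s - \<tau>)\<^sup>2"
      using that t1 t12 t2 \<delta> by (simp add: h_def max_def)
    also have "\<dots> = 2 * (s - \<tau>) * (t1 + t2 - \<tau>) + (\<tau>\<^sup>2 - (\<tau> - t1)\<^sup>2 - (\<tau> - t2)\<^sup>2)"
      by (simp add: power2_eq_square algebra_simps)
    also have "\<dots> = 2 * \<delta> * (s + r)" unfolding cond sum by (simp add: algebra_simps)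
    finally show ?thesis using \<delta>(1) by simp
  qed
  have hle: "h s \<le> s + r" if "0 < s" for s
  proof -
    \<comment> \<open>It starts at \<open>r\<close>, rises up to \<open>\<delta>\<close> where the
      slope of \<open>h\<close> passes \<open>1\<close>, then falls to \<open>0\<close> at
      \<open>\<tau>\<close>; hence it is never negative.\<close>
    let ?\<alpha> = "\<lambda>s. s + r - h s"
    have \<alpha>: "(?\<alpha> has_real_derivative 1 - D x) (at x)" for x using hD by (auto intro!: derivative_eq_intros)
    consider "s \<le> \<delta>" | "\<delta> \<le> s" "s \<le> \<tau>" | "\<tau> \<le> s" by linarith
    then show ?thesis
    proof cases
      case 1
      have "?\<alpha> 0 \<le> ?\<alpha> s"
        by (rule DERIV_nonneg_imp_nondecreasing[of 0 s ?\<alpha>]) (use that \<alpha> Dle1 1 in \<open>auto intro!: exI\<close>)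
      then show ?thesis using h0(1)[of 0] r by simp
    next
      case 2
      have "?\<alpha> \<tau> \<le> ?\<alpha> s"
        by (rule DERIV_nonpos_imp_nonincreasing[of s \<tau> ?\<alpha>]) (use \<alpha> Dge1 2 in \<open>auto intro!: exI\<close>)
      then show ?thesis using hend[of \<tau>] by simp
    next
      case 3 then show ?thesis using hend by simp
    qed
  qed
  show ?thesis by (rule that[OF hD cD h0 hpos hle Dpos D2]) (use hend in \<open>simp_all add: \<tau>_def\<close>)
qed

text \<open>Beyond \<open>M\<close> the profile is bent by an arctangent to make it bounded; \<open>M\<close> will be a bound for \<open>norm (u x - a)\<close>.\<close>

lemma truncated_profile:
  fixes r r0 M :: real
  assumes r: "0 < r" "r < r0 / 2" and M: "0 < M"
  obtains T T' C where "\<And>t. (T has_real_derivative T' t) (at t)" "continuous_on UNIV T'"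
    "\<And>t. \<bar>T t\<bar> \<le> C" "\<And>t. \<bar>T' t\<bar> \<le> C" "T 0 = 0" "T' 0 = 0"
    "\<And>t. 0 < t \<Longrightarrow> t \<le> M \<Longrightarrow> 0 < T t \<and> T t \<le> t + r \<and> 0 < T' t \<and> T' t < 2"
    "\<And>t. r0 - r \<le> t \<Longrightarrow> t \<le> M \<Longrightarrow> T t = t + r"
proof -
  obtain h D where hD: "\<And>s. (h has_real_derivative D s) (at s)" "continuous_on UNIV D"
    and h0: "\<And>s. s \<le> 0 \<Longrightarrow> h s = 0" and D0: "\<And>s. s \<le> 0 \<Longrightarrow> D s = 0"
    and hpos: "\<And>s. 0 < s \<Longrightarrow> 0 < h s" and hle: "\<And>s. 0 < s \<Longrightarrow> h s \<le> s + r"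
    and Dpos: "\<And>s. 0 < s \<Longrightarrow> 0 < D s" and D2: "\<And>s. D s < 2"
    and hend: "\<And>s. r0 - r \<le> s \<Longrightarrow> h s = s + r"
    by (rule trapezoid_profile[OF r]) (rule that)
  \<comment> \<open>The identity up to \<open>M\<close>, afterwards
    \<open>M + arctan (t - M)\<close>: slopes agree at \<open>M\<close>, and the values stay below
    \<open>M + 2\<close>.\<close>
  define \<zeta> where "\<zeta> t = t - (max 0 (t - M) - arctan (max 0 (t - M)))" for t
  define \<zeta>' where "\<zeta>' t = 1 - (1 - 1 / (1 + (max 0 (t - M))\<^sup>2))" for t
  have d\<zeta>: "(\<zeta> has_real_derivative \<zeta>' t) (at t)" for t
  proof -
    have "((\<lambda>s. max 0 s - arctan (max 0 s)) has_real_derivative 1 - 1 / (1 + (max 0 (t - M))\<^sup>2)) (at (t - M))"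
      by (rule deriv_comp_positive_part[where k = "\<lambda>s. s - arctan s" and k' = "\<lambda>s. 1 - 1 / (1 + s\<^sup>2)"])
         (auto intro!: derivative_eq_intros simp: divide_inverse)
    then have "((\<lambda>t. max 0 (t - M) - arctan (max 0 (t - M))) has_real_derivative 1 - 1 / (1 + (max 0 (t - M))\<^sup>2)) (at t)"
      using DERIV_shift[of "\<lambda>s. max 0 s - arctan (max 0 s)" _ t "- M"] by simp
    from DERIV_diff[OF DERIV_ident this] show ?thesis unfolding \<zeta>_def[abs_def] \<zeta>'_def .
  qed
  have \<zeta>M: "\<zeta> t = t" "\<zeta>' t = 1" if "t \<le> M" for t using that by (auto simp: \<zeta>_def \<zeta>'_def)
  have \<zeta>le: "\<zeta> t \<le> M + 2" for t
  proof (cases "t \<le> M")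
    case False
    then have "\<zeta> t = M + arctan (t - M)" by (simp add: \<zeta>_def)
    also have "\<dots> \<le> M + 2" using arctan_ubound[of "t - M"] pi_half_less_two by simp
    finally show ?thesis .
  qed (use \<zeta>M in simp)
  have \<zeta>'b: "0 \<le> \<zeta>' t" "\<zeta>' t \<le> 1" for t by (auto simp: \<zeta>'_def divide_simps add_pos_nonneg)
  have Dn: "0 \<le> D s" for s using Dpos[of s] D0[of s] by (cases "s \<le> 0") auto
  show ?thesis
  \<comment> \<open>One constant for both bounds: the values are at most \<open>M + 2 + r\<close>,
    the slope at most \<open>2\<close>.\<close>
  proof (rule that[of "\<lambda>t. h (\<zeta> t)" "\<lambda>t. D (\<zeta> t) * \<zeta>' t" "M + r + 4"])
    show "((\<lambda>t. h (\<zeta> t)) has_real_derivative D (\<zeta> t) * \<zeta>' t) (at t)" for t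
      by (rule DERIV_chain2[OF hD(1) d\<zeta>])
    have "continuous_on UNIV \<zeta>" using d\<zeta> by (meson DERIV_isCont continuous_at_imp_continuous_on)
    moreover have "continuous_on UNIV \<zeta>'" unfolding \<zeta>'_def[abs_def]
      by (intro continuous_intros) (auto simp: add_nonneg_eq_0_iff)
    ultimately show "continuous_on UNIV (\<lambda>t. D (\<zeta> t) * \<zeta>' t)"
      by (intro continuous_intros continuous_on_compose2[OF hD(2)] subset_UNIV)
    show "\<bar>h (\<zeta> t)\<bar> \<le> M + r + 4" for t
    proof (cases "\<zeta> t \<le> 0")
      case False
      then show ?thesis using hpos[of "\<zeta> t"] hle[of "\<zeta> t"] \<zeta>le[of t] by simp
    qed (use h0 r M in simp)
    show "\<bar>D (\<zeta> t) * \<zeta>' t\<bar> \<le> M + r + 4" for t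
    proof -
      have "D (\<zeta> t) * \<zeta>' t \<le> 2 * 1" using D2[of "\<zeta> t"] \<zeta>'b[of t] Dn by (intro mult_mono) auto
      then show ?thesis using Dn[of "\<zeta> t"] \<zeta>'b[of t] r M by (simp add: abs_mult)
    qed
    show "h (\<zeta> 0) = 0" "D (\<zeta> 0) * \<zeta>' 0 = 0" using \<zeta>M[of 0] M h0 D0 by auto
    show "0 < h (\<zeta> t) \<and> h (\<zeta> t) \<le> t + r \<and> 0 < D (\<zeta> t) * \<zeta>' t \<and> D (\<zeta> t) * \<zeta>' t < 2" if "0 < t" "t \<le> M" for t
      using that \<zeta>M[of t] hpos hle Dpos D2 by simp
    show "h (\<zeta> t) = t + r" if "r0 - r \<le> t" "t \<le> M" for t using that \<zeta>M[of t] hend by simp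
  qed
qed

text \<open>Radial functions are expressed through the smooth squared distance, clamped at
  \<open>r\<^sup>2\<close>. This avoids differentiating the norm at \<open>a\<close> and handles the
  sphere of radius \<open>r\<close> by \<open>deriv_comp_positive_part\<close>.\<close>

lemma radial_deriv:
  fixes a :: "'b::euclidean_space"
  assumes "\<And>s. 0 \<le> s \<Longrightarrow> (k has_real_derivative k' s) (at s)" "k' 0 = 0"
  shows "((\<lambda>w. k (max 0 ((w - a) \<bullet> (w - a) - r\<^sup>2))) has_derivative
    (\<lambda>\<xi>. k' (max 0 ((w - a) \<bullet> (w - a) - r\<^sup>2)) * (2 * ((w - a) \<bullet> \<xi>)))) (at w)"
proof -
  have "((\<lambda>w. (w - a) \<bullet> (w - a) - r\<^sup>2) has_derivative (\<lambda>\<xi>. 2 * ((w - a) \<bullet> \<xi>))) (at w)"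
    by (auto intro!: derivative_eq_intros simp: inner_commute)
  from has_derivative_compose[OF this deriv_comp_positive_part[OF assms, unfolded has_field_derivative_def]]
  show ?thesis by simp
qed

lemma max_norm_eq_sqrt:
  fixes a w :: "'b::euclidean_space"
  assumes "0 < r"
  shows "sqrt (max 0 ((w - a) \<bullet> (w - a) - r\<^sup>2) + r\<^sup>2) = max r (norm (w - a))"
proof (cases "norm (w - a) \<le> r")
  case True
  then have "(w - a) \<bullet> (w - a) \<le> r\<^sup>2" by (simp add: power2_norm_eq_inner[symmetric] power_mono)
  then show ?thesis using True assms by (simp add: max_absorb1)
next
  case False
  then have "r\<^sup>2 \<le> (w - a) \<bullet> (w - a)" using assms by (simp add: power2_norm_eq_inner[symmetric] power_mono)
  then show ?thesis using False by (simp add: max_def norm_eq_sqrt_inner)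
qed

section \<open>Radial maps that are \<open>C1\<close> across the sphere of radius
  \<open>r\<close>\<close>

locale radial =
  fixes a :: "'b::euclidean_space" and r :: real
  assumes r_pos: "0 < r"
begin

text \<open>Never zero, so it can be divided by, and \<open>m w - r\<close> is the positive part of
  \<open>norm (w - a) - r\<close>.\<close>

definition m :: "'b \<Rightarrow> real" where "m w = max r (norm (w - a))"

lemma m_pos: "0 < m w" and m_ge: "r \<le> m w" "norm (w - a) \<le> m w"
  using r_pos by (auto simp: m_def)

lemma m_cont: "continuous_on UNIV m" unfolding m_def by (intro continuous_intros)

lemma sqrt_shift_deriv:
  assumes "0 \<le> s"
  shows "((\<lambda>y. sqrt (y + r\<^sup>2)) has_real_derivative 1 / (2 * sqrt (s + r\<^sup>2))) (at s)"
proof -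
  have "0 < s + r\<^sup>2" using assms r_pos by (simp add: add_nonneg_pos)
  from DERIV_real_sqrt[OF this] show ?thesis by (simp add: DERIV_shift field_simps)
qed

text \<open>\<open>m\<close> itself has a kink on the sphere of radius \<open>r\<close>; there its
  argument to \<open>T\<close> is \<open>0\<close>, and \<open>T' 0 = 0\<close> smooths the kink
  out.\<close>

lemma comp_m_deriv:
  assumes T: "\<And>t. (T has_real_derivative T' t) (at t)" "T' 0 = 0"
  shows "((\<lambda>w. T (m w - r)) has_derivative (\<lambda>\<xi>. T' (m w - r) / m w * ((w - a) \<bullet> \<xi>))) (at w)"
proof -
  have k: "((\<lambda>y. T (sqrt (y + r\<^sup>2) - r)) has_real_derivative T' (sqrt (s + r\<^sup>2) - r) * (1 / (2 * sqrt (s + r\<^sup>2)))) (at s)"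
    if "0 \<le> s" for s
  proof -
    from DERIV_diff[OF sqrt_shift_deriv[OF that] DERIV_const, of r]
    have "((\<lambda>y. sqrt (y + r\<^sup>2) - r) has_real_derivative 1 / (2 * sqrt (s + r\<^sup>2))) (at s)" by simp
    from DERIV_chain2[OF T(1) this] show ?thesis .
  qed
  have "((\<lambda>w. T (sqrt (max 0 ((w - a) \<bullet> (w - a) - r\<^sup>2) + r\<^sup>2) - r)) has_derivative
    (\<lambda>\<xi>. T' (sqrt (max 0 ((w - a) \<bullet> (w - a) - r\<^sup>2) + r\<^sup>2) - r) * (1 / (2 * sqrt (max 0 ((w - a) \<bullet> (w - a) - r\<^sup>2) + r\<^sup>2)))
       * (2 * ((w - a) \<bullet> \<xi>)))) (at w)"
    by (rule radial_deriv[OF k]) (use T(2) r_pos in simp_all)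
  then show ?thesis unfolding max_norm_eq_sqrt[OF r_pos] m_def[symmetric] by simp
qed

text \<open>A \<open>C\<^sup>1\<close> continuation of \<open>norm (w - a)\<close> from the exterior of the ball of radius \<open>r\<close> to a function
  without zeros, so that \<open>N\<close> below extends the radial unit field.\<close>

definition g :: "'b \<Rightarrow> real" where
  "g w = (if norm (w - a) \<le> r then ((norm (w - a))\<^sup>2 + r\<^sup>2) / (2 * r) else norm (w - a))"

lemma g_deriv: "(g has_derivative (\<lambda>\<xi>. ((w - a) \<bullet> \<xi>) / m w)) (at w)"
proof -
  \<comment> \<open>The excess of the inner quadratic over the norm, as a function of the squared
    distance beyond \<open>r\<^sup>2\<close>. Value and slope both vanish at \<open>0\<close>, so
    subtracting it outside the ball keeps \<open>g\<close> differentiable.\<close>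
  let ?k = "\<lambda>y. (y + 2 * r\<^sup>2) / (2 * r) - sqrt (y + r\<^sup>2)"
  let ?z = "\<lambda>w. max 0 ((w - a) \<bullet> (w - a) - r\<^sup>2)"
  have k: "(?k has_real_derivative 1 / (2 * r) - 1 / (2 * sqrt (s + r\<^sup>2))) (at s)" if "0 \<le> s" for s
  proof -
    have "((\<lambda>y. (y + 2 * r\<^sup>2) / (2 * r)) has_real_derivative 1 / (2 * r)) (at s)"
      using r_pos by (auto intro!: derivative_eq_intros)
    from DERIV_diff[OF this sqrt_shift_deriv[OF that]] show ?thesis .
  qed
  have 1: "((\<lambda>w. ?k (?z w)) has_derivative (\<lambda>\<xi>. (1 / (2 * r) - 1 / (2 * sqrt (?z w + r\<^sup>2))) * (2 * ((w - a) \<bullet> \<xi>)))) (at w)"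
    by (rule radial_deriv[OF k]) (use r_pos in simp_all)
  have 2: "((\<lambda>w. ((w - a) \<bullet> (w - a) + r\<^sup>2) / (2 * r)) has_derivative (\<lambda>\<xi>. ((w - a) \<bullet> \<xi>) / r)) (at w)"
    using r_pos by (auto intro!: derivative_eq_intros simp: inner_commute)
  have eq: "g = (\<lambda>w. ((w - a) \<bullet> (w - a) + r\<^sup>2) / (2 * r) - ?k (?z w))"
  proof
    fix w
    show "g w = ((w - a) \<bullet> (w - a) + r\<^sup>2) / (2 * r) - ?k (?z w)"
    proof (cases "norm (w - a) \<le> r")
      case True
      then have "(w - a) \<bullet> (w - a) \<le> r\<^sup>2" by (simp add: power2_norm_eq_inner[symmetric] power_mono)
      then have "?z w = 0" by (simp add: max_absorb1)
      moreover have "?k 0 = 0" using r_pos by (simp add: power2_eq_square)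
      ultimately show ?thesis using True by (simp add: g_def power2_norm_eq_inner)
    next
      case False
      then have "r\<^sup>2 \<le> (w - a) \<bullet> (w - a)" using r_pos by (simp add: power2_norm_eq_inner[symmetric] power_mono)
      then show ?thesis using False r_pos by (simp add: g_def max_absorb2 norm_eq_sqrt_inner)
    qed
  qed
  have "(g has_derivative (\<lambda>\<xi>. ((w - a) \<bullet> \<xi>) / r - (1 / (2 * r) - 1 / (2 * m w)) * (2 * ((w - a) \<bullet> \<xi>)))) (at w)"
    unfolding eq m_def max_norm_eq_sqrt[OF r_pos, symmetric] by (rule has_derivative_diff[OF 2 1])
  then show ?thesis using r_pos m_pos[of w] by (simp add: field_simps)
qed

lemma g_ge: "norm (w - a) \<le> g w" "r / 2 \<le> g w"
proof -
  have "2 * r * norm (w - a) \<le> (norm (w - a))\<^sup>2 + r\<^sup>2"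
    using zero_le_power2[of "norm (w - a) - r"] by (simp add: power2_eq_square algebra_simps)
  then show "norm (w - a) \<le> g w" using r_pos by (simp add: g_def field_simps)
  show "r / 2 \<le> g w" using r_pos by (auto simp: g_def field_simps power2_eq_square)
qed

lemma g_pos: "0 < g w" using g_ge(2)[of w] r_pos by linarith

definition N :: "'b \<Rightarrow> 'b" where "N w = (1 / g w) *\<^sub>R (w - a)"

definition N' :: "'b \<Rightarrow> 'b \<Rightarrow> 'b" where
  "N' w \<xi> = (1 / g w) *\<^sub>R \<xi> - (((w - a) \<bullet> \<xi>) / m w / (g w)\<^sup>2) *\<^sub>R (w - a)"

lemma norm_N: "norm (N w) \<le> 1"
  using g_ge(1)[of w] g_pos[of w] by (simp add: N_def)

lemma inner_div_m: "\<bar>((w - a) \<bullet> \<xi>) / m w\<bar> \<le> norm \<xi>"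
proof -
  have "\<bar>(w - a) \<bullet> \<xi>\<bar> \<le> norm (w - a) * norm \<xi>" by (rule Cauchy_Schwarz_ineq2)
  also have "\<dots> \<le> m w * norm \<xi>" using m_ge(2) by (intro mult_right_mono) auto
  finally show ?thesis using m_pos[of w] by (simp add: abs_divide field_simps)
qed

text \<open>From \<open>g w \<ge> r / 2\<close> each of the two terms of \<open>N'\<close> is at
  most \<open>2 / r * norm \<xi>\<close>. The extra \<open>1\<close> in the constant lets it bound
  \<open>N\<close> too, as \<open>bounded_C1_product\<close> wants a single constant.\<close>

lemma N_C1: "bounded_C1 N N' (4 / r + 1)"
proof
  fix w
  have "((\<lambda>w. (1 / g w) *\<^sub>R (w - a)) has_derivative
     (\<lambda>\<xi>. (1 / g w) *\<^sub>R \<xi> + (- (((w - a) \<bullet> \<xi>) / m w) / (g w)\<^sup>2) *\<^sub>R (w - a))) (at w)"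
    using g_pos[of w] by (auto intro!: derivative_eq_intros g_deriv simp: power2_eq_square)
  then show "(N has_derivative N' w) (at w)"
    unfolding N_def[abs_def] N'_def by simp
next
  fix \<xi>
  have "continuous_on UNIV g"
    using g_deriv by (auto intro!: continuous_at_imp_continuous_on has_derivative_continuous)
  then show "continuous_on UNIV (\<lambda>w. N' w \<xi>)"
    unfolding N'_def using g_pos m_pos
    by (intro continuous_intros m_cont) (auto simp: less_imp_neq[THEN not_sym])
next
  fix w \<xi>
  have "norm (N' w \<xi>) \<le> norm \<xi> / g w + (\<bar>((w - a) \<bullet> \<xi>) / m w\<bar> / g w) * (norm (w - a) / g w)"
    unfolding N'_def using g_pos[of w]
    by (intro order_trans[OF norm_triangle_ineq4] add_mono) (auto simp: power2_eq_square abs_mult)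
  also have "\<dots> \<le> norm \<xi> / g w + (norm \<xi> / g w) * 1"
    using inner_div_m[of w \<xi>] g_ge(1)[of w] g_pos[of w] by (intro add_left_mono mult_mono divide_right_mono) auto
  also have "\<dots> \<le> 4 / r * norm \<xi>"
  proof -
    have "1 / g w \<le> 2 / r" using g_ge(2)[of w] g_pos[of w] r_pos by (simp add: field_simps)
    from mult_right_mono[OF this norm_ge_zero[of \<xi>]] show ?thesis by simp
  qed
  also have "\<dots> \<le> (4 / r + 1) * norm \<xi>" by (simp add: algebra_simps)
  finally show "norm (N' w \<xi>) \<le> (4 / r + 1) * norm \<xi>" .
qed

end

context radial
begin

lemma comp_m_C1:
  assumes T: "\<And>t. (T has_real_derivative T' t) (at t)" "continuous_on UNIV T'" "\<And>t. \<bar>T' t\<bar> \<le> C" "T' 0 = 0"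
  shows "bounded_C1 (\<lambda>w. T (m w - r)) (\<lambda>w \<xi>. T' (m w - r) / m w * ((w - a) \<bullet> \<xi>)) C"
proof
  show "((\<lambda>w. T (m w - r)) has_derivative (\<lambda>\<xi>. T' (m w - r) / m w * ((w - a) \<bullet> \<xi>))) (at w)" for w
    by (rule comp_m_deriv[OF T(1,4)])
  show "continuous_on UNIV (\<lambda>w. T' (m w - r) / m w * ((w - a) \<bullet> \<xi>))" for \<xi>
    using m_pos by (intro continuous_intros continuous_on_compose2[OF T(2)] m_cont subset_UNIV)
      (auto simp: less_imp_neq[THEN not_sym])
  show "norm (T' (m w - r) / m w * ((w - a) \<bullet> \<xi>)) \<le> C * norm \<xi>" for w \<xi>
  proof -
    have "norm (T' (m w - r) / m w * ((w - a) \<bullet> \<xi>)) = \<bar>T' (m w - r)\<bar> * \<bar>((w - a) \<bullet> \<xi>) / m w\<bar>"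
      by (simp add: abs_mult)
    also have "\<dots> \<le> C * norm \<xi>"
      by (intro mult_mono T(3) inner_div_m) (use T(3)[of 0] in auto)
    finally show ?thesis .
  qed
qed

text \<open>The comparison map \<open>P\<close> of the overview, written as a correction of the
  identity so that it is visibly \<open>u\<close> plus a variation.\<close>

definition retract :: "(real \<Rightarrow> real) \<Rightarrow> 'b \<Rightarrow> 'b" where
  "retract T w = w - T (m w - r) *\<^sub>R N w"

definition retract' :: "(real \<Rightarrow> real) \<Rightarrow> (real \<Rightarrow> real) \<Rightarrow> 'b \<Rightarrow> 'b \<Rightarrow> 'b" where
  "retract' T T' w \<xi> = \<xi> - (T (m w - r) *\<^sub>R N' w \<xi> + (T' (m w - r) / m w * ((w - a) \<bullet> \<xi>)) *\<^sub>R N w)"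

lemma retract_C1:
  assumes T: "\<And>t. (T has_real_derivative T' t) (at t)" "continuous_on UNIV T'" "\<And>t. \<bar>T t\<bar> \<le> C" "\<And>t. \<bar>T' t\<bar> \<le> C" "T' 0 = 0"
  shows "bounded_C1 (retract T) (retract' T T') (1 + (C * (4 / r + 1) + C))"
proof -
  interpret S: bounded_C1 "\<lambda>w. T (m w - r)" "\<lambda>w \<xi>. T' (m w - r) / m w * ((w - a) \<bullet> \<xi>)" C
    by (rule comp_m_C1[OF T(1,2,4,5)])
  interpret N: bounded_C1 N N' "4 / r + 1" by (rule N_C1)
  show ?thesis
  proof
    show "(retract T has_derivative retract' T T' w) (at w)" for w
      unfolding retract_def[abs_def] retract'_def
      by (intro has_derivative_diff has_derivative_ident has_derivative_scaleR S.deriv N.deriv)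
    show "continuous_on UNIV (\<lambda>w. retract' T T' w \<xi>)" for \<xi>
      unfolding retract'_def by (intro continuous_intros S.F_cont N.F_cont N.deriv_cont S.deriv_cont)
    fix w \<xi>
    have "norm (retract' T T' w \<xi>) \<le> norm \<xi> + (\<bar>T (m w - r)\<bar> * norm (N' w \<xi>) + norm (T' (m w - r) / m w * ((w - a) \<bullet> \<xi>)) * norm (N w))"
      unfolding retract'_def
      by (rule order_trans[OF norm_triangle_ineq4 add_left_mono[OF order_trans[OF norm_triangle_ineq]]]) simp
    also have "\<dots> \<le> norm \<xi> + (C * ((4 / r + 1) * norm \<xi>) + (C * norm \<xi>) * 1)"
      using T(3)[of 0] by (intro add_left_mono add_mono mult_mono T(3) N.deriv_bound S.deriv_bound norm_N) auto
    finally show "norm (retract' T T' w \<xi>) \<le> (1 + (C * (4 / r + 1) + C)) * norm \<xi>" by (simp add: algebra_simps)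
  qed
qed

lemma retract_outside:
  assumes "r < norm (w - a)"
  shows "retract T w = a + ((norm (w - a) - T (norm (w - a) - r)) / norm (w - a)) *\<^sub>R (w - a)"
proof -
  have "m w = norm (w - a)" "g w = norm (w - a)" using assms by (auto simp: m_def g_def)
  moreover have "norm (w - a) > 0" using assms r_pos by linarith
  ultimately show ?thesis by (simp add: retract_def N_def diff_divide_distrib scaleR_diff_left)
qed

lemma retract_inside:
  assumes "norm (w - a) \<le> r" "T 0 = 0" "T' 0 = 0"
  shows "retract T w = w" "retract' T T' w \<xi> = \<xi>"
  using assms by (auto simp: retract_def retract'_def m_def max_def)

text \<open>Split \<open>\<xi>\<close> into its radial part and the part orthogonal to \<open>w - a\<close>: the derivative scales the
  former by \<open>1 - T'\<close> and the latter by \<open>1 - T / norm (w - a)\<close>.\<close>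

lemma retract_contraction:
  fixes T T' :: "real \<Rightarrow> real"
  assumes w: "r < norm (w - a)" and T: "0 \<le> T (norm (w - a) - r)" "T (norm (w - a) - r) \<le> norm (w - a)"
  defines "d \<equiv> T' (norm (w - a) - r)"
  shows "(norm (retract' T T' w \<xi>))\<^sup>2 + d * (2 - d) * (((w - a) \<bullet> \<xi>) / norm (w - a))\<^sup>2 \<le> (norm \<xi>)\<^sup>2"
proof -
  define s where "s = norm (w - a)"
  have s: "s > 0" using less_trans[OF r_pos w] by (simp only: s_def)
  define e where "e = (1 / s) *\<^sub>R (w - a)"
  have ee: "e \<bullet> e = 1" using s by (simp add: e_def s_def dot_square_norm power2_eq_square)
  define c where "c = e \<bullet> \<xi>"
  define \<eta> where "\<eta> = \<xi> - c *\<^sub>R e"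
  have \<eta>e: "e \<bullet> \<eta> = 0" using ee by (simp add: \<eta>_def c_def inner_diff_right)
  have \<xi>: "\<xi> = \<eta> + c *\<^sub>R e" by (simp add: \<eta>_def)
  have n2: "(norm (x *\<^sub>R \<eta> + y *\<^sub>R e))\<^sup>2 = x\<^sup>2 * (norm \<eta>)\<^sup>2 + y\<^sup>2" for x y
    unfolding power2_norm_eq_inner using \<eta>e ee by (simp add: inner_add_left inner_add_right inner_commute[of \<eta> e] power2_eq_square)
  define k where "k = T (s - r) / s"
  have k: "0 \<le> k" "k \<le> 1" using T s by (auto simp: k_def s_def)
  have wa: "w - a = s *\<^sub>R e" using s by (simp add: e_def)
  have mg: "m w = s" "g w = s" using w by (auto simp: m_def g_def s_def)
  have c': "(w - a) \<bullet> \<xi> = s * c" by (simp add: wa c_def)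
  have "retract' T T' w \<xi> = (1 - k) *\<^sub>R \<eta> + ((1 - d) * c) *\<^sub>R e"
  proof -
    \<comment> \<open>The unit field is constant along rays, so its derivative annihilates the
      radial part of \<open>\<xi>\<close> and divides the tangential part by the distance.\<close>
    have "N' w \<xi> = (1 / s) *\<^sub>R \<eta>"
      unfolding N'_def mg c' unfolding wa using s by (simp add: \<eta>_def scaleR_diff_right power2_eq_square)
    moreover have "N w = e" unfolding N_def mg e_def ..
    ultimately have "retract' T T' w \<xi> = \<xi> - (k *\<^sub>R \<eta> + (d * c) *\<^sub>R e)"
      unfolding retract'_def mg c' using s by (simp add: k_def d_def s_def)
    also have "\<dots> = (1 - k) *\<^sub>R \<eta> + ((1 - d) * c) *\<^sub>R e"
      by (subst \<xi>) (simp add: algebra_simps)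
    finally show ?thesis .
  qed
  then have "(norm (retract' T T' w \<xi>))\<^sup>2 = (1 - k)\<^sup>2 * (norm \<eta>)\<^sup>2 + ((1 - d) * c)\<^sup>2" by (simp add: n2)
  moreover have "(norm \<xi>)\<^sup>2 = (norm \<eta>)\<^sup>2 + c\<^sup>2" using n2[of 1 c] \<xi> by simp
  moreover have "(1 - k)\<^sup>2 * (norm \<eta>)\<^sup>2 \<le> 1 * (norm \<eta>)\<^sup>2"
    using k by (intro mult_right_mono) (auto simp: power_le_one)
  moreover have "((w - a) \<bullet> \<xi>) / norm (w - a) = c" unfolding c' using s by (simp add: s_def)
  \<comment> \<open>\<open>d * (2 - d)\<close> equals \<open>1 - (1 - d)\<^sup>2\<close>, the share
    of the radial part that is lost.\<close>
  moreover have "((1 - d) * c)\<^sup>2 + d * (2 - d) * c\<^sup>2 = c\<^sup>2" by (simp add: power2_eq_square algebra_simps)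
  ultimately show ?thesis by simp
qed

end

subsection \<open>The maximum principle\<close>

text \<open>Rests on \<open>t \<le> c + 1 / c * t\<^sup>2\<close>: on a space of finite measure the
  constant contributes at most \<open>e / 2\<close> for small \<open>c\<close>, and the square is
  then eventually small enough for the other half.\<close>

lemma L2_null_imp_L1_null:
  fixes f :: "nat \<Rightarrow> 'a \<Rightarrow> 'b::euclidean_space"
  assumes M: "finite_measure M" and [measurable]: "\<And>k. f k \<in> borel_measurable M"
    and lim: "(\<lambda>k. \<integral>\<^sup>+x. ennreal ((norm (f k x))\<^sup>2) \<partial>M) \<longlonglongrightarrow> 0"
  shows "(\<lambda>k. \<integral>\<^sup>+x. ennreal (norm (f k x)) \<partial>M) \<longlonglongrightarrow> 0"
proof (rule tendsto_0_if_le)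
  interpret finite_measure M by (rule M)
  fix e :: real assume e: "e > 0"
  define \<mu> where "\<mu> = measure M (space M)"
  define c where "c = e / (2 * (\<mu> + 1))"
  have \<mu>: "\<mu> \<ge> 0" by (simp add: \<mu>_def)
  have c: "c > 0" using e \<mu> by (simp add: c_def)
  have "\<forall>\<^sub>F k in sequentially. (\<integral>\<^sup>+x. ennreal ((norm (f k x))\<^sup>2) \<partial>M) < ennreal (c * e / 2)"
    by (rule order_tendstoD(2)[OF lim]) (use c e in simp)
  then show "\<forall>\<^sub>F k in sequentially. (\<integral>\<^sup>+x. ennreal (norm (f k x)) \<partial>M) \<le> ennreal e"
  proof eventually_elim
    case (elim k)
    have "t \<le> c + 1 / c * t\<^sup>2" if "0 \<le> t" for t :: real
    proof (cases "t \<le> c")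
      case True then show ?thesis using c by (simp add: add_increasing2)
    next
      case False
      then have "c * t \<le> t * t" using that by (intro mult_right_mono) auto
      then have "t \<le> 1 / c * t\<^sup>2" using c by (simp add: field_simps power2_eq_square)
      then show ?thesis using c by simp
    qed
    then have "(\<integral>\<^sup>+x. ennreal (norm (f k x)) \<partial>M) \<le> (\<integral>\<^sup>+x. ennreal c + ennreal (1 / c) * ennreal ((norm (f k x))\<^sup>2) \<partial>M)"
      using c by (intro nn_integral_mono) (simp add: ennreal_leI flip: ennreal_mult ennreal_plus)
    also have "\<dots> = ennreal c * emeasure M (space M) + ennreal (1 / c) * (\<integral>\<^sup>+x. ennreal ((norm (f k x))\<^sup>2) \<partial>M)"
      by (subst nn_integral_add) (auto simp: nn_integral_cmult)
    also have "\<dots> \<le> ennreal c * ennreal \<mu> + ennreal (1 / c) * ennreal (c * e / 2)"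
      using elim by (intro add_mono mult_left_mono) (auto simp: \<mu>_def emeasure_eq_measure)
    also have "\<dots> = ennreal (c * \<mu> + e / 2)" using c \<mu> e by (simp flip: ennreal_mult ennreal_plus)
    also have "\<dots> \<le> ennreal e"
      using e \<mu> by (intro ennreal_leI) (simp add: c_def field_simps)
    finally show ?case .
  qed
qed

text \<open>Since \<open>\<partial>\<^sub>i x\<^sub>i = 1\<close>, integration by parts against the coordinate function expresses the integral
  of a test function through its gradient.\<close>

lemma sobolev_W12_0_zero_gradient:
  fixes w :: "real^'n::finite \<Rightarrow> real"
  assumes \<Omega>: "open \<Omega>" "bounded \<Omega>" and w: "sobolev_W12_0 \<Omega> w" and H: "weak_gradient \<Omega> w H"
    and H0: "AE x in lebesgue_on \<Omega>. H x = 0"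
  shows "integrable (lebesgue_on \<Omega>) w" "integral\<^sup>L (lebesgue_on \<Omega>) w = 0"
proof -
  note fin = bounded_open_finite_measure[OF \<Omega>]
  have \<Omega>L: "\<Omega> \<in> sets lebesgue" using \<Omega> by simp
  obtain G \<phi> where G: "sobolev_pair \<Omega> w G" and \<phi>: "\<And>k. test_fun \<Omega> (\<phi> k)"
    and lim: "(\<lambda>k. \<integral>\<^sup>+x. ennreal ((norm (\<phi> k x - w x))\<^sup>2) \<partial>lebesgue_on \<Omega>) \<longlonglongrightarrow> 0"
    "\<And>i. (\<lambda>k. \<integral>\<^sup>+x. ennreal ((norm (partial_deriv i (\<phi> k) x - G x $ i))\<^sup>2) \<partial>lebesgue_on \<Omega>) \<longlonglongrightarrow> 0"
    by (rule sobolev_W12_0_approximation[OF \<Omega> w]) (rule that)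
  have wi: "integrable (lebesgue_on \<Omega>) w" and Gi: "integrable (lebesgue_on \<Omega>) (\<lambda>x. G x $ i)" for i
    using G by (auto simp: sobolev_pair_def)
  show "integrable (lebesgue_on \<Omega>) w" by (rule wi)
  have G0: "AE x in lebesgue_on \<Omega>. G x = 0"
    using weak_gradient_unique[OF \<Omega>(1) H, of G] G H0 by (auto simp: sobolev_pair_def elim: eventually_elim2)
  have \<phi>i: "integrable (lebesgue_on \<Omega>) (\<phi> k)" "integrable (lebesgue_on \<Omega>) (partial_deriv i (\<phi> k))" for k i
    using test_fun_sobolev_pair[OF \<Omega>(1) \<phi>[of k]] by (auto simp: sobolev_pair_def)
  note m [measurable] = wi[THEN borel_measurable_integrable] Gi[THEN borel_measurable_integrable]
    \<phi>i(1)[THEN borel_measurable_integrable] \<phi>i(2)[THEN borel_measurable_integrable]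
  fix i :: 'n
  obtain R where R: "\<And>x. x \<in> \<Omega> \<Longrightarrow> norm x \<le> R" using \<Omega>(2) by (auto simp: bounded_iff)
  \<comment> \<open>The coordinate function, cut off to the bounded set \<open>\<Omega>\<close> so
    that it is a bounded weight under which the \<open>L1\<close> limits of the gradients
    pass.\<close>
  define b where "b x = indicator \<Omega> x * x $ i" for x :: "real^'n"
  have b: "\<bar>b x\<bar> \<le> \<bar>R\<bar>" for x
    using R[of x] component_le_norm_cart[of x i] by (cases "x \<in> \<Omega>") (auto simp: b_def)
  have [measurable]: "b \<in> borel_measurable (lebesgue_on \<Omega>)"
  proof -
    have "(\<lambda>x::real^'n. x $ i) \<in> borel_measurable lebesgue" by (rule measurable_completion) simp
    then have "(\<lambda>x::real^'n. x $ i) \<in> borel_measurable (lebesgue_on \<Omega>)" by (rule measurable_restrict_space1)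
    then show ?thesis by (subst measurable_lebesgue_cong[where g = "\<lambda>x. x $ i"]) (auto simp: b_def)
  qed
  have bi: "integrable (lebesgue_on \<Omega>) (\<lambda>x. b x *\<^sub>R f x)" if f: "integrable (lebesgue_on \<Omega>) f" for f :: "real^'n \<Rightarrow> real"
  proof (rule Bochner_Integration.integrable_bound)
    show "integrable (lebesgue_on \<Omega>) (\<lambda>x. \<bar>R\<bar> * f x)" using f by simp
    note [measurable] = borel_measurable_integrable[OF f]
    show "(\<lambda>x. b x *\<^sub>R f x) \<in> borel_measurable (lebesgue_on \<Omega>)" by measurable
    show "AE x in lebesgue_on \<Omega>. norm (b x *\<^sub>R f x) \<le> norm (\<bar>R\<bar> * f x)"
      using b by (auto simp: abs_mult intro!: mult_right_mono)
  qed
  have l1: "(\<lambda>k. integral\<^sup>L (lebesgue_on \<Omega>) (\<phi> k)) \<longlonglongrightarrow> integral\<^sup>L (lebesgue_on \<Omega>) w"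
    by (rule tendsto_L1_int[OF \<phi>i(1) wi L2_null_imp_L1_null[OF fin _ lim(1)]]) measurable
  have l2: "(\<lambda>k. integral\<^sup>L (lebesgue_on \<Omega>) (\<lambda>x. b x *\<^sub>R partial_deriv i (\<phi> k) x)) \<longlonglongrightarrow>
    integral\<^sup>L (lebesgue_on \<Omega>) (\<lambda>x. b x *\<^sub>R G x $ i)"
    by (rule bounded_scaleR_L1_limit[OF b m(4) m(2) _ L2_null_imp_L1_null[OF fin _ lim(2)] bi[OF \<phi>i(2)] bi[OF Gi]]) measurable
  have "integral\<^sup>L (lebesgue_on \<Omega>) (\<lambda>x. b x *\<^sub>R G x $ i) = integral\<^sup>L (lebesgue_on \<Omega>) (\<lambda>x. 0::real)"
    by (rule integral_cong_AE) (use G0 in \<open>auto elim: eventually_mono\<close>)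
  then have l2': "(\<lambda>k. integral\<^sup>L (lebesgue_on \<Omega>) (\<lambda>x. b x *\<^sub>R partial_deriv i (\<phi> k) x)) \<longlonglongrightarrow> 0" using l2 by simp
  have parts: "integral\<^sup>L (lebesgue_on \<Omega>) (\<phi> k) = - integral\<^sup>L (lebesgue_on \<Omega>) (\<lambda>x. b x *\<^sub>R partial_deriv i (\<phi> k) x)" for k
  proof -
    obtain K where K: "compact K" "K \<subseteq> \<Omega>" "\<And>x. x \<notin> K \<Longrightarrow> \<phi> k x = 0" "\<And>x i. x \<notin> K \<Longrightarrow> partial_deriv i (\<phi> k) x = 0"
      by (rule test_funE[OF \<phi>[of k]]) (rule that)
    have sm: "smooth_fun (\<phi> k)" using \<phi>[of k] by (simp add: test_fun_def)
    have c: "continuous_on UNIV (\<phi> k)" "continuous_on UNIV (partial_deriv i (\<phi> k))"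
      by (intro smooth_fun_continuous smooth_fun_partial sm)+
    obtain d where d: "\<And>x. x \<in> K \<Longrightarrow> norm x \<le> d" using compact_imp_bounded[OF K(1)] by (auto simp: bounded_iff)
    have out: "x \<notin> K" if "d + 1 \<le> norm x" for x using d[of x] that by fastforce
    have eq: "integral\<^sup>L lebesgue (\<lambda>x. axis i 1 $ i *\<^sub>R \<phi> k x)
      = - integral\<^sup>L lebesgue (\<lambda>x. x $ i *\<^sub>R (\<Sum>j\<in>UNIV. axis i 1 $ j *\<^sub>R partial_deriv j (\<phi> k) x))"
    proof (rule integration_by_parts[where d = "d + 1"])
      show "((\<lambda>x. x $ i) has_derivative (\<lambda>h. h $ i)) (at x)"
        and "(\<phi> k has_derivative (\<lambda>h. \<Sum>j\<in>UNIV. h $ j *\<^sub>R partial_deriv j (\<phi> k) x)) (at x)" for x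
        by (intro has_derivative_partials smooth_fun_differentiable sm bounded_linear_imp_has_derivative bounded_linear_vec_nth)+
    qed (use c K(3,4)[OF out] in \<open>auto simp: sum_axis simp del: real_scaleR_def\<close>)
    have "zero_ext \<Omega> (\<phi> k) x = \<phi> k x" for x using K(2,3) by (cases "x \<in> K") (auto simp: zero_ext_def)
    moreover have "zero_ext \<Omega> (\<lambda>x. b x *\<^sub>R partial_deriv i (\<phi> k) x) x = x $ i * partial_deriv i (\<phi> k) x" for x
      using K(2,4) by (cases "x \<in> K") (auto simp: zero_ext_def b_def)
    ultimately show ?thesis
      using eq[unfolded sum_axis] by (simp add: axis_def[of i] lebesgue_on_zero_ext[OF \<Omega>L] cong: Bochner_Integration.integral_cong)
  qed
  \<comment> \<open>Only the mean of \<open>w\<close> is obtained. This is enough for the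
    nonnegative function to which it will be applied.\<close>
  show "integral\<^sup>L (lebesgue_on \<Omega>) w = 0"
    using LIMSEQ_unique[OF l1] tendsto_minus[OF l2'] unfolding parts[symmetric] by simp
qed

lemma energy_eq:
  fixes v :: "real^'n::finite \<Rightarrow> 'b::euclidean_space"
  assumes "open \<Omega>" "weak_gradient \<Omega> v G"
  shows "energy W \<Omega> v = (\<integral>\<^sup>+x. ennreal (1 / 2 * (norm (G x))\<^sup>2 + W (v x)) \<partial>lebesgue_on \<Omega>)"
proof -
  have "weak_gradient \<Omega> v (sobolev_grad \<Omega> v)" unfolding sobolev_grad_def by (rule someI[of "weak_gradient \<Omega> v", OF assms(2)])
  from weak_gradient_unique[OF assms(1) this assms(2)]
  show ?thesis unfolding energy_def by (intro nn_integral_cong_AE) (auto elim: eventually_mono)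
qed

lemma C11_loc_continuous: "C11_loc W \<Longrightarrow> continuous_on UNIV W"
  unfolding C11_loc_def by (meson continuous_at_imp_continuous_on has_derivative_continuous)

theorem theoremB2:
  fixes W :: "real^'m \<Rightarrow> real" and a :: "real^'m" and r0 r :: real
    and \<Omega> :: "(real^'n) set" and u :: "real^'n \<Rightarrow> real^'m"
  assumes W_reg: "C11_loc W"
    and W_nonneg: "\<And>v. W v \<ge> 0"
    and W_a: "W a = 0"
    and r0_pos: "r0 > 0"
    and W_mono: "\<And>\<nu>. norm \<nu> = 1 \<Longrightarrow> mono_on {0<..r0} (\<lambda>s. W (a + s *\<^sub>R \<nu>))"
    and W_pos: "\<And>v. norm (v - a) < 2 * r0 \<Longrightarrow> v \<noteq> a \<Longrightarrow> W v > 0"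
    and \<Omega>_open: "open \<Omega>" and \<Omega>_conn: "connected \<Omega>" and \<Omega>_bdd: "bounded \<Omega>"
    and \<Omega>_lip: "lipschitz_boundary \<Omega>"
    and u_sob: "sobolev_W12 \<Omega> u" and u_inf: "L_infty \<Omega> u"
    and u_min: "\<And>\<phi>. sobolev_W12_0 \<Omega> \<phi> \<Longrightarrow> L_infty \<Omega> \<phi> \<Longrightarrow>
                  energy W \<Omega> u \<le> energy W \<Omega> (\<lambda>x. u x + \<phi> x)"
    and r_pos: "0 < r" and r_small: "r < r0 / 2"
    and bdry: "sobolev_W12_0 \<Omega> (\<lambda>x. max 0 (norm (u x - a) - r))"
  shows "AE x in lebesgue_on \<Omega>. norm (u x - a) \<le> r"
proof -
  note fin = bounded_open_finite_measure[OF \<Omega>_open \<Omega>_bdd]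
  interpret finite_measure "lebesgue_on \<Omega>" by (rule fin)
  obtain G where G: "sobolev_pair \<Omega> u G"
    using u_sob sobolev_W12_iff_pair[OF \<Omega>_open \<Omega>_bdd] by blast
  have wG: "weak_gradient \<Omega> u G" using G by (simp add: sobolev_pair_def)
  have um [measurable]: "u \<in> borel_measurable (lebesgue_on \<Omega>)"
    and Gm [measurable]: "(\<lambda>x. G x $ i) \<in> borel_measurable (lebesgue_on \<Omega>)" for i
    using G borel_measurable_integrable by (auto simp: sobolev_pair_def)
  obtain Cu where Cu: "AE x in lebesgue_on \<Omega>. norm (u x) \<le> Cu" using u_inf by (auto simp: L_infty_def)
  \<comment> \<open>An almost everywhere bound for \<open>norm (u x - a)\<close>; the summand
    \<open>r0\<close> makes it positive.\<close>
  define M where "M = \<bar>Cu\<bar> + norm a + r0"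
  have M: "0 < M" using r0_pos by (simp add: M_def add_nonneg_pos)
  have uM: "AE x in lebesgue_on \<Omega>. norm (u x - a) \<le> M"
    using Cu
  proof eventually_elim
    case (elim x)
    then show ?case using norm_triangle_ineq4[of "u x" a] r0_pos by (simp add: M_def)
  qed
  obtain T T' C where T: "\<And>t. (T has_real_derivative T' t) (at t)" "continuous_on UNIV T'"
    "\<And>t. \<bar>T t\<bar> \<le> C" "\<And>t. \<bar>T' t\<bar> \<le> C" "T 0 = 0" "T' 0 = 0"
    and T1: "\<And>t. 0 < t \<Longrightarrow> t \<le> M \<Longrightarrow> 0 < T t \<and> T t \<le> t + r \<and> 0 < T' t \<and> T' t < 2"
    and T2: "\<And>t. r0 - r \<le> t \<Longrightarrow> t \<le> M \<Longrightarrow> T t = t + r"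
    by (rule truncated_profile[OF r_pos r_small M]) (rule that)
  interpret R: radial a r by standard (rule r_pos)
  interpret P: bounded_C1 "R.retract T" "R.retract' T T'" "1 + (C * (4 / r + 1) + C)"
    by (rule R.retract_C1[OF T(1-4,6)])
  interpret S: bounded_C1 "\<lambda>w. T (R.m w - r)" "\<lambda>w \<xi>. T' (R.m w - r) / R.m w * ((w - a) \<bullet> \<xi>)" C
    by (rule R.comp_m_C1[OF T(1,2,4,6)])
  let ?v = "\<lambda>x. max 0 (norm (u x - a) - r)"
  have v_eq: "?v x = R.m (u x) - r" for x by (simp add: R.m_def max_def)

  \<comment> \<open>Since \<open>?v x = R.m (u x) - r\<close>, adding this to \<open>u\<close> gives
    exactly the retraction, while \<open>\<phi>\<close> is a product with a factor
    \<open>T v\<close> to which \<open>bdry\<close> applies.\<close>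
  define \<phi> where "\<phi> x = - T (?v x) *\<^sub>R R.N (u x)" for x
  have u\<phi>: "u x + \<phi> x = R.retract T (u x)" for x unfolding \<phi>_def R.retract_def v_eq by simp
  have N_C1: "bounded_C1 R.N R.N' (4 / r + 1)" by (rule R.N_C1)
  have "norm (R.N w) \<le> 4 / r + 1" for w using R.norm_N[of w] r_pos by (simp add: add_increasing)
  then have "sobolev_W12_0 \<Omega> (\<lambda>x. (\<lambda>t. - T t) (?v x) *\<^sub>R R.N (u x))"
    using T by (intro sobolev_W12_0_product[OF \<Omega>_open \<Omega>_bdd bdry G _ _ _ _ _ _ N_C1, where T' = "\<lambda>t. - T' t" and C = C])
      (auto intro!: DERIV_minus continuous_intros)
  then have \<phi>W: "sobolev_W12_0 \<Omega> \<phi>" by (simp add: \<phi>_def[abs_def])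
  have \<phi>m: "\<phi> \<in> borel_measurable (lebesgue_on \<Omega>)"
    using \<phi>W by (simp add: sobolev_W12_0_def sobolev_W12_def)
  have "norm (\<phi> x) \<le> C" for x
  proof -
    have "norm (\<phi> x) = \<bar>T (?v x)\<bar> * norm (R.N (u x))" by (simp add: \<phi>_def)
    also have "\<dots> \<le> C * 1" using T(3)[of 0] by (intro mult_mono T(3) R.norm_N) auto
    finally show ?thesis by simp
  qed
  with \<phi>m have \<phi>L: "L_infty \<Omega> \<phi>" by (auto simp: L_infty_def)

  define H where "H x = (\<chi> i. R.retract' T T' (u x) (G x $ i))" for x
  have pairH: "sobolev_pair \<Omega> (\<lambda>x. R.retract T (u x)) H"
    unfolding H_def by (rule P.sobolev_pair_chain[OF \<Omega>_open \<Omega>_bdd G])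
  have [measurable]: "H \<in> borel_measurable (lebesgue_on \<Omega>)"
    using pairH borel_measurable_integrable by (subst borel_measurable_vec_iff) (auto simp: sobolev_pair_def)
  note [measurable] = P.F_measurable[OF um]
  let ?fu = "\<lambda>x. 1 / 2 * (norm (G x))\<^sup>2 + W (u x)"
  let ?fP = "\<lambda>x. 1 / 2 * (norm (H x))\<^sup>2 + W (R.retract T (u x))"
  have E_le: "(\<integral>\<^sup>+x. ennreal (?fu x) \<partial>lebesgue_on \<Omega>) \<le> (\<integral>\<^sup>+x. ennreal (?fP x) \<partial>lebesgue_on \<Omega>)"
    using u_min[OF \<phi>W \<phi>L] unfolding u\<phi> energy_eq[OF \<Omega>_open wG]
    using pairH energy_eq[OF \<Omega>_open, of "\<lambda>x. R.retract T (u x)" H W] by (simp add: sobolev_pair_def)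

  \<comment> \<open>The strict gain in the contraction estimate for one direction. Inside the ball
    the retraction is the identity and nothing is gained.\<close>
  define e where "e w \<xi> = (if r < norm (w - a)
    then T' (norm (w - a) - r) * (2 - T' (norm (w - a) - r)) * (((w - a) \<bullet> \<xi>) / norm (w - a))\<^sup>2 else 0)" for w \<xi>
  have e_nonneg: "0 \<le> e w \<xi>" if "norm (w - a) \<le> M" for w \<xi>
    using T1[of "norm (w - a) - r"] that r_pos by (auto simp: e_def)
  have contr: "(norm (R.retract' T T' w \<xi>))\<^sup>2 + e w \<xi> \<le> (norm \<xi>)\<^sup>2" if "norm (w - a) \<le> M" for w \<xi>
  proof (cases "r < norm (w - a)")
    case True
    have "0 < T (norm (w - a) - r) \<and> T (norm (w - a) - r) \<le> norm (w - a)"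
      using T1[of "norm (w - a) - r"] that True r_pos by simp
    then show ?thesis using R.retract_contraction[OF True, of T T' \<xi>] True by (simp add: e_def)
  next
    case False
    then show ?thesis using R.retract_inside(2)[of w T T' \<xi>] T(5,6) by (simp add: e_def)
  qed
  have W_le: "W (R.retract T w) \<le> W w" if wM: "norm (w - a) \<le> M" for w
  proof (cases "r < norm (w - a)")
    case False
    then show ?thesis using R.retract_inside(1)[of w T T'] T(5,6) by simp
  next
    case True
    define s where "s = norm (w - a)"
    define \<nu> where "\<nu> = (1 / s) *\<^sub>R (w - a)"
    have s: "0 < s" "r < s" "s \<le> M" using True r_pos wM by (auto simp: s_def intro: less_trans[OF r_pos])
    have \<nu>: "norm \<nu> = 1" using s by (simp add: \<nu>_def s_def)
    have w_eq: "w = a + s *\<^sub>R \<nu>" using s by (simp add: \<nu>_def)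
    define k where "k = s - T (s - r)"
    have Pw: "R.retract T w = a + k *\<^sub>R \<nu>" using R.retract_outside[OF True, of T] by (simp add: k_def \<nu>_def s_def)
    have k: "0 \<le> k" "k \<le> s" using T1[of "s - r"] s r_pos by (auto simp: k_def)
    show ?thesis
    \<comment> \<open>From distance \<open>r0\<close> on the retraction sends everything to
      \<open>a\<close>, where \<open>W\<close> is \<open>0\<close>. Otherwise \<open>k\<close> and
      \<open>s\<close> both lie in the interval on which \<open>W\<close> is monotone along the
      ray.\<close>
    proof (cases "k = 0 \<or> r0 \<le> s")
      case True
      then have "k = 0" using T2[of "s - r"] s r_pos by (auto simp: k_def)
      then show ?thesis using Pw W_a W_nonneg by simp
    next
      case False
      then have "W (a + k *\<^sub>R \<nu>) \<le> W (a + s *\<^sub>R \<nu>)"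
        using k by (intro mono_onD[OF W_mono[OF \<nu>]]) auto
      then show ?thesis using Pw w_eq by simp
    qed
  qed

  have gap: "AE x in lebesgue_on \<Omega>. ?fP x + 1 / 2 * (\<Sum>i\<in>UNIV. e (u x) (G x $ i)) \<le> ?fu x"
    using uM
  proof eventually_elim
    case (elim x)
    have "(\<Sum>i\<in>UNIV. (norm (H x $ i))\<^sup>2 + e (u x) (G x $ i)) \<le> (\<Sum>i\<in>UNIV. (norm (G x $ i))\<^sup>2)"
      unfolding H_def vec_lambda_beta by (intro sum_mono contr[OF elim])
    then show ?case using W_le[OF elim] by (simp add: norm_vec_squared sum.distrib)
  qed
  have Wc: "continuous_on UNIV W" by (rule C11_loc_continuous[OF W_reg])
  note [measurable] = borel_measurable_continuous_onI[OF Wc]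
  obtain CW where CW: "\<And>w. w \<in> cball a M \<Longrightarrow> W w \<le> CW"
    using compact_imp_bounded[OF compact_continuous_image[OF continuous_on_subset[OF Wc subset_UNIV] compact_cball[of a M]]]
    by (auto simp: bounded_iff) (metis abs_le_D1 mem_cball)
  \<comment> \<open>Finite energy: as \<open>u\<close> is bounded and \<open>W\<close> continuous,
    the potential term is integrable, so the energies can be subtracted as real integrals.\<close>
  have Wu: "integrable (lebesgue_on \<Omega>) (\<lambda>x. W (u x))"
  proof (rule Bochner_Integration.integrable_bound)
    show "integrable (lebesgue_on \<Omega>) (\<lambda>x. CW)" by simp
    show "(\<lambda>x. W (u x)) \<in> borel_measurable (lebesgue_on \<Omega>)" by measurable
    show "AE x in lebesgue_on \<Omega>. norm (W (u x)) \<le> norm CW"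
      using uM
    proof eventually_elim
      case (elim x)
      then have "W (u x) \<le> CW" by (intro CW) (simp add: dist_norm norm_minus_commute)
      then show ?case using W_nonneg[of "u x"] by simp
    qed
  qed
  have fu: "integrable (lebesgue_on \<Omega>) ?fu"
    using G Wu by (simp add: sobolev_pair_def norm_vec_squared[of "G _"])
  have fPm: "?fP \<in> borel_measurable (lebesgue_on \<Omega>)"
    by measurable
  have fP_le: "AE x in lebesgue_on \<Omega>. ?fP x \<le> ?fu x"
    using gap uM
  proof eventually_elim
    case (elim x)
    have "0 \<le> (\<Sum>i\<in>UNIV. e (u x) (G x $ i))" by (intro sum_nonneg e_nonneg elim(2))
    then show ?case using elim(1) by linarith
  qed
  have fP: "integrable (lebesgue_on \<Omega>) ?fP"
    by (rule Bochner_Integration.integrable_bound[OF fu fPm])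
       (use fP_le W_nonneg in \<open>auto elim!: eventually_mono intro!: add_nonneg_nonneg\<close>)
  have "integral\<^sup>L (lebesgue_on \<Omega>) ?fu \<le> integral\<^sup>L (lebesgue_on \<Omega>) ?fP"
  proof -
    have pos: "0 \<le> ?fu x" "0 \<le> ?fP x" for x by (simp_all add: W_nonneg)
    have "ennreal (integral\<^sup>L (lebesgue_on \<Omega>) ?fu) \<le> ennreal (integral\<^sup>L (lebesgue_on \<Omega>) ?fP)"
      using E_le nn_integral_eq_integral[OF fu AE_I2[OF pos(1)]] nn_integral_eq_integral[OF fP AE_I2[OF pos(2)]]
      by (simp only:)
    moreover have "0 \<le> integral\<^sup>L (lebesgue_on \<Omega>) ?fP"
      by (rule Bochner_Integration.integral_nonneg) (rule pos(2))
    ultimately show ?thesis by (simp only: ennreal_le_iff)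
  qed
  \<comment> \<open>Pointwise the retraction has the smaller density, by minimality the larger
    integral; so the densities agree almost everywhere.\<close>
  moreover have "0 \<le> integral\<^sup>L (lebesgue_on \<Omega>) (\<lambda>x. ?fu x - ?fP x)"
    by (rule integral_nonneg_AE) (use fP_le in \<open>auto elim!: eventually_mono\<close>)
  ultimately have "integral\<^sup>L (lebesgue_on \<Omega>) (\<lambda>x. ?fu x - ?fP x) = 0"
    using fu fP by simp
  then have eq: "AE x in lebesgue_on \<Omega>. ?fu x - ?fP x = 0"
    using fP_le fu fP by (subst (asm) integral_nonneg_eq_0_iff_AE) (auto elim!: eventually_mono)

  \<comment> \<open>Outside the ball \<open>0 < T' < 2\<close> makes the coefficient in
    \<open>e\<close> positive, so \<open>e = 0\<close> forces
    \<open>(u x - a) \<bullet> G x $ i = 0\<close>; inside, \<open>T' 0 = 0\<close> does the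
    rest.\<close>
  have S0: "AE x in lebesgue_on \<Omega>. (\<chi> i. T' (R.m (u x) - r) / R.m (u x) * ((u x - a) \<bullet> G x $ i)) = 0"
    using gap eq uM
  proof eventually_elim
    case (elim x)
    have "(\<Sum>i\<in>UNIV. e (u x) (G x $ i)) \<le> 0" using elim(1,2) by linarith
    then have "(\<Sum>i\<in>UNIV. e (u x) (G x $ i)) = 0"
      using sum_nonneg[of UNIV "\<lambda>i. e (u x) (G x $ i)"] e_nonneg[OF elim(3)] by fastforce
    then have e0: "e (u x) (G x $ i) = 0" for i
      using e_nonneg[OF elim(3)] by (simp add: sum_nonneg_eq_0_iff)
    have "T' (R.m (u x) - r) / R.m (u x) * ((u x - a) \<bullet> G x $ i) = 0" for i
    proof (cases "r < norm (u x - a)")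
      case True
      have "0 < T' (norm (u x - a) - r) \<and> T' (norm (u x - a) - r) < 2"
        using T1[of "norm (u x - a) - r"] True elim(3) r_pos by simp
      then show ?thesis using e0[of i] True by (auto simp: e_def)
    next
      case False
      then show ?thesis using T(6) by (simp add: R.m_def max_def)
    qed
    then show ?case by (simp add: vec_eq_iff)
  qed
  have const_C1: "bounded_C1 (\<lambda>_::real^'m. 1::real) (\<lambda>_ _. 0) 1" by standard auto
  \<comment> \<open>The product lemma with the constant factor \<open>1\<close> puts
    \<open>T v\<close> itself into \<open>sobolev_W12_0\<close>.\<close>
  have "sobolev_W12_0 \<Omega> (\<lambda>x. T (?v x) *\<^sub>R (1::real))"
    by (rule sobolev_W12_0_product[OF \<Omega>_open \<Omega>_bdd bdry G T const_C1]) simp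
  then have TvW: "sobolev_W12_0 \<Omega> (\<lambda>x. T (R.m (u x) - r))" unfolding v_eq by simp
  have "weak_gradient \<Omega> (\<lambda>x. T (R.m (u x) - r)) (\<lambda>x. \<chi> i. T' (R.m (u x) - r) / R.m (u x) * ((u x - a) \<bullet> G x $ i))"
    using S.sobolev_pair_chain[OF \<Omega>_open \<Omega>_bdd G] by (simp add: sobolev_pair_def)
  note Tv = sobolev_W12_0_zero_gradient[OF \<Omega>_open \<Omega>_bdd TvW this S0]
  have "AE x in lebesgue_on \<Omega>. 0 \<le> T (R.m (u x) - r)"
    using uM
  proof eventually_elim
    case (elim x)
    then show ?case using T1[of "norm (u x - a) - r"] T(5) r_pos by (cases "r < norm (u x - a)") (auto simp: R.m_def max_def)
  qed
  then have "AE x in lebesgue_on \<Omega>. T (R.m (u x) - r) = 0"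
    using Tv by (subst (asm) integral_nonneg_eq_0_iff_AE) auto
  then show ?thesis using uM
  proof eventually_elim
    case (elim x)
    show ?case
    proof (rule ccontr)
      assume "\<not> norm (u x - a) \<le> r"
      then have "0 < T (norm (u x - a) - r)" using T1[of "norm (u x - a) - r"] elim(2) r_pos by simp
      moreover have "R.m (u x) = norm (u x - a)" using \<open>\<not> norm (u x - a) \<le> r\<close> by (simp add: R.m_def)
      ultimately show False using elim(1) by simp
    qed
  qed
qed

end
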